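(* Let $2\le n_1<n_2<n_3$ be integers with $\frac{\log n_1}{\log n_2}=\frac{\log n_2}{\log n_3}$, and let $F\subset[0,1]^3$ be the Bedford--McMullen sponge generated by a set $\mathcal{D}\subset\mathcal{I}_1\times\mathcal{I}_2\times\mathcal{I}_3$ with at least two elements; assume that $F$ has non-uniform fibres. Then, with $f_1,f_2,g_1,g_2$ the functions on $(0,1)$ defined in the context, the Assouad spectrum of $F$ is $$\dim_{\mathrm A}^{\theta}F=\begin{cases} f_1(\theta) & \text{for } 0<\theta\le\frac{\log n_1}{\log n_3},\\ f_2(\theta) & \text{for } \frac{\log n_1}{\log n_3}<\theta\le\frac{\log n_2}{\log n_3},\\ \dim_{\mathrm A}F & \text{for } \frac{\log n_2}{\log n_3}<\theta<1,\end{cases}$$ and the lower spectrum of $F$ is $$\dim_{\mathrm L}^{\theta}F=\begin{cases} g_1(\theta) & \text{for } 0<\theta\le\frac{\log n_1}{\log n_3},\\ g_2(\theta) & \text{for } \frac{\log n_1}{\log n_3}<\theta\le\frac{\log n_2}{\log n_3},\\ \dim_{\mathrm L}F & \text{for } \frac{\log n_2}{\log n_3}<\theta<1.\end{cases}$$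
   Context: **Dimensions.** For bounded $E\subset\mathbb{R}^d$ and $r>0$, $N(E,r)$ is the minimal number of balls of radius $r$ required to cover $E$; $B(x,R)$ is the closed ball with centre $x$ and radius $R$. Let $F\subset\mathbb{R}^d$ be non-empty and compact. - Box dimension: $\dim_{\mathrm B}F=\lim_{r\to0}\frac{\log N(F,r)}{\log(1/r)}$ when the limit exists (it does for Bedford--McMullen sponges). - Assouad dimension: $\dim_{\mathrm A}F$ is the infimum of all $s>0$ for which there is $C>0$ such that $N(B(x,R)\cap F,r)\le C(R/r)^s$ for all $x\in F$ and $0<r<R$. - Lower dimension: $\dim_{\mathrm L}F$ is the supremum of all $s>0$ for which there is $C>0$ such that $N(B(x,R)\cap F,r)\ge C(R/r)^s$ for all $x\in F$ and $0<r<R<1$. - For $\theta\in(0,1)$, the Assouad spectrum $\dim_{\mathrm A}^{\theta}F$ is the infimum of all $s>0$ for which there is $C>0$ such that $N(B(x,R)\cap F,R^{1/\theta})\le C(R/R^{1/\theta})^s$ for all $0<R<1$ and $x\in F$. - For $\theta\in(0,1)$, the lower spectrum $\dim_{\mathrm L}^{\theta}F$ is the supremum of all $s>0$ for which there is $C>0$ such that $N(B(x,R)\cap F,R^{1/\theta})\ge C(R/R^{1/\theta})^s$ for all $0<R<1$ and $x\in F$. The supremum of the empty set is taken to be $0$. **Bedford--McMullen sponges.** Let $2\le n_1<\dots<n_d$ be integers, $\mathcal{I}_q=\{0,\dots,n_q-1\}$, and let $\mathcal{D}\subset\prod_{q=1}^d\mathcal{I}_q$ have at least two elements. For $\bar\imath=(i_1,\dots,i_d)\in\mathcal{D}$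 let $\varphi_{\bar\imath}(x_1,\dots,x_d)=\left(\frac{x_1+i_1}{n_1},\dots,\frac{x_d+i_d}{n_d}\right)$ on $[0,1]^d$. Let $\mathcal{D}^\infty$ be the set of infinite words $\omega=(\bar\imath_1,\bar\imath_2,\dots)$ over $\mathcal{D}$ and $\Pi(\omega)$ the unique point of $\bigcap_{l\in\mathbb{N}}\varphi_{\bar\imath_1}\circ\cdots\circ\varphi_{\bar\imath_l}([0,1]^d)$. The Bedford--McMullen sponge generated by $\mathcal{D}$ is $F=\Pi(\mathcal{D}^\infty)$. For $1\le l\le d$, $\pi_l$ denotes projection of $\mathcal{D}$ onto the first $l$ coordinates, and for $1\le l\le d-1$ and $(i_1,\dots,i_l)\in\pi_l\mathcal{D}$, $$N(i_1,\dots,i_l)=|\{i_{l+1}\in\mathcal{I}_{l+1}:(i_1,\dots,i_l,i_{l+1})\in\pi_{l+1}\mathcal{D}\}|.$$ $F$ has uniform fibres if for every $l=1,\dots,d-1$ the number $N(i_1,\dots,i_l)$ is the same for all $(i_1,\dots,i_l)\in\pi_l\mathcal{D}$; otherwise it has non-uniform fibres. **Notation for $d=3$.** $M_{\max}$, $M_{\min}$ are the maximum and minimum of $N(i_1)$ over $i_1\in\pi_1\mathcal{D}$; $N_{\max}$, $N_{\min}$ are the maximum and minimum of $N(i_1,i_2)$ over $(i_1,i_2)\in\pi_2\mathcal{D}$; $C_{\max}$, $C_{\min}$ are the maximum and minimum over $i_1\in\pi_1\mathcal{D}$ of $\sum_{i_2:(i_1,i_2)\in\pi_2\mathcal{D}}N(i_1,i_2)$.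 For $\theta\in(0,1)$, $$f_1(\theta)=\frac{\dim_{\mathrm B}F-\theta\left(\frac{\log(|\mathcal{D}|/C_{\max})}{\log n_1}+\frac{\log(C_{\max}/N_{\max})}{\log n_2}+\frac{\log N_{\max}}{\log n_3}\right)}{1-\theta},$$ $$f_2(\theta)=\frac{\frac{\log|\pi_1\mathcal{D}|}{\log n_1}+\frac{\log(|\pi_2\mathcal{D}|/|\pi_1\mathcal{D}|)}{\log n_2}+\frac{\log(C_{\max}/M_{\max})}{\log n_3}-\theta\left(\frac{\log(|\pi_2\mathcal{D}|/M_{\max})}{\log n_1}+\frac{\log(C_{\max}/N_{\max})}{\log n_2}+\frac{\log N_{\max}}{\log n_3}\right)}{1-\theta},$$ and $g_1,g_2$ are given by the same formulae as $f_1,f_2$ respectively, with $C_{\max},M_{\max},N_{\max}$ replaced throughout by $C_{\min},M_{\min},N_{\min}$. *)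

theory Defs
  imports "HOL-Analysis.Analysis"
begin

section \<open>Dimensions\<close>

definition covering_number :: "'a::euclidean_space set \<Rightarrow> real \<Rightarrow> nat" where
  "covering_number E r =
     (LEAST k. \<exists>X. finite X \<and> card X = k \<and> E \<subseteq> (\<Union>c\<in>X. cball c r))"

definition box_dim :: "'a::euclidean_space set \<Rightarrow> real" where
  "box_dim F = Lim (at_right 0) (\<lambda>r. ln (real (covering_number F r)) / ln (1 / r))"

text \<open>The library leaves \<open>Sup {}\<close> unspecified on the reals; the dimensions below
  take it to be 0.\<close>

definition Sup0 :: "real set \<Rightarrow> real" where
  "Sup0 S = (if S = {} then 0 else Sup S)"

definition assouad_dim :: "'a::euclidean_space set \<Rightarrow> real" where
  "assouad_dim F = Inf {s. s > 0 \<and> (\<exists>C>0. \<forall>x\<in>F. \<forall>r R. 0 < r \<and> r < R \<longrightarrow>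
     real (covering_number (cball x R \<inter> F) r) \<le> C * (R / r) powr s)}"

definition lower_dim :: "'a::euclidean_space set \<Rightarrow> real" where
  "lower_dim F = Sup0 {s. s > 0 \<and> (\<exists>C>0. \<forall>x\<in>F. \<forall>r R. 0 < r \<and> r < R \<and> R < 1 \<longrightarrow>
     real (covering_number (cball x R \<inter> F) r) \<ge> C * (R / r) powr s)}"

definition assouad_spectrum :: "real \<Rightarrow> 'a::euclidean_space set \<Rightarrow> real" where
  "assouad_spectrum \<theta> F = Inf {s. s > 0 \<and> (\<exists>C>0. \<forall>R. \<forall>x\<in>F. 0 < R \<and> R < 1 \<longrightarrow>
     real (covering_number (cball x R \<inter> F) (R powr (1 / \<theta>)))
       \<le> C * (R / R powr (1 / \<theta>)) powr s)}"

definition lower_spectrum :: "real \<Rightarrow> 'a::euclidean_space set \<Rightarrow> real" where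
  "lower_spectrum \<theta> F = Sup0 {s. s > 0 \<and> (\<exists>C>0. \<forall>R. \<forall>x\<in>F. 0 < R \<and> R < 1 \<longrightarrow>
     real (covering_number (cball x R \<inter> F) (R powr (1 / \<theta>)))
       \<ge> C * (R / R powr (1 / \<theta>)) powr s)}"


section \<open>Bedford--McMullen sponges in \<open>\<real>\<^sup>3\<close>\<close>

type_synonym digit = "nat \<times> nat \<times> nat"

fun bm_map :: "nat \<Rightarrow> nat \<Rightarrow> nat \<Rightarrow> digit \<Rightarrow> real^3 \<Rightarrow> real^3" where
  "bm_map n1 n2 n3 (i1, i2, i3) x =
     vector [(x $ 1 + real i1) / real n1, (x $ 2 + real i2) / real n2, (x $ 3 + real i3) / real n3]"

text \<open>\<open>bm_comp n1 n2 n3 \<omega> l\<close> is the composition of the maps of the first \<open>l\<close> letters of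
  \<open>\<omega>\<close>, the map of the first letter being outermost. Letters are indexed from 0.\<close>

primrec bm_comp :: "nat \<Rightarrow> nat \<Rightarrow> nat \<Rightarrow> (nat \<Rightarrow> digit) \<Rightarrow> nat \<Rightarrow> real^3 \<Rightarrow> real^3" where
  "bm_comp n1 n2 n3 \<omega> 0 = id"
| "bm_comp n1 n2 n3 \<omega> (Suc l) = bm_comp n1 n2 n3 \<omega> l \<circ> bm_map n1 n2 n3 (\<omega> l)"

definition unit_cube :: "(real^3) set" where
  "unit_cube = {x. \<forall>q. 0 \<le> x $ q \<and> x $ q \<le> 1}"

definition bm_coding :: "nat \<Rightarrow> nat \<Rightarrow> nat \<Rightarrow> (nat \<Rightarrow> digit) \<Rightarrow> real^3" where
  "bm_coding n1 n2 n3 \<omega> = (THE x. x \<in> (\<Inter>l. bm_comp n1 n2 n3 \<omega> l ` unit_cube))"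

definition bm_sponge :: "nat \<Rightarrow> nat \<Rightarrow> nat \<Rightarrow> digit set \<Rightarrow> (real^3) set" where
  "bm_sponge n1 n2 n3 D = bm_coding n1 n2 n3 ` {\<omega>. \<forall>l. \<omega> l \<in> D}"

definition proj1 :: "digit set \<Rightarrow> nat set" where
  "proj1 D = (\<lambda>(i1, i2, i3). i1) ` D"

definition proj2 :: "digit set \<Rightarrow> (nat \<times> nat) set" where
  "proj2 D = (\<lambda>(i1, i2, i3). (i1, i2)) ` D"

text \<open>The fibre counts \<open>N(i\<^sub>1)\<close> and \<open>N(i\<^sub>1, i\<^sub>2)\<close>. The range restriction on the counted
  digit is implied by membership in \<open>D\<close>.\<close>

definition fibre1 :: "digit set \<Rightarrow> nat \<Rightarrow> nat" where
  "fibre1 D i1 = card {i2. (i1, i2) \<in> proj2 D}"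

definition fibre2 :: "digit set \<Rightarrow> nat \<times> nat \<Rightarrow> nat" where
  "fibre2 D = (\<lambda>(i1, i2). card {i3. (i1, i2, i3) \<in> D})"

definition column_count :: "digit set \<Rightarrow> nat \<Rightarrow> nat" where
  "column_count D i1 = (\<Sum>i2 | (i1, i2) \<in> proj2 D. fibre2 D (i1, i2))"

definition uniform_fibres :: "digit set \<Rightarrow> bool" where
  "uniform_fibres D \<longleftrightarrow>
     (\<forall>i\<in>proj1 D. \<forall>j\<in>proj1 D. fibre1 D i = fibre1 D j) \<and>
     (\<forall>p\<in>proj2 D. \<forall>q\<in>proj2 D. fibre2 D p = fibre2 D q)"

definition M_max :: "digit set \<Rightarrow> nat" where "M_max D = Max (fibre1 D ` proj1 D)"
definition M_min :: "digit set \<Rightarrow> nat" where "M_min D = Min (fibre1 D ` proj1 D)"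
definition N_max :: "digit set \<Rightarrow> nat" where "N_max D = Max (fibre2 D ` proj2 D)"
definition N_min :: "digit set \<Rightarrow> nat" where "N_min D = Min (fibre2 D ` proj2 D)"
definition C_max :: "digit set \<Rightarrow> nat" where "C_max D = Max (column_count D ` proj1 D)"
definition C_min :: "digit set \<Rightarrow> nat" where "C_min D = Min (column_count D ` proj1 D)"

text \<open>The formulae common to \<open>f\<^sub>1, g\<^sub>1\<close> and to \<open>f\<^sub>2, g\<^sub>2\<close>, with the extremal counts
  \<open>C\<close>, \<open>M\<close>, \<open>N\<close> as parameters.\<close>

definition spectrum_formula1 ::
  "nat \<Rightarrow> nat \<Rightarrow> nat \<Rightarrow> digit set \<Rightarrow> nat \<Rightarrow> nat \<Rightarrow> real \<Rightarrow> real" where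
  "spectrum_formula1 n1 n2 n3 D C N \<theta> =
     (box_dim (bm_sponge n1 n2 n3 D)
       - \<theta> * (ln (real (card D) / real C) / ln (real n1)
              + ln (real C / real N) / ln (real n2)
              + ln (real N) / ln (real n3)))
     / (1 - \<theta>)"

definition spectrum_formula2 ::
  "nat \<Rightarrow> nat \<Rightarrow> nat \<Rightarrow> digit set \<Rightarrow> nat \<Rightarrow> nat \<Rightarrow> nat \<Rightarrow> real \<Rightarrow> real" where
  "spectrum_formula2 n1 n2 n3 D C M N \<theta> =
     (ln (real (card (proj1 D))) / ln (real n1)
       + ln (real (card (proj2 D)) / real (card (proj1 D))) / ln (real n2)
       + ln (real C / real M) / ln (real n3)
       - \<theta> * (ln (real (card (proj2 D)) / real M) / ln (real n1)
              + ln (real C / real N) / ln (real n2)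
              + ln (real N) / ln (real n3)))
     / (1 - \<theta>)"

definition f1 :: "nat \<Rightarrow> nat \<Rightarrow> nat \<Rightarrow> digit set \<Rightarrow> real \<Rightarrow> real" where
  "f1 n1 n2 n3 D = spectrum_formula1 n1 n2 n3 D (C_max D) (N_max D)"

definition f2 :: "nat \<Rightarrow> nat \<Rightarrow> nat \<Rightarrow> digit set \<Rightarrow> real \<Rightarrow> real" where
  "f2 n1 n2 n3 D = spectrum_formula2 n1 n2 n3 D (C_max D) (M_max D) (N_max D)"

definition g1 :: "nat \<Rightarrow> nat \<Rightarrow> nat \<Rightarrow> digit set \<Rightarrow> real \<Rightarrow> real" where
  "g1 n1 n2 n3 D = spectrum_formula1 n1 n2 n3 D (C_min D) (N_min D)"

definition g2 :: "nat \<Rightarrow> nat \<Rightarrow> nat \<Rightarrow> digit set \<Rightarrow> real \<Rightarrow> real" where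
  "g2 n1 n2 n3 D = spectrum_formula2 n1 n2 n3 D (C_min D) (M_min D) (N_min D)"

end

theory Submission imports Defs begin

text \<open>Words over \<open>D\<close> that agree in their first \<open>k q\<close> digits in coordinate \<open>q\<close>, where
  \<open>n\<^sub>q\<close> to the power \<open>- k q\<close> is about \<open>R\<close>, code an approximate cube of side \<open>R\<close>. The number
  of approximate cubes of side \<open>r\<close> inside it is a product over letter positions, the factor at
  position \<open>l\<close> depending only on letter \<open>l\<close> and on how many coordinates of it are fixed at scale
  \<open>R\<close> and at scale \<open>r\<close>. Hence the factors can be maximised or minimised independently, and the
  logarithm of the extremal count is, up to a bounded error, a sum of (number of positions) times
  (logarithm of the extremal factor). For \<open>r = R powr (1 / \<theta>)\<close> the three ranges of \<open>\<theta>\<close> are the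
  three possible interlacings of the levels of \<open>R\<close> and \<open>r\<close>. A ball of radius \<open>R\<close> meets boundedly
  many approximate cubes, which suffices for upper bounds; the sharpness of the lower spectrum
  needs balls meeting just one, minimal, cube.\<close>

subsection \<open>Covering numbers\<close>

text \<open>Six levels, those of \<open>R\<close> and \<open>r\<close> in three coordinates, could
  interlace in more than three ways: \<open>lev R 0\<close> and \<open>lev r 1\<close> change order
  at \<theta> = ln n1 / ln n2, \<open>lev R 1\<close> and \<open>lev r 2\<close> at \<theta> = ln n2
  / ln n3. The hypothesis on the logarithms merges these thresholds. A bounded factor in a radius
  moves each level boundedly and so changes boundedly many factors of the product, all between 1 and
  |D|; hence the constants of the geometry (3, powers of n3) cost only an additive constant in the
  logarithm. The obstacle is that closed cubes touch: near a face of a cube with few subcubes a ball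
  also sees a neighbour, which may have many. The cure is a centre with two distinct consecutive
  digits soon after the recorded ones in every coordinate that is not constant on \<open>D\<close>;
  this costs a bounded factor. The Assouad and lower dimensions turn out to be exponents of the last
  range: sub- and supermultiplicativity of the local counts bound them for all pairs of radii, and a
  single large \<theta> shows sharpness.\<close>

lemma covering_number_le:
  assumes "finite X" "E \<subseteq> (\<Union>c\<in>X. cball c r)"
  shows "covering_number E r \<le> card X"
  unfolding covering_number_def using assms by (intro Least_le) blast

text \<open>\<open>LEAST\<close> over an empty set of numbers is arbitrary, so some finite cover
  must be known before the minimum can be used; \<open>X\<close> is this guarantee, here and in the
  next two lemmas.\<close>

lemma covering_number_attained:
  assumes "finite X" "E \<subseteq> (\<Union>c\<in>X. cball c r)"
  obtains Y where "finite Y" "card Y = covering_number E r" "E \<subseteq> (\<Union>c\<in>Y. cball c r)"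
proof -
  have "\<exists>k Y. finite Y \<and> card Y = k \<and> E \<subseteq> (\<Union>c\<in>Y. cball c r)"
    using assms by blast
  from LeastI_ex[OF this] show ?thesis
    using that unfolding covering_number_def by blast
qed

lemma covering_number_mono:
  assumes "finite X" "B \<subseteq> (\<Union>c\<in>X. cball c r)" "A \<subseteq> B"
  shows "covering_number A r \<le> covering_number B r"
proof -
  obtain Y where "finite Y" "card Y = covering_number B r" "B \<subseteq> (\<Union>c\<in>Y. cball c r)"
    using covering_number_attained[OF assms(1,2)] .
  then show ?thesis
    using covering_number_le[of Y A r] assms(3) by auto
qed

lemma covering_number_pos:
  assumes "finite X" "E \<subseteq> (\<Union>c\<in>X. cball c r)" "E \<noteq> {}"
  shows "covering_number E r > 0"
proof -
  obtain Y where "finite Y" "card Y = covering_number E r" "E \<subseteq> (\<Union>c\<in>Y. cball c r)"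
    using covering_number_attained[OF assms(1,2)] .
  then show ?thesis using assms(3) by (auto simp: card_gt_0_iff simp flip: \<open>card Y = _\<close>)
qed

subsection \<open>Integer prefixes of digit expansions\<close>

text \<open>The first \<open>k\<close> digits read as an integer in base \<open>n\<close> (Horner's
  scheme); divided by \<open>n ^ k\<close> it is the left end of an \<open>n\<close>-adic interval
  of level \<open>k\<close>.\<close>

primrec prefix_num :: "nat \<Rightarrow> (nat \<Rightarrow> nat) \<Rightarrow> nat \<Rightarrow> nat" where
  "prefix_num n d 0 = 0"
| "prefix_num n d (Suc k) = n * prefix_num n d k + d k"

lemma prefix_num_inj:
  assumes "\<And>l. d l < n" "\<And>l. e l < n" "prefix_num n d k = prefix_num n e k" "l < k"
  shows "d l = e l"
  using assms(3,4)
proof (induction k)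
  case (Suc k)
  have "prefix_num n d (Suc k) div n = prefix_num n d k" "prefix_num n d (Suc k) mod n = d k"
    using assms(1)[of k] by auto
  moreover have "prefix_num n e (Suc k) div n = prefix_num n e k" "prefix_num n e (Suc k) mod n = e k"
    using assms(2)[of k] by auto
  ultimately show ?case using Suc by (metis less_SucE)
qed simp

lemma prefix_num_cong: "(\<And>l. l < k \<Longrightarrow> d l = e l) \<Longrightarrow> prefix_num n d k = prefix_num n e k"
  by (induction k) auto

text \<open>Nesting of \<open>n\<close>-adic intervals, scaled to integers: the one of level
  \<open>k + j\<close> lies inside the one of level \<open>k\<close>, on the left by the first bound
  and on the right by the second.\<close>

lemma prefix_num_add_bounds:
  assumes "\<And>l. d l < n"
  shows "n ^ j * prefix_num n d k \<le> prefix_num n d (k + j)"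
    and "prefix_num n d (k + j) + 1 \<le> n ^ j * (prefix_num n d k + 1)"
proof -
  show "n ^ j * prefix_num n d k \<le> prefix_num n d (k + j)"
  proof (induction j)
    case (Suc j)
    have "n * (n ^ j * prefix_num n d k) \<le> n * prefix_num n d (k + j)"
      using Suc by (rule mult_le_mono2)
    then have "n * (n ^ j * prefix_num n d k) \<le> n * prefix_num n d (k + j) + d (k + j)"
      by (rule trans_le_add1)
    then show ?case by (simp add: mult.assoc)
  qed simp
  show "prefix_num n d (k + j) + 1 \<le> n ^ j * (prefix_num n d k + 1)"
  proof (induction j)
    case (Suc j)
    have "prefix_num n d (k + Suc j) + 1 \<le> n * (prefix_num n d (k + j) + 1)"
      using assms[of "k + j"] by simp
    also have "\<dots> \<le> n * (n ^ j * (prefix_num n d k + 1))" using Suc by (rule mult_le_mono2)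
    finally show ?case by (simp only: power_Suc mult.assoc)
  qed simp
qed

text \<open>Two distinct consecutive digits keep the expansion away from both ends of every
  \<open>n\<close>-adic interval of earlier level.\<close>

lemma prefix_num_interior:
  assumes "\<And>l. d l < n" "k \<le> p" "d p \<noteq> d (Suc p)"
  shows "n ^ (p + 2 - k) * prefix_num n d k + 1 \<le> prefix_num n d (p + 2)"
    and "prefix_num n d (p + 2) + 2 \<le> n ^ (p + 2 - k) * (prefix_num n d k + 1)"
proof -
  have n: "2 \<le> n" using assms(1)[of p] assms(1)[of "Suc p"] assms(3) by linarith
  have P: "prefix_num n d (p + 2) = n * (n * prefix_num n d p + d p) + d (Suc p)"
    by (simp add: numeral_2_eq_2)
  have e: "n ^ (p + 2 - k) = n * n * n ^ (p - k)"
    using assms(2) by (simp add: Suc_diff_le numeral_2_eq_2)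
  have "n ^ (p - k) * prefix_num n d k \<le> prefix_num n d p"
    using prefix_num_add_bounds(1)[of d n "p - k" k] assms by simp
  then have a: "n * n * (n ^ (p - k) * prefix_num n d k) \<le> n * n * prefix_num n d p"
    by (rule mult_le_mono2)
  have b: "prefix_num n d p + 1 \<le> n ^ (p - k) * (prefix_num n d k + 1)"
    using prefix_num_add_bounds(2)[of d n k "p - k"] assms by simp
  have b: "n * n * (prefix_num n d p + 1) \<le> n * n * (n ^ (p - k) * (prefix_num n d k + 1))"
    using b by (rule mult_le_mono2)
  \<comment> \<open>The two digits form the number \<open>n * d p + d (Suc p)\<close> below
    \<open>n * n\<close>. Being distinct they are not both 0, which leaves one unit of room on the
    left, and not both \<open>n - 1\<close>, which leaves one on the right (\<open>f\<close>
    below).\<close>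
  have c: "1 \<le> n * d p + d (Suc p)" using assms(3) n by (cases "d p") auto
  have P: "prefix_num n d (p + 2) = n * n * prefix_num n d p + (n * d p + d (Suc p))"
    unfolding P by (simp add: algebra_simps)
  show "n ^ (p + 2 - k) * prefix_num n d k + 1 \<le> prefix_num n d (p + 2)"
    unfolding P e using add_mono[OF a c] by (simp only: mult.assoc)
  have f: "n * d p + d (Suc p) + 2 \<le> n * n"
  proof (cases "d p = n - 1")
    case True
    then have "d (Suc p) + 2 \<le> n" using assms(1)[of "Suc p"] assms(3) by linarith
    moreover have "n * d p + n = n * n" using True n by (cases n) (auto simp: algebra_simps)
    ultimately show ?thesis by linarith
  next
    case False
    then have "d p + 2 \<le> n" using assms(1)[of p] by linarith
    then have "n * (d p + 2) \<le> n * n" by (rule mult_le_mono2)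
    then show ?thesis using assms(1)[of "Suc p"] n by (simp add: algebra_simps)
  qed
  show "prefix_num n d (p + 2) + 2 \<le> n ^ (p + 2 - k) * (prefix_num n d k + 1)"
    unfolding P e using b f unfolding distrib_left mult.assoc mult_1_right by linarith
qed

text \<open>Both inequalities are weak because the cubes are closed. A common end of two intervals
  may therefore have two expansions, and points do not determine prefixes;
  \<open>expands_interior\<close> gives a case in which they do.\<close>

definition expands :: "nat \<Rightarrow> (nat \<Rightarrow> nat) \<Rightarrow> real \<Rightarrow> bool" where
  "expands n d x \<longleftrightarrow> (\<forall>k. real (prefix_num n d k) \<le> x * real n ^ k \<and>
      x * real n ^ k \<le> real (prefix_num n d k) + 1)"

lemma expands_exists:
  assumes "\<And>l. d l < n"
  shows "\<exists>x. expands n d x"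
proof -
  have n: "n > 0" using assms[of 0] by simp
  let ?u = "\<lambda>k. real (prefix_num n d k) / real n ^ k"
  \<comment> \<open>Every left end lies below every right end, whatever the two levels; hence the
    supremum of the left ends belongs to all the intervals.\<close>
  have le: "?u k \<le> (real (prefix_num n d j) + 1) / real n ^ j" for k j
  proof (cases "k \<le> j")
    case True
    have "n ^ (j - k) * prefix_num n d k \<le> prefix_num n d j"
      using prefix_num_add_bounds(1)[of d n "j - k" k] assms True by simp
    then have 1: "real n ^ (j - k) * real (prefix_num n d k) \<le> real (prefix_num n d j)"
      by (metis of_nat_le_iff of_nat_mult of_nat_power)
    have "real n ^ j = real n ^ (j - k) * real n ^ k"
      using True by (simp flip: power_add)
    then have "?u k = real n ^ (j - k) * real (prefix_num n d k) / real n ^ j"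
      using n by simp
    also have "\<dots> \<le> (real (prefix_num n d j) + 1) / real n ^ j"
      using 1 by (intro divide_right_mono) auto
    finally show ?thesis .
  next
    case False
    have "prefix_num n d k + 1 \<le> n ^ (k - j) * (prefix_num n d j + 1)"
      using prefix_num_add_bounds(2)[of d n j "k - j"] assms False by simp
    then have "real (prefix_num n d k + 1) \<le> real (n ^ (k - j) * (prefix_num n d j + 1))"
      by (rule of_nat_mono)
    then have "real (prefix_num n d k) \<le> real n ^ (k - j) * (real (prefix_num n d j) + 1)"
      by (simp add: distrib_left)
    moreover have "real n ^ k = real n ^ (k - j) * real n ^ j"
      using False by (simp flip: power_add)
    ultimately show ?thesis using n
      by (simp add: divide_simps mult.commute)
  qed
  have bdd: "bdd_above (range ?u)" using le[of _ 0] by (intro bdd_aboveI2) auto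
  have "expands n d (SUP k. ?u k)"
    unfolding expands_def
  proof (intro allI conjI)
    fix k
    have "?u k \<le> (SUP k. ?u k)" using bdd by (rule cSUP_upper2) auto
    then show "real (prefix_num n d k) \<le> (SUP k. ?u k) * real n ^ k"
      using n by (simp add: divide_simps)
    have "(SUP k. ?u k) \<le> (real (prefix_num n d k) + 1) / real n ^ k"
      using le by (intro cSUP_least) auto
    then show "(SUP k. ?u k) * real n ^ k \<le> real (prefix_num n d k) + 1"
      using n by (simp add: divide_simps)
  qed
  then show ?thesis ..
qed

lemma expands_close:
  assumes "n > 0" "expands n d x" "expands n e y" "prefix_num n d k = prefix_num n e k"
  shows "\<bar>x - y\<bar> \<le> 1 / real n ^ k"
proof -
  have "\<bar>x * real n ^ k - y * real n ^ k\<bar> \<le> 1"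
    using assms(2,3)[unfolded expands_def, rule_format, of k] assms(4) by linarith
  then have "\<bar>x - y\<bar> * real n ^ k \<le> 1"
    by (simp add: abs_mult flip: left_diff_distrib)
  then show ?thesis using assms(1) by (simp add: divide_simps)
qed

lemma expands_unique:
  assumes "n \<ge> 2" "expands n d x" "expands n d y"
  shows "x = y"
proof (rule ccontr)
  assume "x \<noteq> y"
  then have "0 < \<bar>x - y\<bar>" by simp
  then obtain k where "inverse (real n) ^ k < \<bar>x - y\<bar>"
    using real_arch_pow_inv[of "\<bar>x - y\<bar>" "inverse (real n)"] assms(1)
    by (auto simp: inverse_eq_divide)
  moreover have "\<bar>x - y\<bar> \<le> 1 / real n ^ k"
    using expands_close[of n d x d y k] assms by simp
  ultimately show False by (simp add: power_inverse inverse_eq_divide power_one_over)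
qed

text \<open>In units of \<open>1 / n ^ (p + 2)\<close>, the point \<open>x\<close> keeps distance at
  least 1 from both ends of its interval of level \<open>k\<close>. So \<open>y\<close> lies in the
  open interval, where the prefix is forced whichever expansion of \<open>y\<close> is
  taken.\<close>

lemma expands_interior:
  assumes "\<And>l. d l < n" "\<And>l. e l < n" "expands n d x" "expands n e y"
    and "k \<le> p" "d p \<noteq> d (Suc p)" "\<bar>y - x\<bar> < 1 / real n ^ (p + 2)"
  shows "prefix_num n e k = prefix_num n d k"
proof -
  have n: "n > 0" using assms(1)[of 0] by simp
  define N where "N = real n ^ (p + 2 - k)"
  have N: "N > 0" using n by (simp add: N_def)
  have NN: "real n ^ (p + 2) = N * real n ^ k"
    using assms(5) by (simp add: N_def flip: power_add)
  have "\<bar>y - x\<bar> * real n ^ (p + 2) < 1" using assms(7) n by (simp add: divide_simps)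
  then have d: "\<bar>y * real n ^ (p + 2) - x * real n ^ (p + 2)\<bar> < 1"
    using n by (simp add: abs_mult del: power_Suc flip: left_diff_distrib)
  have "real (n ^ (p + 2 - k) * prefix_num n d k + 1) \<le> real (prefix_num n d (p + 2))"
    using prefix_num_interior(1)[of d n k p] assms by (intro of_nat_mono) auto
  then have 1: "N * real (prefix_num n d k) + 1 \<le> real (prefix_num n d (p + 2))"
    by (simp add: N_def)
  have "real (prefix_num n d (p + 2) + 2) \<le> real (n ^ (p + 2 - k) * (prefix_num n d k + 1))"
    using prefix_num_interior(2)[of d n k p] assms by (intro of_nat_mono) auto
  then have 2: "real (prefix_num n d (p + 2)) + 2 \<le> N * (real (prefix_num n d k) + 1)"
    by (simp add: N_def algebra_simps)
  note ex = assms(3)[unfolded expands_def, rule_format, of "p + 2"]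
  define Y where "Y = N * (y * real n ^ k)"
  have Y: "y * real n ^ (p + 2) = Y" unfolding NN Y_def by simp
  have "N * real (prefix_num n d k) < Y"
    using 1 d ex unfolding Y by linarith
  then have a: "real (prefix_num n d k) < y * real n ^ k" using N by (simp add: Y_def)
  have "Y < N * (real (prefix_num n d k) + 1)"
    using 2 d ex unfolding Y by linarith
  then have b: "y * real n ^ k < real (prefix_num n d k) + 1" using N by (simp add: Y_def)
  show ?thesis using a b assms(4)[unfolded expands_def, rule_format, of k] by linarith
qed

subsection \<open>Patterns of words\<close>

text \<open>Coordinates are indexed by \<open>q = 0, 1, 2\<close>. A level vector \<open>k\<close> says that of a word only
  the first \<open>k q\<close> digits in coordinate \<open>q\<close> are recorded; for \<open>k 2 \<le> k 1 \<le> k 0\<close> this means that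
  the first \<open>depth k l\<close> coordinates of letter \<open>l\<close> are recorded.\<close>

fun digit_coord :: "nat \<Rightarrow> digit \<Rightarrow> nat" where
  "digit_coord q (i1, i2, i3) = (if q = 0 then i1 else if q = 1 then i2 else i3)"

text \<open>Forgotten coordinates become 0 instead of being dropped, so truncations of all depths
  have one type. They are compared at equal depth, where the filler is the same on both
  sides.\<close>

fun trunc :: "nat \<Rightarrow> digit \<Rightarrow> digit" where
  "trunc a (i1, i2, i3) = (if 0 < a then i1 else 0, if 1 < a then i2 else 0, if 2 < a then i3 else 0)"

definition depth :: "(nat \<Rightarrow> nat) \<Rightarrow> nat \<Rightarrow> nat" where
  "depth k l = (if l < k 2 then 3 else if l < k 1 then 2 else if l < k 0 then 1 else 0)"

definition pattern :: "(nat \<Rightarrow> nat) \<Rightarrow> (nat \<Rightarrow> digit) \<Rightarrow> nat \<Rightarrow> digit" where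
  "pattern k \<omega> = (\<lambda>l. trunc (depth k l) (\<omega> l))"

definition decreasing :: "(nat \<Rightarrow> nat) \<Rightarrow> bool" where
  "decreasing k \<longleftrightarrow> k 2 \<le> k 1 \<and> k 1 \<le> k 0"

definition words :: "digit set \<Rightarrow> (nat \<Rightarrow> digit) set" where
  "words D = {\<omega>. \<forall>l. \<omega> l \<in> D}"

definition cyl :: "digit set \<Rightarrow> (nat \<Rightarrow> nat) \<Rightarrow> (nat \<Rightarrow> digit) \<Rightarrow> (nat \<Rightarrow> digit) set" where
  "cyl D k \<omega> = {\<tau> \<in> words D. pattern k \<tau> = pattern k \<omega>}"

text \<open>The factor of the product at one letter position: \<open>a\<close> coordinates of the
  letter are fixed at the coarse scale, \<open>b\<close> are recorded at the fine one. For depths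
  (1,2), (1,3) and (2,3) it is N(i1), the column count and N(i1,i2).\<close>

definition ext_count :: "digit set \<Rightarrow> nat \<Rightarrow> nat \<Rightarrow> digit \<Rightarrow> nat" where
  "ext_count D a b i = card (trunc b ` {j \<in> D. trunc a j = trunc a i})"

definition pattern_count :: "digit set \<Rightarrow> (nat \<Rightarrow> nat) \<Rightarrow> (nat \<Rightarrow> nat) \<Rightarrow> (nat \<Rightarrow> digit) \<Rightarrow> nat" where
  "pattern_count D k m \<omega> = card (pattern m ` cyl D k \<omega>)"

definition ext_max :: "digit set \<Rightarrow> nat \<Rightarrow> nat \<Rightarrow> nat" where
  "ext_max D a b = Max (ext_count D a b ` D)"

definition ext_min :: "digit set \<Rightarrow> nat \<Rightarrow> nat \<Rightarrow> nat" where
  "ext_min D a b = Min (ext_count D a b ` D)"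

lemma all_less_3: "(\<forall>q<3. P q) \<longleftrightarrow> P 0 \<and> P 1 \<and> P (2::nat)"
  by (auto simp: numeral_3_eq_3 numeral_2_eq_2 less_Suc_eq)

lemma trunc_eq_iff: "trunc a i = trunc a j \<longleftrightarrow> (\<forall>q<3. q < a \<longrightarrow> digit_coord q i = digit_coord q j)"
  by (cases i; cases j) (auto simp: all_less_3)

lemma trunc_0 [simp]: "trunc 0 i = (0, 0, 0)"
  by (cases i) auto

lemma trunc_trunc: "trunc a (trunc b i) = trunc (min a b) i"
  by (cases i) auto

lemma depth_le: "depth k l \<le> 3"
  by (auto simp: depth_def)

lemma less_depth_iff: "decreasing k \<Longrightarrow> q < 3 \<Longrightarrow> q < depth k l \<longleftrightarrow> l < k q"
  by (auto simp: decreasing_def depth_def numeral_3_eq_3 numeral_2_eq_2 less_Suc_eq)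

lemma depth_eq_0: "decreasing k \<Longrightarrow> k 0 \<le> l \<Longrightarrow> depth k l = 0"
  by (auto simp: decreasing_def depth_def)

lemma pattern_eq_iff:
  "decreasing k \<Longrightarrow> pattern k \<tau> = pattern k \<omega> \<longleftrightarrow>
     (\<forall>q<3. \<forall>l<k q. digit_coord q (\<tau> l) = digit_coord q (\<omega> l))"
  by (auto simp: pattern_def fun_eq_iff trunc_eq_iff less_depth_iff)

text \<open>Patterns are functions on all of \<open>nat\<close>, but past some position they are
  forced to a constant \<open>z\<close>; extension by \<open>z\<close> is then a bijection from a
  finite product.\<close>

lemma card_product_functions:
  fixes A :: "nat \<Rightarrow> 'a set"
  assumes "\<And>l. l \<ge> L \<Longrightarrow> A l = {z}" "\<And>l. finite (A l)"
  shows "card {f. \<forall>l. f l \<in> A l} = (\<Prod>l<L. card (A l))"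
    and "finite {f. \<forall>l. f l \<in> A l}"
proof -
  let ?e = "\<lambda>g l. if l < L then g l else z"
  have im: "{f. \<forall>l. f l \<in> A l} = ?e ` PiE {..<L} A"
  proof (intro equalityI subsetI)
    fix f assume f: "f \<in> {f. \<forall>l. f l \<in> A l}"
    then have "f = ?e (restrict f {..<L})" using assms(1) by (fastforce simp: fun_eq_iff not_less)
    moreover have "restrict f {..<L} \<in> PiE {..<L} A" using f by auto
    ultimately show "f \<in> ?e ` PiE {..<L} A" by (rule image_eqI)
  next
    fix f assume "f \<in> ?e ` PiE {..<L} A"
    then show "f \<in> {f. \<forall>l. f l \<in> A l}" using assms(1) by (auto simp: PiE_iff not_less)
  qed
  have inj: "inj_on ?e (PiE {..<L} A)"
  proof (rule inj_onI)
    fix g h assume g: "g \<in> PiE {..<L} A" and h: "h \<in> PiE {..<L} A" and e: "?e g = ?e h"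
    show "g = h"
      using g h
    proof (rule PiE_ext)
      fix l assume "l \<in> {..<L}"
      then show "g l = h l" using fun_cong[OF e, of l] by auto
    qed
  qed
  show "card {f. \<forall>l. f l \<in> A l} = (\<Prod>l<L. card (A l))"
    unfolding im by (subst card_image[OF inj]) (simp add: card_PiE)
  show "finite {f. \<forall>l. f l \<in> A l}"
    unfolding im using assms(2) by (intro finite_imageI finite_PiE) auto
qed

section \<open>Pattern counts as products of local counts\<close>

locale digit_set =
  fixes D :: "digit set"
  assumes finite_D: "finite D" and D_nonempty: "D \<noteq> {}"
begin

text \<open>Words are unrestricted sequences over \<open>D\<close>, so admissible letters can be
  chosen separately at each position and every choice is realised: the image is a full product
  set.\<close>

lemma pattern_image_cyl:
  "pattern m ` cyl D k \<omega> =
     {f. \<forall>l. f l \<in> trunc (depth m l) ` {j \<in> D. trunc (depth k l) j = trunc (depth k l) (\<omega> l)}}"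
  (is "_ = {f. \<forall>l. f l \<in> ?A l}")
proof (intro equalityI subsetI)
  fix f assume "f \<in> {f. \<forall>l. f l \<in> ?A l}"
  then have "\<forall>l. \<exists>j. j \<in> D \<and> trunc (depth k l) j = trunc (depth k l) (\<omega> l) \<and> f l = trunc (depth m l) j"
    by blast
  then obtain \<tau> where "\<forall>l. \<tau> l \<in> D \<and> trunc (depth k l) (\<tau> l) = trunc (depth k l) (\<omega> l) \<and>
      f l = trunc (depth m l) (\<tau> l)"
    by metis
  then have "\<tau> \<in> cyl D k \<omega>" "f = pattern m \<tau>"
    by (auto simp: cyl_def words_def pattern_def)
  then show "f \<in> pattern m ` cyl D k \<omega>" by blast
next
  fix f assume "f \<in> pattern m ` cyl D k \<omega>"
  then obtain \<tau> where t: "\<tau> \<in> words D" "pattern k \<tau> = pattern k \<omega>" "f = pattern m \<tau>"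
    by (auto simp: cyl_def)
  then show "f \<in> {f. \<forall>l. f l \<in> ?A l}"
    using fun_cong[OF t(2)] unfolding words_def pattern_def t(3)[unfolded pattern_def]
    by (intro CollectI allI imageI conjI) simp_all
qed

lemma
  assumes "decreasing m" "\<omega> \<in> words D"
  shows pattern_count_eq_prod:
      "pattern_count D k m \<omega> = (\<Prod>l<m 0. ext_count D (depth k l) (depth m l) (\<omega> l))"
    and finite_pattern_image: "finite (pattern m ` cyl D k \<omega>)"
proof -
  let ?A = "\<lambda>l. trunc (depth m l) ` {j \<in> D. trunc (depth k l) j = trunc (depth k l) (\<omega> l)}"
  have 1: "?A l = {(0, 0, 0)}" if "l \<ge> m 0" for l
    using assms depth_eq_0[OF assms(1) that] by (auto simp: words_def)
  have 2: "finite (?A l)" for l using finite_D by simp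
  show "pattern_count D k m \<omega> = (\<Prod>l<m 0. ext_count D (depth k l) (depth m l) (\<omega> l))"
    unfolding pattern_count_def pattern_image_cyl ext_count_def
    by (rule card_product_functions(1)[OF 1 2])
  show "finite (pattern m ` cyl D k \<omega>)"
    unfolding pattern_image_cyl by (rule card_product_functions(2)[OF 1 2])
qed

lemma ext_count_pos: "i \<in> D \<Longrightarrow> ext_count D a b i > 0"
proof -
  assume "i \<in> D"
  then have "trunc b i \<in> trunc b ` {j \<in> D. trunc a j = trunc a i}" by (intro imageI) simp
  moreover have "finite (trunc b ` {j \<in> D. trunc a j = trunc a i})" using finite_D by simp
  ultimately show ?thesis unfolding ext_count_def card_gt_0_iff by blast
qed

lemma ext_count_le_card: "ext_count D a b i \<le> card D"
  unfolding ext_count_def using finite_D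
  by (intro order_trans[OF card_image_le] card_mono) auto

lemma ext_count_trivial: "i \<in> D \<Longrightarrow> b \<le> a \<Longrightarrow> ext_count D a b i = 1"
proof -
  assume "i \<in> D" "b \<le> a"
  have "trunc b j = trunc b i" if "trunc a j = trunc a i" for j
    using arg_cong[OF that, of "trunc b"] \<open>b \<le> a\<close> by (simp add: trunc_trunc min_absorb1)
  then have "trunc b ` {j \<in> D. trunc a j = trunc a i} = {trunc b i}"
    using \<open>i \<in> D\<close> by blast
  then show ?thesis by (simp add: ext_count_def)
qed

lemma ext_count_le_max: "i \<in> D \<Longrightarrow> ext_count D a b i \<le> ext_max D a b"
  unfolding ext_max_def using finite_D by (intro Max_ge) auto

lemma ext_min_le_count: "i \<in> D \<Longrightarrow> ext_min D a b \<le> ext_count D a b i"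
  unfolding ext_min_def using finite_D by (intro Min_le) auto

lemma ext_max_attained: "\<exists>i\<in>D. ext_count D a b i = ext_max D a b"
proof -
  have "ext_max D a b \<in> ext_count D a b ` D"
    unfolding ext_max_def using finite_D D_nonempty by (intro Max_in) simp_all
  then show ?thesis by (metis imageE)
qed

lemma ext_min_attained: "\<exists>i\<in>D. ext_count D a b i = ext_min D a b"
proof -
  have "ext_min D a b \<in> ext_count D a b ` D"
    unfolding ext_min_def using finite_D D_nonempty by (intro Min_in) simp_all
  then show ?thesis by (metis imageE)
qed

lemma ext_max_pos: "ext_max D a b > 0" and ext_min_pos: "ext_min D a b > 0"
  and ext_max_le_card: "ext_max D a b \<le> card D" and ext_min_le_card: "ext_min D a b \<le> card D"
  using ext_max_attained[of a b] ext_min_attained[of a b] ext_count_pos[of _ a b]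
    ext_count_le_card[of a b] by metis+

lemma ext_max_trivial: "b \<le> a \<Longrightarrow> ext_max D a b = 1" and ext_min_trivial: "b \<le> a \<Longrightarrow> ext_min D a b = 1"
  using ext_max_attained[of a b] ext_min_attained[of a b] ext_count_trivial[of _ b a] by metis+

text \<open>A truncation of depth \<open>c\<close> determines that of depth \<open>b\<close>, so
  sorting by the latter is a partition. Bounding the number of classes and their sizes gives the
  next two lemmas.\<close>

lemma ext_count_split:
  assumes "i \<in> D" "a \<le> b" "b \<le> c"
  shows "ext_count D a c i =
    (\<Sum>p\<in>trunc b ` {j \<in> D. trunc a j = trunc a i}. card (trunc c ` {j \<in> D. trunc b j = p}))"
proof -
  let ?S = "{j \<in> D. trunc a j = trunc a i}"
  have aux: "trunc a j = trunc a j'" if "trunc b j = trunc b j'" for j j'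
    using arg_cong[OF that, of "trunc a"] assms by (simp add: trunc_trunc min_absorb1)
  have aux': "trunc b j = trunc b j'" if "trunc c j = trunc c j'" for j j'
    using arg_cong[OF that, of "trunc b"] assms by (simp add: trunc_trunc min_absorb1)
  have "trunc c ` ?S = (\<Union>p\<in>trunc b ` ?S. trunc c ` {j \<in> D. trunc b j = p})"
  proof (intro equalityI subsetI)
    fix x assume "x \<in> (\<Union>p\<in>trunc b ` ?S. trunc c ` {j \<in> D. trunc b j = p})"
    then obtain p where p: "p \<in> trunc b ` ?S" "x \<in> trunc c ` {j \<in> D. trunc b j = p}"
      by (rule UN_E)
    obtain j' where j': "j' \<in> ?S" "p = trunc b j'" using p(1) by (rule imageE)
    obtain j where j: "j \<in> D" "trunc b j = p" "x = trunc c j" using p(2) by blast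
    have "trunc a j = trunc a j'" by (rule aux) (use j j' in simp)
    then have "j \<in> ?S" using j(1) j'(1) by simp
    then show "x \<in> trunc c ` ?S" using j(3) by blast
  qed blast
  moreover have "card (\<Union>p\<in>trunc b ` ?S. trunc c ` {j \<in> D. trunc b j = p}) =
      (\<Sum>p\<in>trunc b ` ?S. card (trunc c ` {j \<in> D. trunc b j = p}))"
  proof (rule card_UN_disjoint)
    show "\<forall>p\<in>trunc b ` ?S. \<forall>p'\<in>trunc b ` ?S. p \<noteq> p' \<longrightarrow>
        trunc c ` {j \<in> D. trunc b j = p} \<inter> trunc c ` {j \<in> D. trunc b j = p'} = {}"
      using aux' by blast
  qed (use finite_D in simp_all)
  ultimately show ?thesis by (simp add: ext_count_def)
qed

lemma ext_max_submult:
  assumes "a \<le> b" "b \<le> c"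
  shows "ext_max D a c \<le> ext_max D a b * ext_max D b c"
proof -
  obtain i where i: "i \<in> D" "ext_count D a c i = ext_max D a c" using ext_max_attained by blast
  have "ext_max D a c \<le> of_nat (card (trunc b ` {j \<in> D. trunc a j = trunc a i})) * ext_max D b c"
    unfolding i(2)[symmetric] ext_count_split[OF i(1) assms]
    using ext_count_le_max[of _ b c] by (intro sum_bounded_above) (auto simp: ext_count_def)
  also have "\<dots> \<le> ext_max D a b * ext_max D b c"
    using ext_count_le_max[OF i(1), of a b] by (simp add: ext_count_def)
  finally show ?thesis .
qed

lemma ext_min_supermult:
  assumes "a \<le> b" "b \<le> c"
  shows "ext_min D a b * ext_min D b c \<le> ext_min D a c"
proof -
  obtain i where i: "i \<in> D" "ext_count D a c i = ext_min D a c" using ext_min_attained by blast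
  have "ext_min D a b * ext_min D b c \<le> of_nat (card (trunc b ` {j \<in> D. trunc a j = trunc a i})) * ext_min D b c"
    using ext_min_le_count[OF i(1), of a b] by (simp add: ext_count_def)
  also have "\<dots> \<le> ext_min D a c"
    unfolding i(2)[symmetric] ext_count_split[OF i(1) assms]
    using ext_min_le_count[of _ b c] by (intro sum_bounded_below) (auto simp: ext_count_def)
  finally show ?thesis .
qed

section \<open>Local counts in terms of fibre counts\<close>

lemma ext_count_0: "i \<in> D \<Longrightarrow> ext_count D 0 b i = card (trunc b ` D)"
  by (simp add: ext_count_def)

text \<open>With no coordinate fixed the count is the same for every letter; this is why the
  cardinalities of \<open>D\<close> and its projections enter the formulae of both spectra
  alike.\<close>

lemma ext_max_0: "ext_max D 0 b = card (trunc b ` D)" and ext_min_0: "ext_min D 0 b = card (trunc b ` D)"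
  using ext_max_attained[of 0 b] ext_min_attained[of 0 b] ext_count_0 by metis+

lemma card_trunc_image:
  "card (trunc (Suc 0) ` D) = card (proj1 D)"
  "card (trunc 2 ` D) = card (proj2 D)"
  "card (trunc 3 ` D) = card D"
proof -
  have "trunc (Suc 0) ` D = (\<lambda>i. (i, 0, 0)) ` proj1 D" by (force simp: proj1_def)
  then show "card (trunc (Suc 0) ` D) = card (proj1 D)"
    by (simp add: card_image inj_on_def)
  have "trunc 2 ` D = (\<lambda>(i, j). (i, j, 0)) ` proj2 D" by (force simp: proj2_def)
  then show "card (trunc 2 ` D) = card (proj2 D)"
    by (simp add: card_image inj_on_def split_beta prod_eq_iff)
  have "trunc 3 ` D = D" by force
  then show "card (trunc 3 ` D) = card D" by simp
qed

lemma ext_count_1_2: "(i1, i2, i3) \<in> D \<Longrightarrow> ext_count D (Suc 0) 2 (i1, i2, i3) = fibre1 D i1"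
proof -
  have "trunc 2 ` {j \<in> D. trunc (Suc 0) j = trunc (Suc 0) (i1, i2, i3)} =
      (\<lambda>j. (i1, j, 0)) ` {j. (i1, j) \<in> proj2 D}"
    by (force simp: proj2_def)
  then show ?thesis by (simp add: ext_count_def fibre1_def card_image inj_on_def)
qed

lemma ext_count_2_3: "(i1, i2, i3) \<in> D \<Longrightarrow> ext_count D 2 3 (i1, i2, i3) = fibre2 D (i1, i2)"
proof -
  have "trunc 3 ` {j \<in> D. trunc 2 j = trunc 2 (i1, i2, i3)} =
      (\<lambda>j. (i1, i2, j)) ` {j. (i1, i2, j) \<in> D}"
    by force
  then show ?thesis by (simp add: ext_count_def fibre2_def card_image inj_on_def)
qed

lemma ext_count_1_3: "(i1, i2, i3) \<in> D \<Longrightarrow> ext_count D (Suc 0) 3 (i1, i2, i3) = column_count D i1"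
proof -
  assume i: "(i1, i2, i3) \<in> D"
  have e: "trunc 2 ` {j \<in> D. trunc (Suc 0) j = trunc (Suc 0) (i1, i2, i3)} =
      (\<lambda>j. (i1, j, 0)) ` {j. (i1, j) \<in> proj2 D}"
    by (force simp: proj2_def)
  have "ext_count D (Suc 0) 3 (i1, i2, i3) =
      (\<Sum>j | (i1, j) \<in> proj2 D. card (trunc 3 ` {i \<in> D. trunc 2 i = (i1, j, 0)}))"
    by (subst ext_count_split[OF i, of "Suc 0" 2 3], simp, simp, unfold e, rule sum.reindex_cong)
      (auto intro: inj_onI)
  also have "\<dots> = column_count D i1"
    unfolding column_count_def
  proof (rule sum.cong)
    fix j assume "j \<in> {j. (i1, j) \<in> proj2 D}"
    have "trunc 3 ` {i \<in> D. trunc 2 i = (i1, j, 0)} = (\<lambda>k. (i1, j, k)) ` {k. (i1, j, k) \<in> D}"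
      by force
    then show "card (trunc 3 ` {i \<in> D. trunc 2 i = (i1, j, 0)}) = fibre2 D (i1, j)"
      by (simp add: fibre2_def card_image inj_on_def)
  qed simp
  finally show ?thesis .
qed

lemma ext_count_images:
  "ext_count D (Suc 0) 2 ` D = fibre1 D ` proj1 D"
  "ext_count D (Suc 0) 3 ` D = column_count D ` proj1 D"
  "ext_count D 2 3 ` D = fibre2 D ` proj2 D"
proof -
  have "ext_count D (Suc 0) 2 ` D = (\<lambda>(i1, i2, i3). fibre1 D i1) ` D"
    by (intro image_cong) (auto simp: ext_count_1_2)
  then show "ext_count D (Suc 0) 2 ` D = fibre1 D ` proj1 D"
    by (simp add: proj1_def image_image split_beta)
  have "ext_count D (Suc 0) 3 ` D = (\<lambda>(i1, i2, i3). column_count D i1) ` D"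
    by (intro image_cong) (auto simp: ext_count_1_3)
  then show "ext_count D (Suc 0) 3 ` D = column_count D ` proj1 D"
    by (simp add: proj1_def image_image split_beta)
  have "ext_count D 2 3 ` D = (\<lambda>(i1, i2, i3). fibre2 D (i1, i2)) ` D"
    by (intro image_cong) (auto simp: ext_count_2_3)
  then show "ext_count D 2 3 ` D = fibre2 D ` proj2 D"
    by (simp add: proj2_def image_image split_beta)
qed

lemma ext_max_eqs:
  "ext_max D 0 (Suc 0) = card (proj1 D)" "ext_max D 0 2 = card (proj2 D)" "ext_max D 0 3 = card D"
  "ext_max D (Suc 0) 2 = M_max D" "ext_max D (Suc 0) 3 = C_max D" "ext_max D 2 3 = N_max D"
  by (simp_all add: ext_max_0 card_trunc_image)
    (simp_all add: ext_max_def M_max_def C_max_def N_max_def ext_count_images)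

lemma ext_min_eqs:
  "ext_min D 0 (Suc 0) = card (proj1 D)" "ext_min D 0 2 = card (proj2 D)" "ext_min D 0 3 = card D"
  "ext_min D (Suc 0) 2 = M_min D" "ext_min D (Suc 0) 3 = C_min D" "ext_min D 2 3 = N_min D"
  by (simp_all add: ext_min_0 card_trunc_image)
    (simp_all add: ext_min_def M_min_def C_min_def N_min_def ext_count_images)

end

subsection \<open>Geometry of the coding map\<close>

text \<open>Natural indices from 0 allow one quantifier \<open>q < 3\<close> for points, levels,
  bases and digits together. All indices from 2 on mean the third coordinate, as in
  \<open>digit_coord\<close> and \<open>base\<close>.\<close>

definition coord :: "nat \<Rightarrow> real^3 \<Rightarrow> real" where
  "coord q x = (if q = 0 then x $ 1 else if q = 1 then x $ 2 else x $ 3)"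

lemma abs_coord_diff_le_dist: "\<bar>coord q x - coord q y\<bar> \<le> dist x y"
  using component_le_norm_cart[of "x - y"] by (auto simp: coord_def dist_norm)

text \<open>The Euclidean norm is bounded by the sum of the three coordinates. The resulting factor
  3 in radii is crude but costs only boundedly many levels.\<close>

lemma dist_le_coord:
  assumes "\<And>q. q < 3 \<Longrightarrow> \<bar>coord q x - coord q y\<bar> \<le> e / 3"
  shows "dist x y \<le> e"
  using norm_le_l1_cart[of "x - y"] assms[of 0] assms[of 1] assms[of 2]
  by (simp add: sum_3 coord_def dist_norm)

lemma vec3_eqI: "(\<And>q. q < 3 \<Longrightarrow> coord q x = coord q y) \<Longrightarrow> x = y"
  using dist_le_coord[of x y 0] by simp

lemma vec3_coord_exists:
  assumes "\<And>q. q < 3 \<Longrightarrow> \<exists>z. P q z"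
  shows "\<exists>x. \<forall>q<3. P q (coord q x)"
proof -
  obtain z where "\<And>q. q < 3 \<Longrightarrow> P q (z q)" using assms by metis
  then have "\<forall>q<3. P q (coord q (vector [z 0, z 1, z 2]))"
    by (auto simp: all_less_3 coord_def)
  then show ?thesis ..
qed

lemma card_nat_near_le_4: "card {p::nat. t - 2 \<le> real p \<and> real p \<le> t + 1} \<le> 4"
  and finite_nat_near: "finite {p::nat. t - 2 \<le> real p \<and> real p \<le> t + 1}"
proof -
  have "int ` {p::nat. t - 2 \<le> real p \<and> real p \<le> t + 1} \<subseteq> {\<lfloor>t\<rfloor> - 2..\<lfloor>t\<rfloor> + 1}"
    by auto linarith+
  then have "card {p::nat. t - 2 \<le> real p \<and> real p \<le> t + 1} \<le> card {\<lfloor>t\<rfloor> - 2..\<lfloor>t\<rfloor> + 1}"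
    by (rule card_inj_on_le[rotated]) auto
  then show "card {p::nat. t - 2 \<le> real p \<and> real p \<le> t + 1} \<le> 4" by simp
  have "{p::nat. t - 2 \<le> real p \<and> real p \<le> t + 1} \<subseteq> {..nat \<lceil>t + 1\<rceil>}"
    by auto linarith
  then show "finite {p::nat. t - 2 \<le> real p \<and> real p \<le> t + 1}"
    by (rule finite_subset) simp
qed

section \<open>The sponge described by digit expansions\<close>

locale bm_digits =
  fixes n1 n2 n3 :: nat and D :: "digit set"
  assumes n1: "2 \<le> n1" and n12: "n1 < n2" and n23: "n2 < n3"
    and D_sub: "D \<subseteq> {..<n1} \<times> {..<n2} \<times> {..<n3}" and D_ne: "D \<noteq> {}"
begin

sublocale digit_set D
  using finite_subset[OF D_sub] D_ne by unfold_locales auto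

definition base :: "nat \<Rightarrow> nat" where
  "base q = (if q = 0 then n1 else if q = 1 then n2 else n3)"

definition pnum :: "nat \<Rightarrow> (nat \<Rightarrow> digit) \<Rightarrow> nat \<Rightarrow> nat" where
  "pnum q \<omega> k = prefix_num (base q) (\<lambda>l. digit_coord q (\<omega> l)) k"

abbreviation pt :: "(nat \<Rightarrow> digit) \<Rightarrow> real^3" where
  "pt \<equiv> bm_coding n1 n2 n3"

abbreviation F :: "(real^3) set" where
  "F \<equiv> bm_sponge n1 n2 n3 D"

lemma F_eq: "F = pt ` words D"
  by (simp add: bm_sponge_def words_def)

lemma words_nonempty: "words D \<noteq> {}"
  using D_ne by (auto simp: words_def)

lemma base_ge: "base q \<ge> 2"
  using n1 n12 n23 by (simp add: base_def)

lemma base_mono: "q \<le> q' \<Longrightarrow> base q \<le> base q'"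
  using n12 n23 by (auto simp: base_def)

lemma base_le: "base q \<le> n3"
  using n12 n23 by (auto simp: base_def)

lemma digit_less_base: "i \<in> D \<Longrightarrow> digit_coord q i < base q"
  using D_sub by (cases i) (auto simp: base_def)

lemma words_digit_less: "\<omega> \<in> words D \<Longrightarrow> digit_coord q (\<omega> l) < base q"
  using digit_less_base by (simp add: words_def)

lemma coord_bm_map: "coord q (bm_map n1 n2 n3 i x) = (coord q x + real (digit_coord q i)) / real (base q)"
  by (cases i) (auto simp: coord_def base_def)

lemma coord_bm_comp:
  "coord q (bm_comp n1 n2 n3 \<omega> l x) = (coord q x + real (pnum q \<omega> l)) / real (base q) ^ l"
proof (induction l arbitrary: x)
  case (Suc l)
  have "base q > 0" using base_ge[of q] by simp
  then show ?case by (simp add: Suc coord_bm_map pnum_def field_simps)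
qed (simp add: pnum_def)

lemma unit_cube_iff: "x \<in> unit_cube \<longleftrightarrow> (\<forall>q<3. 0 \<le> coord q x \<and> coord q x \<le> 1)"
  by (auto simp: unit_cube_def all_less_3 coord_def forall_3)

lemma bm_comp_image:
  "bm_comp n1 n2 n3 \<omega> l ` unit_cube = {x. \<forall>q<3. real (pnum q \<omega> l) \<le> coord q x * real (base q) ^ l \<and>
     coord q x * real (base q) ^ l \<le> real (pnum q \<omega> l) + 1}"
proof (intro equalityI subsetI)
  have b: "base q > 0" for q using base_ge[of q] by simp
  fix x assume "x \<in> bm_comp n1 n2 n3 \<omega> l ` unit_cube"
  then obtain y where "y \<in> unit_cube" "x = bm_comp n1 n2 n3 \<omega> l y" by blast
  then show "x \<in> {x. \<forall>q<3. real (pnum q \<omega> l) \<le> coord q x * real (base q) ^ l \<and>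
     coord q x * real (base q) ^ l \<le> real (pnum q \<omega> l) + 1}"
    using b by (auto simp: coord_bm_comp unit_cube_iff)
next
  have b: "base q > 0" for q using base_ge[of q] by simp
  fix x assume x: "x \<in> {x. \<forall>q<3. real (pnum q \<omega> l) \<le> coord q x * real (base q) ^ l \<and>
     coord q x * real (base q) ^ l \<le> real (pnum q \<omega> l) + 1}"
  obtain y where y: "\<forall>q<3. coord q y = coord q x * real (base q) ^ l - real (pnum q \<omega> l)"
    using vec3_coord_exists[of "\<lambda>q z. z = coord q x * real (base q) ^ l - real (pnum q \<omega> l)"] by blast
  then have "y \<in> unit_cube" using x by (auto simp: unit_cube_iff)
  moreover have "x = bm_comp n1 n2 n3 \<omega> l y"
    using y b by (intro vec3_eqI) (simp add: coord_bm_comp)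
  ultimately show "x \<in> bm_comp n1 n2 n3 \<omega> l ` unit_cube" by blast
qed

lemma Inter_bm_comp_iff:
  "x \<in> (\<Inter>l. bm_comp n1 n2 n3 \<omega> l ` unit_cube) \<longleftrightarrow>
     (\<forall>q<3. expands (base q) (\<lambda>l. digit_coord q (\<omega> l)) (coord q x))"
  unfolding bm_comp_image by (auto simp: expands_def pnum_def)

text \<open>The definite description in \<open>bm_coding\<close> has to be justified: the condition
  of lying in all cubes splits into one condition \<open>expands\<close> per coordinate, each with
  exactly one solution.\<close>

lemma pt_expands:
  assumes "\<omega> \<in> words D" "q < 3"
  shows "expands (base q) (\<lambda>l. digit_coord q (\<omega> l)) (coord q (pt \<omega>))"
proof -
  have "\<exists>x. \<forall>q<3. expands (base q) (\<lambda>l. digit_coord q (\<omega> l)) (coord q x)"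
    using words_digit_less[OF assms(1)] by (intro vec3_coord_exists expands_exists)
  then obtain x where x: "x \<in> (\<Inter>l. bm_comp n1 n2 n3 \<omega> l ` unit_cube)"
    unfolding Inter_bm_comp_iff by blast
  have "y = x" if "y \<in> (\<Inter>l. bm_comp n1 n2 n3 \<omega> l ` unit_cube)" for y
    using x that unfolding Inter_bm_comp_iff
    by (intro vec3_eqI) (metis expands_unique base_ge)
  then have "pt \<omega> = x" unfolding bm_coding_def using x by (rule the_equality[rotated])
  then show ?thesis using x assms(2) unfolding Inter_bm_comp_iff by blast
qed

text \<open>The bridge from combinatorics to geometry: digits lie below the base, so agreement of
  the first digits is equality of one integer per coordinate, and this integer is known from the
  position of the point up to a bounded ambiguity.\<close>

lemma pattern_eq_iff_pnum:
  assumes "decreasing k" "\<tau> \<in> words D" "\<omega> \<in> words D"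
  shows "pattern k \<tau> = pattern k \<omega> \<longleftrightarrow> (\<forall>q<3. pnum q \<tau> (k q) = pnum q \<omega> (k q))"
proof -
  have "(\<forall>l<K. digit_coord q (\<tau> l) = digit_coord q (\<omega> l)) \<longleftrightarrow> pnum q \<tau> K = pnum q \<omega> K" for q K
    unfolding pnum_def
    using prefix_num_inj[of "\<lambda>l. digit_coord q (\<tau> l)" "base q" "\<lambda>l. digit_coord q (\<omega> l)" K]
      prefix_num_cong[of K "\<lambda>l. digit_coord q (\<tau> l)" "\<lambda>l. digit_coord q (\<omega> l)" "base q"]
      words_digit_less[OF assms(2)] words_digit_less[OF assms(3)] by metis
  then show ?thesis unfolding pattern_eq_iff[OF assms(1)] by simp
qed

lemma cyl_image_subset_cball:
  assumes "decreasing k" "\<omega> \<in> words D" "\<And>q. q < 3 \<Longrightarrow> 1 / real (base q) ^ k q \<le> \<rho> / 3"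
  shows "pt ` cyl D k \<omega> \<subseteq> cball (pt \<omega>) \<rho>"
proof clarsimp
  fix \<tau> assume "\<tau> \<in> cyl D k \<omega>"
  then have t: "\<tau> \<in> words D" "\<And>q. q < 3 \<Longrightarrow> pnum q \<tau> (k q) = pnum q \<omega> (k q)"
    using pattern_eq_iff_pnum assms(1,2) by (auto simp: cyl_def)
  show "dist (pt \<omega>) (pt \<tau>) \<le> \<rho>"
  proof (rule dist_le_coord)
    fix q :: nat assume "q < 3"
    then show "\<bar>coord q (pt \<omega>) - coord q (pt \<tau>)\<bar> \<le> \<rho> / 3"
      using expands_close[OF _ pt_expands[OF assms(2)] pt_expands[OF t(1)], of q "k q"]
        t(2)[of q] assms(3)[of q] base_ge[of q] by (simp add: pnum_def)
  qed
qed

section \<open>Covering numbers compared with pattern counts\<close>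

lemma cyl_0: "cyl D (\<lambda>_. 0) \<omega> = words D"
  by (simp add: cyl_def pattern_def depth_def)

lemma finite_pattern_words:
  assumes "decreasing m" "S \<subseteq> words D"
  shows "finite (pattern m ` S)"
proof -
  obtain \<omega> where "\<omega> \<in> words D" using words_nonempty by blast
  from finite_pattern_image[OF assms(1) this, of "\<lambda>_. 0"] show ?thesis
    unfolding cyl_0 using assms(2) by (metis finite_subset image_mono)
qed

text \<open>In units of the side at level \<open>k q\<close> the ball has radius at most 1 and a
  point exceeds its prefix number by at most 1, so that number lies in an interval of length 3,
  which holds four integers; three coordinates give 64. At level 0, which occurs for large radii,
  the prefix number is 0.\<close>

lemma card_patterns_in_ball:
  assumes "decreasing k" "\<And>q. q < 3 \<Longrightarrow> k q = 0 \<or> \<rho> * real (base q) ^ k q \<le> 1"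
  shows "card (pattern k ` {\<tau> \<in> words D. pt \<tau> \<in> cball c \<rho>}) \<le> 64"
proof -
  let ?T = "{\<tau> \<in> words D. pt \<tau> \<in> cball c \<rho>}"
  have "\<exists>A. finite A \<and> card A \<le> 4 \<and> (\<forall>\<tau>\<in>?T. pnum q \<tau> (k q) \<in> A)" if q: "q < 3" for q
  proof (cases "k q = 0")
    case True
    then show ?thesis by (intro exI[of _ "{0}"]) (simp add: pnum_def)
  next
    case False
    then have r: "\<rho> * real (base q) ^ k q \<le> 1" using assms(2)[OF q] by simp
    let ?t = "coord q c * real (base q) ^ k q"
    have "?t - 2 \<le> real (pnum q \<tau> (k q)) \<and> real (pnum q \<tau> (k q)) \<le> ?t + 1" if "\<tau> \<in> ?T" for \<tau>
    proof -
      have "\<bar>coord q c - coord q (pt \<tau>)\<bar> \<le> \<rho>"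
        using abs_coord_diff_le_dist[of q c "pt \<tau>"] that by simp
      then have "\<bar>coord q c - coord q (pt \<tau>)\<bar> * real (base q) ^ k q \<le> 1"
        using r by (meson mult_right_mono of_nat_0_le_iff order_trans zero_le_power)
      then have "\<bar>?t - coord q (pt \<tau>) * real (base q) ^ k q\<bar> \<le> 1"
        by (simp add: abs_mult flip: left_diff_distrib)
      moreover have "real (pnum q \<tau> (k q)) \<le> coord q (pt \<tau>) * real (base q) ^ k q"
         "coord q (pt \<tau>) * real (base q) ^ k q \<le> real (pnum q \<tau> (k q)) + 1"
        using pt_expands[of \<tau> q] that q by (auto simp: expands_def pnum_def)
      ultimately show ?thesis by linarith
    qed
    then have "\<forall>\<tau>\<in>?T. pnum q \<tau> (k q) \<in> {p::nat. ?t - 2 \<le> real p \<and> real p \<le> ?t + 1}"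
      by (intro ballI CollectI)
    then show ?thesis
      by (intro exI[of _ "{p::nat. ?t - 2 \<le> real p \<and> real p \<le> ?t + 1}"] conjI
          card_nat_near_le_4 finite_nat_near)
  qed
  then have "\<forall>q\<in>{..<3}. \<exists>A. finite A \<and> card A \<le> 4 \<and> (\<forall>\<tau>\<in>?T. pnum q \<tau> (k q) \<in> A)"
    by (intro ballI) (simp only: lessThan_iff)
  from bchoice[OF this] obtain A where A:
    "\<forall>q\<in>{..<3}. finite (A q) \<and> card (A q) \<le> 4 \<and> (\<forall>\<tau>\<in>?T. pnum q \<tau> (k q) \<in> A q)" ..
  have A: "finite (A q) \<and> card (A q) \<le> 4 \<and> (\<forall>\<tau>\<in>?T. pnum q \<tau> (k q) \<in> A q)" if "q < 3" for q
    by (rule bspec[OF A]) (simp add: that)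
  \<comment> \<open>The pattern is a function of the three prefix numbers; \<open>?h\<close>
    realises it by choosing a word with the given triple, so there are at most as many patterns as
    triples.\<close>
  let ?G = "\<lambda>\<tau>. (pnum 0 \<tau> (k 0), pnum 1 \<tau> (k 1), pnum 2 \<tau> (k 2))"
  let ?h = "\<lambda>p. pattern k (SOME \<tau>. \<tau> \<in> ?T \<and> ?G \<tau> = p)"
  have h: "?h (?G \<tau>) = pattern k \<tau>" if "\<tau> \<in> ?T" for \<tau>
  proof -
    define \<tau>' where "\<tau>' = (SOME \<tau>'. \<tau>' \<in> ?T \<and> ?G \<tau>' = ?G \<tau>)"
    have "\<tau>' \<in> ?T \<and> ?G \<tau>' = ?G \<tau>"
      unfolding \<tau>'_def by (rule someI[of _ \<tau>]) (use that in auto)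
    then have "pattern k \<tau>' = pattern k \<tau>"
      using that by (subst pattern_eq_iff_pnum[OF assms(1)]) (auto simp: all_less_3)
    then show ?thesis unfolding \<tau>'_def .
  qed
  have GA: "?G ` ?T \<subseteq> A 0 \<times> A 1 \<times> A 2" using A[of 0] A[of 1] A[of 2] by auto
  have fin: "finite (A 0 \<times> A 1 \<times> A 2)" using A[of 0] A[of 1] A[of 2] by simp
  have "pattern k ` ?T = ?h ` ?G ` ?T"
    unfolding image_image by (intro image_cong) (simp_all only: h)
  then have "card (pattern k ` ?T) \<le> card (?G ` ?T)"
    using card_image_le[of "?G ` ?T" ?h] finite_subset[OF GA fin] by metis
  also have "\<dots> \<le> card (A 0 \<times> A 1 \<times> A 2)" by (rule card_mono[OF fin GA])
  also have "\<dots> \<le> 4 * (4 * 4)"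
    unfolding card_cartesian_product using A[of 0] A[of 1] A[of 2] by (intro mult_le_mono) auto
  finally show ?thesis by simp
qed

lemma cover_by_patterns:
  assumes "decreasing m" "S \<subseteq> words D" "\<And>q. q < 3 \<Longrightarrow> 1 / real (base q) ^ m q \<le> r / 3"
  obtains X where "finite X" "card X \<le> card (pattern m ` S)" "pt ` S \<subseteq> (\<Union>c\<in>X. cball c r)"
proof -
  note fin = finite_pattern_words[OF assms(1,2)]
  let ?X = "(\<lambda>p. pt (SOME \<tau>. \<tau> \<in> S \<and> pattern m \<tau> = p)) ` pattern m ` S"
  have "pt \<tau> \<in> (\<Union>c\<in>?X. cball c r)" if "\<tau> \<in> S" for \<tau>
  proof -
    let ?\<tau> = "SOME \<tau>'. \<tau>' \<in> S \<and> pattern m \<tau>' = pattern m \<tau>"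
    have t: "?\<tau> \<in> S \<and> pattern m ?\<tau> = pattern m \<tau>"
      by (rule someI[of _ \<tau>]) (use that in auto)
    have "pt ` cyl D m ?\<tau> \<subseteq> cball (pt ?\<tau>) r"
      using t assms by (intro cyl_image_subset_cball) auto
    moreover have "\<tau> \<in> cyl D m ?\<tau>" using t that assms(2) by (auto simp: cyl_def)
    ultimately have "pt \<tau> \<in> cball (pt ?\<tau>) r" by blast
    moreover have "pt ?\<tau> \<in> ?X" using that by blast
    ultimately show ?thesis by blast
  qed
  then have "pt ` S \<subseteq> (\<Union>c\<in>?X. cball c r)" by blast
  moreover have "finite ?X" using fin by simp
  moreover have "card ?X \<le> card (pattern m ` S)" using fin by (rule card_image_le)
  ultimately show ?thesis using that by blast
qed

lemma covering_number_le_patterns: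
  assumes "decreasing m" "S \<subseteq> words D" "\<And>q. q < 3 \<Longrightarrow> 1 / real (base q) ^ m q \<le> r / 3"
  shows "covering_number (pt ` S) r \<le> card (pattern m ` S)"
proof -
  obtain X where "finite X" "card X \<le> card (pattern m ` S)" "pt ` S \<subseteq> (\<Union>c\<in>X. cball c r)"
    using cover_by_patterns[OF assms] .
  then show ?thesis using covering_number_le[of X "pt ` S" r] by linarith
qed

lemma power_less_real: "e > 0 \<Longrightarrow> \<exists>j. 1 / real (base q) ^ j < e"
  using real_arch_pow_inv[of e "1 / real (base q)"] base_ge[of q] by (simp add: power_one_over)

lemma F_coverable:
  assumes "r > 0"
  obtains X where "finite X" "F \<subseteq> (\<Union>c\<in>X. cball c r)"
proof -
  obtain j where j: "1 / real (base 0) ^ j < r / 3"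
    using power_less_real[of "r / 3" 0] assms by auto
  have "1 / real (base q) ^ j \<le> r / 3" for q
  proof -
    have "real (base 0) ^ j \<le> real (base q) ^ j" using base_mono[of 0 q] by (intro power_mono) auto
    then have "1 / real (base q) ^ j \<le> 1 / real (base 0) ^ j"
      using base_ge[of 0] by (intro divide_left_mono) (auto intro!: mult_pos_pos zero_less_power simp: less_le_trans[OF zero_less_numeral base_ge])
    then show ?thesis using j by linarith
  qed
  moreover have "decreasing (\<lambda>_. j)" by (simp add: decreasing_def)
  ultimately obtain X where "finite X" "pt ` words D \<subseteq> (\<Union>c\<in>X. cball c r)"
    using cover_by_patterns[OF _ subset_refl] by metis
  then show ?thesis using that unfolding F_eq by blast
qed

lemma covering_number_mono_F:
  assumes "r > 0" "A \<subseteq> B" "B \<subseteq> F"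
  shows "covering_number A r \<le> covering_number B r"
  using F_coverable[OF assms(1)] covering_number_mono assms(2,3) by (metis subset_trans)

lemma covering_number_pos_F:
  assumes "r > 0" "A \<subseteq> F" "A \<noteq> {}"
  shows "covering_number A r > 0"
  using F_coverable[OF assms(1)] covering_number_pos assms(2,3) by (metis subset_trans)

text \<open>The balls of an optimal cover may have their centres anywhere in space, but each meets
  at most 64 patterns, so many patterns force many balls.\<close>

lemma patterns_le_covering_number:
  assumes "decreasing m" "S \<subseteq> words D" "r > 0"
    and "\<And>q. q < 3 \<Longrightarrow> m q = 0 \<or> r * real (base q) ^ m q \<le> 1"
  shows "card (pattern m ` S) \<le> 64 * covering_number (pt ` S) r"
proof -
  obtain X where X: "finite X" "F \<subseteq> (\<Union>c\<in>X. cball c r)" using F_coverable[OF assms(3)] .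
  have "pt ` S \<subseteq> F" using assms(2) by (auto simp: F_eq)
  then have "pt ` S \<subseteq> (\<Union>c\<in>X. cball c r)" using X(2) by (rule subset_trans)
  from covering_number_attained[OF X(1) this] obtain Y where Y: "finite Y" "card Y = covering_number (pt ` S) r"
      "pt ` S \<subseteq> (\<Union>c\<in>Y. cball c r)" .
  let ?P = "\<lambda>c. pattern m ` {\<tau> \<in> words D. pt \<tau> \<in> cball c r}"
  have "pattern m ` S \<subseteq> (\<Union>c\<in>Y. ?P c)" using Y(3) assms(2) by blast
  then have "card (pattern m ` S) \<le> card (\<Union>c\<in>Y. ?P c)"
    using Y(1) finite_pattern_words[OF assms(1)] by (intro card_mono) auto
  also have "\<dots> \<le> (\<Sum>c\<in>Y. card (?P c))" by (rule card_UN_le[OF Y(1)])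
  also have "\<dots> \<le> of_nat (card Y) * 64"
    using card_patterns_in_ball[OF assms(1,4)] by (intro sum_bounded_above) auto
  finally show ?thesis using Y(2) by simp
qed

lemma covering_number_ball_le:
  assumes "decreasing k" "\<And>q. q < 3 \<Longrightarrow> k q = 0 \<or> R * real (base q) ^ k q \<le> 1"
    and "decreasing m" "\<And>q. q < 3 \<Longrightarrow> 1 / real (base q) ^ m q \<le> r / 3"
    and "\<And>\<omega>. \<omega> \<in> words D \<Longrightarrow> pattern_count D k m \<omega> \<le> K"
  shows "covering_number (cball x R \<inter> F) r \<le> 64 * K"
proof -
  let ?S = "{\<tau> \<in> words D. pt \<tau> \<in> cball x R}"
  have e: "cball x R \<inter> F = pt ` ?S" by (auto simp: F_eq)
  have "pattern m ` ?S \<subseteq> (\<Union>p\<in>pattern k ` ?S. pattern m ` {\<tau> \<in> words D. pattern k \<tau> = p})" by blast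
  then have "card (pattern m ` ?S) \<le> card (\<Union>p\<in>pattern k ` ?S. pattern m ` {\<tau> \<in> words D. pattern k \<tau> = p})"
    using finite_pattern_words[OF assms(3)] finite_pattern_words[OF assms(1)]
    by (intro card_mono finite_UN_I) auto
  also have "\<dots> \<le> (\<Sum>p\<in>pattern k ` ?S. card (pattern m ` {\<tau> \<in> words D. pattern k \<tau> = p}))"
    by (rule card_UN_le) (auto intro: finite_pattern_words[OF assms(1)])
  also have "\<dots> \<le> of_nat (card (pattern k ` ?S)) * K"
    using assms(5) by (intro sum_bounded_above) (auto simp: pattern_count_def cyl_def)
  also have "\<dots> \<le> 64 * K"
    using card_patterns_in_ball[OF assms(1,2)] by simp
  finally show ?thesis
    unfolding e using covering_number_le_patterns[OF assms(3) _ assms(4), of ?S] by fastforce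
qed

text \<open>The level conditions are opposite to those of the upper estimate: the coarse cube must
  fit into the ball, and the fine cubes must be so large that a ball of radius \<open>r\<close>
  meets boundedly many.\<close>

lemma pattern_count_le_covering_ball:
  assumes "decreasing k" "\<And>q. q < 3 \<Longrightarrow> 1 / real (base q) ^ k q \<le> R / 3"
    and "decreasing m" "\<And>q. q < 3 \<Longrightarrow> m q = 0 \<or> r * real (base q) ^ m q \<le> 1"
    and "\<omega> \<in> words D" "r > 0"
  shows "pattern_count D k m \<omega> \<le> 64 * covering_number (cball (pt \<omega>) R \<inter> F) r"
proof -
  have s: "cyl D k \<omega> \<subseteq> words D" by (auto simp: cyl_def)
  have "pattern_count D k m \<omega> \<le> 64 * covering_number (pt ` cyl D k \<omega>) r"
    unfolding pattern_count_def by (rule patterns_le_covering_number[OF assms(3) s assms(6,4)])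
  moreover have "covering_number (pt ` cyl D k \<omega>) r \<le> covering_number (cball (pt \<omega>) R \<inter> F) r"
    using cyl_image_subset_cball[OF assms(1,5,2)] s
    by (intro covering_number_mono_F[OF assms(6)]) (auto simp: F_eq)
  ultimately show ?thesis by linarith
qed

text \<open>If a coordinate is constant on \<open>D\<close>, all words agree in it. Otherwise two
  distinct digits after the recorded ones keep the centre farther than \<open>R\<close> from the
  faces, whichever expansion the other point uses.\<close>

lemma cball_inter_F_subset_cyl:
  assumes "decreasing k" "\<omega> \<in> words D"
    and "\<And>q. q < 3 \<Longrightarrow> (\<forall>i\<in>D. \<forall>j\<in>D. digit_coord q i = digit_coord q j) \<or>
       k q \<le> p q \<and> digit_coord q (\<omega> (p q)) \<noteq> digit_coord q (\<omega> (Suc (p q))) \<and>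
       R < 1 / real (base q) ^ (p q + 2)"
  shows "cball (pt \<omega>) R \<inter> F \<subseteq> pt ` cyl D k \<omega>"
proof
  fix y assume "y \<in> cball (pt \<omega>) R \<inter> F"
  then obtain \<tau> where t: "\<tau> \<in> words D" "y = pt \<tau>" "dist (pt \<omega>) (pt \<tau>) \<le> R" by (auto simp: F_eq)
  have "pnum q \<tau> (k q) = pnum q \<omega> (k q)" if q: "q < 3" for q
  proof (cases "\<forall>i\<in>D. \<forall>j\<in>D. digit_coord q i = digit_coord q j")
    case True
    then show ?thesis unfolding pnum_def
      using t(1) assms(2) by (intro prefix_num_cong) (simp add: words_def)
  next
    case False
    then have p: "k q \<le> p q" "digit_coord q (\<omega> (p q)) \<noteq> digit_coord q (\<omega> (Suc (p q)))"
        "R < 1 / real (base q) ^ (p q + 2)"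
      using assms(3)[OF q] by auto
    have "\<bar>coord q (pt \<tau>) - coord q (pt \<omega>)\<bar> < 1 / real (base q) ^ (p q + 2)"
      using abs_coord_diff_le_dist[of q "pt \<tau>" "pt \<omega>"] t(3) p(3) by (simp add: dist_commute)
    then show ?thesis
      unfolding pnum_def
      by (intro expands_interior[OF words_digit_less[OF assms(2)] words_digit_less[OF t(1)]
          pt_expands[OF assms(2) q] pt_expands[OF t(1) q] p(1,2)])
  qed
  then have "\<tau> \<in> cyl D k \<omega>"
    using t(1) pattern_eq_iff_pnum[OF assms(1) t(1) assms(2)] by (auto simp: cyl_def)
  then show "y \<in> pt ` cyl D k \<omega>" using t(2) by blast
qed

end

subsection \<open>Sums of local exponents over levels\<close>

text \<open>For \<open>h\<close> the logarithm of the largest or smallest local count, this is the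
  logarithm of the largest or smallest number of cubes of levels \<open>m\<close> inside one of
  levels \<open>k\<close>.\<close>

definition wsum :: "(nat \<Rightarrow> nat \<Rightarrow> real) \<Rightarrow> (nat \<Rightarrow> nat) \<Rightarrow> (nat \<Rightarrow> nat) \<Rightarrow> real" where
  "wsum h k m = (\<Sum>l<m 0. h (depth k l) (depth m l))"

lemma wsum_extend:
  assumes "decreasing m" "\<And>a. h a 0 = 0" "m 0 \<le> L"
  shows "wsum h k m = (\<Sum>l<L. h (depth k l) (depth m l))"
  unfolding wsum_def using assms
  by (intro sum.mono_neutral_left) (auto simp: depth_eq_0)

text \<open>A summand can change only at a position between the old and the new value of one of the
  six levels. These are at most \<open>6 * c\<close> positions, and two values of \<open>h\<close>
  differ by at most \<open>H\<close>.\<close>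

lemma abs_wsum_diff_le:
  assumes m: "decreasing m" "decreasing m'"
    and h: "\<And>a. h a 0 = 0" "\<And>a b. 0 \<le> h a b" "\<And>a b. h a b \<le> H"
    and c: "\<And>q. q < 3 \<Longrightarrow> \<bar>int (k q) - int (k' q)\<bar> \<le> int c"
       "\<And>q. q < 3 \<Longrightarrow> \<bar>int (m q) - int (m' q)\<bar> \<le> int c"
  shows "\<bar>wsum h k m - wsum h k' m'\<bar> \<le> 6 * real c * H"
proof -
  have H: "0 \<le> H" using h(2,3)[of 0 0] by linarith
  define I where "I u v = {min u v..<max u v}" for u v :: nat
  define E where "E = (\<Union>q\<in>{..<3}. I (k q) (k' q) \<union> I (m q) (m' q))"
  define L where "L = max (m 0) (m' 0)"
  have "card E \<le> (\<Sum>q<3. card (I (k q) (k' q) \<union> I (m q) (m' q)))"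
    unfolding E_def by (rule card_UN_le) simp
  also have "\<dots> \<le> (\<Sum>q<(3::nat). 2 * c)"
  proof (rule sum_mono)
    fix q :: nat assume "q \<in> {..<3}"
    then have "card (I (k q) (k' q)) \<le> c" "card (I (m q) (m' q)) \<le> c"
      using c[of q] by (auto simp: I_def)
    then show "card (I (k q) (k' q) \<union> I (m q) (m' q)) \<le> 2 * c"
      using card_Un_le[of "I (k q) (k' q)" "I (m q) (m' q)"] by linarith
  qed
  finally have cE: "card E \<le> 6 * c" by simp
  have fE: "finite E" by (auto simp: E_def I_def)
  let ?d = "\<lambda>l. h (depth k l) (depth m l) - h (depth k' l) (depth m' l)"
  have out: "?d l = 0" if "l \<notin> E" for l
  proof -
    have "(l < k q) = (l < k' q) \<and> (l < m q) = (l < m' q)" if "q < 3" for q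
    proof -
      have "l \<notin> I (k q) (k' q)" "l \<notin> I (m q) (m' q)"
        using \<open>l \<notin> E\<close> that by (auto simp: E_def)
      then show ?thesis unfolding I_def atLeastLessThan_iff by linarith
    qed
    from this[of 0] this[of 1] this[of 2] show ?thesis by (simp add: depth_def)
  qed
  have "wsum h k m - wsum h k' m' = (\<Sum>l<L. ?d l)"
    using wsum_extend[of m h, OF m(1) h(1), of L k] wsum_extend[of m' h, OF m(2) h(1), of L k']
    by (simp add: L_def sum_subtractf)
  also have "\<dots> = (\<Sum>l\<in>{..<L} \<inter> E. ?d l)"
    using out by (intro sum.mono_neutral_right) auto
  finally have "\<bar>wsum h k m - wsum h k' m'\<bar> \<le> (\<Sum>l\<in>{..<L} \<inter> E. \<bar>?d l\<bar>)"
    by simp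
  also have "\<dots> \<le> real (card ({..<L} \<inter> E)) * H"
  proof (rule sum_bounded_above)
    fix l
    show "\<bar>?d l\<bar> \<le> H"
      using h(2,3)[of "depth k l" "depth m l"] h(2,3)[of "depth k' l" "depth m' l"] by linarith
  qed
  also have "\<dots> \<le> real (6 * c) * H"
    using cE card_mono[OF fE, of "{..<L} \<inter> E"] H
    by (intro mult_right_mono of_nat_mono) auto
  finally show ?thesis by simp
qed

section \<open>Block decompositions for the three interlacings\<close>

lemma sum_const_interval:
  fixes g :: "nat \<Rightarrow> real"
  assumes "a \<le> b" "\<And>l. a \<le> l \<Longrightarrow> l < b \<Longrightarrow> g l = v"
  shows "sum g {a..<b} = (real b - real a) * v"
proof -
  have "sum g {a..<b} = sum (\<lambda>_. v) {a..<b}" using assms(2) by (intro sum.cong) auto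
  then show ?thesis using assms(1) by (simp add: of_nat_diff)
qed

text \<open>Between consecutive levels both depths are constant; here the blocks have (coarse, fine)
  depths (3,3), (2,3), (1,3), (0,3), (0,2), (0,1).\<close>

lemma wsum_separated:
  assumes "k 2 \<le> k 1" "k 1 \<le> k 0" "k 0 \<le> m 2" "m 2 \<le> m 1" "m 1 \<le> m 0" "h 3 3 = 0"
  shows "wsum h k m = (real (k 1) - real (k 2)) * h 2 3 + (real (k 0) - real (k 1)) * h (Suc 0) 3
    + (real (m 2) - real (k 0)) * h 0 3 + (real (m 1) - real (m 2)) * h 0 2
    + (real (m 0) - real (m 1)) * h 0 (Suc 0)"
proof -
  let ?g = "\<lambda>l. h (depth k l) (depth m l)"
  have "wsum h k m = sum ?g {0..<k 2} + sum ?g {k 2..<k 1} + sum ?g {k 1..<k 0}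
      + sum ?g {k 0..<m 2} + sum ?g {m 2..<m 1} + sum ?g {m 1..<m 0}"
    unfolding wsum_def lessThan_atLeast0 using assms by (simp add: sum.atLeastLessThan_concat)
  moreover have "sum ?g {0..<k 2} = (real (k 2) - real 0) * 0"
    by (rule sum_const_interval) (use assms in \<open>auto simp: depth_def\<close>)
  moreover have "sum ?g {k 2..<k 1} = (real (k 1) - real (k 2)) * h 2 3"
    by (rule sum_const_interval) (use assms in \<open>auto simp: depth_def\<close>)
  moreover have "sum ?g {k 1..<k 0} = (real (k 0) - real (k 1)) * h (Suc 0) 3"
    by (rule sum_const_interval) (use assms in \<open>auto simp: depth_def\<close>)
  moreover have "sum ?g {k 0..<m 2} = (real (m 2) - real (k 0)) * h 0 3"
    by (rule sum_const_interval) (use assms in \<open>auto simp: depth_def\<close>)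
  moreover have "sum ?g {m 2..<m 1} = (real (m 1) - real (m 2)) * h 0 2"
    by (rule sum_const_interval) (use assms in \<open>auto simp: depth_def\<close>)
  moreover have "sum ?g {m 1..<m 0} = (real (m 0) - real (m 1)) * h 0 (Suc 0)"
    by (rule sum_const_interval) (use assms in \<open>auto simp: depth_def\<close>)
  ultimately show ?thesis by simp
qed

text \<open>The third coordinate at the fine scale now ends before the first at the coarse scale, so
  the block (0,3) gives way to (1,2).\<close>

lemma wsum_interlaced:
  assumes "k 2 \<le> k 1" "k 1 \<le> m 2" "m 2 \<le> k 0" "k 0 \<le> m 1" "m 1 \<le> m 0" "h 3 3 = 0"
  shows "wsum h k m = (real (k 1) - real (k 2)) * h 2 3 + (real (m 2) - real (k 1)) * h (Suc 0) 3
    + (real (k 0) - real (m 2)) * h (Suc 0) 2 + (real (m 1) - real (k 0)) * h 0 2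
    + (real (m 0) - real (m 1)) * h 0 (Suc 0)"
proof -
  let ?g = "\<lambda>l. h (depth k l) (depth m l)"
  have "wsum h k m = sum ?g {0..<k 2} + sum ?g {k 2..<k 1} + sum ?g {k 1..<m 2}
      + sum ?g {m 2..<k 0} + sum ?g {k 0..<m 1} + sum ?g {m 1..<m 0}"
    unfolding wsum_def lessThan_atLeast0 using assms by (simp add: sum.atLeastLessThan_concat)
  moreover have "sum ?g {0..<k 2} = (real (k 2) - real 0) * 0"
    by (rule sum_const_interval) (use assms in \<open>auto simp: depth_def\<close>)
  moreover have "sum ?g {k 2..<k 1} = (real (k 1) - real (k 2)) * h 2 3"
    by (rule sum_const_interval) (use assms in \<open>auto simp: depth_def\<close>)
  moreover have "sum ?g {k 1..<m 2} = (real (m 2) - real (k 1)) * h (Suc 0) 3"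
    by (rule sum_const_interval) (use assms in \<open>auto simp: depth_def\<close>)
  moreover have "sum ?g {m 2..<k 0} = (real (k 0) - real (m 2)) * h (Suc 0) 2"
    by (rule sum_const_interval) (use assms in \<open>auto simp: depth_def\<close>)
  moreover have "sum ?g {k 0..<m 1} = (real (m 1) - real (k 0)) * h 0 2"
    by (rule sum_const_interval) (use assms in \<open>auto simp: depth_def\<close>)
  moreover have "sum ?g {m 1..<m 0} = (real (m 0) - real (m 1)) * h 0 (Suc 0)"
    by (rule sum_const_interval) (use assms in \<open>auto simp: depth_def\<close>)
  ultimately show ?thesis by simp
qed

text \<open>At every position at most one coordinate is recorded at the fine scale only; the blocks
  (3,3), (2,2) and (1,1) contribute nothing.\<close>

lemma wsum_nested:
  assumes "k 2 \<le> m 2" "m 2 \<le> k 1" "k 1 \<le> m 1" "m 1 \<le> k 0" "k 0 \<le> m 0"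
    "h 3 3 = 0" "h 2 2 = 0" "h (Suc 0) (Suc 0) = 0"
  shows "wsum h k m = (real (m 2) - real (k 2)) * h 2 3 + (real (m 1) - real (k 1)) * h (Suc 0) 2
    + (real (m 0) - real (k 0)) * h 0 (Suc 0)"
proof -
  let ?g = "\<lambda>l. h (depth k l) (depth m l)"
  have "wsum h k m = sum ?g {0..<k 2} + sum ?g {k 2..<m 2} + sum ?g {m 2..<k 1}
      + sum ?g {k 1..<m 1} + sum ?g {m 1..<k 0} + sum ?g {k 0..<m 0}"
    unfolding wsum_def lessThan_atLeast0 using assms by (simp add: sum.atLeastLessThan_concat)
  moreover have "sum ?g {0..<k 2} = (real (k 2) - real 0) * 0"
    by (rule sum_const_interval) (use assms in \<open>auto simp: depth_def\<close>)
  moreover have "sum ?g {k 2..<m 2} = (real (m 2) - real (k 2)) * h 2 3"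
    by (rule sum_const_interval) (use assms in \<open>auto simp: depth_def\<close>)
  moreover have "sum ?g {m 2..<k 1} = (real (k 1) - real (m 2)) * 0"
    by (rule sum_const_interval) (use assms in \<open>auto simp: depth_def\<close>)
  moreover have "sum ?g {k 1..<m 1} = (real (m 1) - real (k 1)) * h (Suc 0) 2"
    by (rule sum_const_interval) (use assms in \<open>auto simp: depth_def\<close>)
  moreover have "sum ?g {m 1..<k 0} = (real (k 0) - real (m 1)) * 0"
    by (rule sum_const_interval) (use assms in \<open>auto simp: depth_def\<close>)
  moreover have "sum ?g {k 0..<m 0} = (real (m 0) - real (k 0)) * h 0 (Suc 0)"
    by (rule sum_const_interval) (use assms in \<open>auto simp: depth_def\<close>)
  ultimately show ?thesis by simp
qed

text \<open>An \<open>h\<close> that adds one weight per coordinate makes the sum split: coordinate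
  \<open>q\<close> is newly recorded exactly at the positions from \<open>k q\<close> up to
  \<open>m q\<close>. Truncated subtraction gives the right value when there are none.\<close>

lemma wsum_coordinatewise:
  assumes "decreasing k" "decreasing m"
  shows "wsum (\<lambda>a b. \<Sum>q<3. if a \<le> q \<and> q < b then g q else 0) k m = (\<Sum>q<3. real (m q - k q) * g q)"
proof -
  have "wsum (\<lambda>a b. \<Sum>q<3. if a \<le> q \<and> q < b then g q else 0) k m =
      (\<Sum>q<3. \<Sum>l<m 0. if depth k l \<le> q \<and> q < depth m l then g q else 0)"
    unfolding wsum_def by (rule sum.swap)
  also have "\<dots> = (\<Sum>q<3. real (m q - k q) * g q)"
  proof (rule sum.cong)
    fix q :: nat assume "q \<in> {..<3}"
    then have q: "q < 3" by simp
    have "m q \<le> m 0" using assms(2) q by (auto simp: decreasing_def numeral_3_eq_3 less_Suc_eq numeral_2_eq_2)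
    have "depth k l \<le> q \<longleftrightarrow> k q \<le> l" for l
      using less_depth_iff[OF assms(1) q] by (metis not_less)
    then have "{l \<in> {..<m 0}. depth k l \<le> q \<and> q < depth m l} = {k q..<m q}"
      using less_depth_iff[OF assms(2) q] \<open>m q \<le> m 0\<close> by auto
    then have "(\<Sum>l<m 0. if depth k l \<le> q \<and> q < depth m l then g q else 0) = (\<Sum>l\<in>{k q..<m q}. g q)"
      by (subst sum.inter_filter[symmetric]) simp_all
    then show "(\<Sum>l<m 0. if depth k l \<le> q \<and> q < depth m l then g q else 0) = real (m q - k q) * g q"
      by simp
  qed simp
  finally show ?thesis .
qed

lemma interval_sum_3:
  fixes g :: "nat \<Rightarrow> real"
  assumes "b \<le> 3"
  shows "(\<Sum>q<3. if a \<le> q \<and> q < b then g q else 0) = sum g {a..<b}"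
proof -
  have "(\<Sum>q<3. if a \<le> q \<and> q < b then g q else 0) = sum g {q \<in> {..<3}. a \<le> q \<and> q < b}"
    by (rule sum.inter_filter[symmetric]) simp
  also have "{q \<in> {..<3}. a \<le> q \<and> q < b} = {a..<b}" using assms by auto
  finally show ?thesis .
qed

lemma subadditive_le_sum:
  fixes h :: "nat \<Rightarrow> nat \<Rightarrow> real"
  assumes "\<And>a b. b \<le> a \<Longrightarrow> h a b = 0" "\<And>a b c. a \<le> b \<Longrightarrow> b \<le> c \<Longrightarrow> h a c \<le> h a b + h b c"
  shows "h a b \<le> (\<Sum>q=a..<b. h q (Suc q))"
proof (induction b)
  case (Suc b)
  then show ?case using assms(1)[of "Suc b" a] assms(2)[of a b "Suc b"]
    by (cases "a \<le> b") (auto simp: not_less_eq_eq)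
qed (simp add: assms)

text \<open>This holds for every interlacing of \<open>k\<close> with \<open>m\<close>, so it serves
  the Assouad dimension, where the two radii are not tied to each other; the next lemma does the
  same for the lower dimension.\<close>

lemma wsum_le_coordinatewise:
  assumes "decreasing k" "decreasing m" "\<And>a b. b \<le> a \<Longrightarrow> h a b = 0"
    "\<And>a b c. a \<le> b \<Longrightarrow> b \<le> c \<Longrightarrow> h a c \<le> h a b + h b c"
  shows "wsum h k m \<le> (\<Sum>q<3. real (m q - k q) * h q (Suc q))"
  unfolding wsum_coordinatewise[OF assms(1,2), symmetric]
  using subadditive_le_sum[of h, OF assms(3,4)] interval_sum_3[OF depth_le]
  unfolding wsum_def by (intro sum_mono) simp

lemma wsum_ge_coordinatewise:
  assumes "decreasing k" "decreasing m" "\<And>a b. b \<le> a \<Longrightarrow> h a b = 0"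
    "\<And>a b c. a \<le> b \<Longrightarrow> b \<le> c \<Longrightarrow> h a b + h b c \<le> h a c"
  shows "(\<Sum>q<3. real (m q - k q) * h q (Suc q)) \<le> wsum h k m"
proof -
  have "- h a b \<le> (\<Sum>q=a..<b. - h q (Suc q))" for a b
    using assms(3,4) by (intro subadditive_le_sum[of "\<lambda>a b. - h a b"]) fastforce+
  then have "(\<Sum>q=a..<b. h q (Suc q)) \<le> h a b" for a b by (simp add: sum_negf)
  then show ?thesis
    unfolding wsum_coordinatewise[OF assms(1,2), symmetric]
    using interval_sum_3[OF depth_le] unfolding wsum_def by (intro sum_mono) simp
qed

lemma abs_nat_floor_diff_le:
  assumes "\<bar>x - y\<bar> \<le> real c"
  shows "\<bar>int (nat \<lfloor>x\<rfloor>) - int (nat \<lfloor>y\<rfloor>)\<bar> \<le> int c + 1"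
  using assms by linarith

section \<open>Levels belonging to a radius\<close>

context bm_digits
begin

text \<open>For 0 < \<rho> \<le> 1 the largest level at which intervals still have length at least
  \<rho>. For larger \<rho> the quotient is negative and \<open>nat\<close> makes the level 0,
  whence the alternative \<open>lev \<rho> q = 0\<close> in \<open>lev_upper\<close>.\<close>

definition lev :: "real \<Rightarrow> nat \<Rightarrow> nat" where
  "lev \<rho> q = nat \<lfloor>ln (1 / \<rho>) / ln (real (base q))\<rfloor>"

lemma ln_base_pos: "ln (real (base q)) > 0"
  using base_ge[of q] by simp

lemma ln_base_ge: "ln 2 \<le> ln (real (base q))"
  using base_ge[of q] by simp

lemma ln_base_mono: "q \<le> q' \<Longrightarrow> ln (real (base q)) \<le> ln (real (base q'))"
  using base_ge[of q] base_mono[of q q'] by simp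

lemma lev_antimono_coord: "q \<le> q' \<Longrightarrow> lev \<rho> q' \<le> lev \<rho> q"
proof (cases "ln (1 / \<rho>) \<ge> 0")
  case True
  assume "q \<le> q'"
  then have "ln (1 / \<rho>) / ln (real (base q')) \<le> ln (1 / \<rho>) / ln (real (base q))"
    using True ln_base_mono ln_base_pos by (intro divide_left_mono) auto
  then show ?thesis unfolding lev_def by (intro nat_mono floor_mono)
next
  case False
  then have "ln (1 / \<rho>) / ln (real (base q')) \<le> 0"
    using ln_base_pos[of q'] by (simp add: divide_nonpos_pos)
  then have "\<lfloor>ln (1 / \<rho>) / ln (real (base q'))\<rfloor> \<le> 0" by linarith
  then show ?thesis unfolding lev_def by simp
qed

lemma decreasing_lev: "decreasing (lev \<rho>)"
  unfolding decreasing_def by (simp add: lev_antimono_coord)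

lemma lev_upper:
  assumes "\<rho> > 0"
  shows "lev \<rho> q = 0 \<or> \<rho> * real (base q) ^ lev \<rho> q \<le> 1"
proof (cases "lev \<rho> q = 0")
  case False
  then have "real (lev \<rho> q) \<le> ln (1 / \<rho>) / ln (real (base q))"
    unfolding lev_def by linarith
  then have "real (lev \<rho> q) * ln (real (base q)) \<le> ln (1 / \<rho>)"
    using ln_base_pos[of q] by (simp add: pos_le_divide_eq)
  then have "ln (real (base q) ^ lev \<rho> q) \<le> ln (1 / \<rho>)"
    using base_ge[of q] by (simp add: ln_realpow)
  then have "real (base q) ^ lev \<rho> q \<le> 1 / \<rho>"
    using base_ge[of q] assms by (subst (asm) ln_le_cancel_iff) auto
  then show ?thesis using assms by (simp add: field_simps)
qed simp

lemma lev_lower: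
  assumes "\<rho> > 0"
  shows "1 / real (base q) ^ lev \<rho> q \<le> real n3 * \<rho>"
proof -
  have b: "real (base q) > 0" using base_ge[of q] by simp
  have "ln (1 / \<rho>) / ln (real (base q)) \<le> real (Suc (lev \<rho> q))"
    unfolding lev_def by linarith
  then have "ln (1 / \<rho>) \<le> real (Suc (lev \<rho> q)) * ln (real (base q))"
    using ln_base_pos[of q] by (simp add: pos_divide_le_eq)
  also have "\<dots> = ln (real (base q) ^ Suc (lev \<rho> q))"
    using b by (simp only: ln_realpow)
  finally have "1 / \<rho> \<le> real (base q) ^ Suc (lev \<rho> q)"
    using b assms by (subst (asm) ln_le_cancel_iff) (auto simp del: power_Suc)
  then have "1 / real (base q) ^ lev \<rho> q \<le> real (base q) * \<rho>"
    using b assms by (simp add: field_simps)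
  also have "\<dots> \<le> real n3 * \<rho>" using base_le[of q] assms by simp
  finally show ?thesis .
qed

text \<open>Scaling by \<open>a\<close> shifts the quotient in \<open>lev\<close> by
  \<open>ln a / ln (base q)\<close>, which base 2 bounds for all coordinates at once; rounding adds
  one more.\<close>

lemma lev_scale:
  assumes "a > 0"
  shows "\<exists>c. \<forall>\<rho> q. \<rho> > 0 \<longrightarrow> \<bar>int (lev (a * \<rho>) q) - int (lev \<rho> q)\<bar> \<le> int c"
proof -
  obtain c where c: "\<bar>ln a\<bar> / ln 2 \<le> real c" using real_arch_simple by blast
  have "\<bar>int (lev (a * \<rho>) q) - int (lev \<rho> q)\<bar> \<le> int (Suc c)" if "\<rho> > 0" for \<rho> q
  proof -
    have "ln (1 / (a * \<rho>)) / ln (real (base q)) - ln (1 / \<rho>) / ln (real (base q)) =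
        - ln a / ln (real (base q))"
      using assms that by (simp add: ln_div ln_mult diff_divide_distrib)
    then have "\<bar>ln (1 / (a * \<rho>)) / ln (real (base q)) - ln (1 / \<rho>) / ln (real (base q))\<bar> =
        \<bar>ln a\<bar> / ln (real (base q))"
      using ln_base_pos[of q] by simp
    also have "\<dots> \<le> \<bar>ln a\<bar> / ln 2"
      using ln_base_ge[of q] ln_base_pos[of q] by (intro divide_left_mono) auto
    also note c
    finally show ?thesis
      unfolding lev_def of_nat_Suc using abs_nat_floor_diff_le by (simp only: add.commute)
  qed
  then show ?thesis by (intro exI allI impI)
qed

lemma lev_bounds:
  assumes "0 \<le> ln (1 / \<rho>)"
  shows "real (lev \<rho> q) \<le> ln (1 / \<rho>) / ln (real (base q))"
    and "ln (1 / \<rho>) / ln (real (base q)) - 1 \<le> real (lev \<rho> q)"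
proof -
  have "0 \<le> ln (1 / \<rho>) / ln (real (base q))" using assms ln_base_pos[of q] by simp
  then show "real (lev \<rho> q) \<le> ln (1 / \<rho>) / ln (real (base q))"
    "ln (1 / \<rho>) / ln (real (base q)) - 1 \<le> real (lev \<rho> q)"
    unfolding lev_def by linarith+
qed

end

subsection \<open>Covering numbers of balls\<close>

lemma real_le_64_mult: "a \<le> 64 * b \<Longrightarrow> real a \<le> 64 * real b"
  by linarith

lemma real_le_mult_power: "a \<le> b * c ^ j \<Longrightarrow> real a \<le> real b * real c ^ j"
  by (metis of_nat_le_iff of_nat_mult of_nat_power)

context bm_digits
begin

definition hmax :: "nat \<Rightarrow> nat \<Rightarrow> real" where "hmax a b = ln (real (ext_max D a b))"
definition hmin :: "nat \<Rightarrow> nat \<Rightarrow> real" where "hmin a b = ln (real (ext_min D a b))"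

lemma card_D_pos: "card D > 0"
  using finite_D D_ne by (simp add: card_gt_0_iff)

lemma h_trivial: "b \<le> a \<Longrightarrow> hmax a b = 0" "b \<le> a \<Longrightarrow> hmin a b = 0"
  by (simp_all add: hmax_def hmin_def ext_max_trivial ext_min_trivial)

lemma h_nonneg: "0 \<le> hmax a b" "0 \<le> hmin a b"
  using ext_max_pos[of a b] ext_min_pos[of a b] by (simp_all add: hmax_def hmin_def Suc_le_eq)

lemma h_le: "hmax a b \<le> ln (real (card D))" "hmin a b \<le> ln (real (card D))"
  using ext_max_pos[of a b] ext_min_pos[of a b] ext_max_le_card[of a b] ext_min_le_card[of a b]
  by (simp_all add: hmax_def hmin_def)

lemma hmax_subadditive: "a \<le> b \<Longrightarrow> b \<le> c \<Longrightarrow> hmax a c \<le> hmax a b + hmax b c"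
proof -
  assume "a \<le> b" "b \<le> c"
  then have "real (ext_max D a c) \<le> real (ext_max D a b * ext_max D b c)"
    using ext_max_submult by (intro of_nat_mono)
  then have "hmax a c \<le> ln (real (ext_max D a b * ext_max D b c))"
    unfolding hmax_def using ext_max_pos by (subst ln_le_cancel_iff) auto
  also have "\<dots> = hmax a b + hmax b c"
    unfolding hmax_def of_nat_mult using ext_max_pos by (intro ln_mult_pos) auto
  finally show ?thesis .
qed

lemma hmin_superadditive: "a \<le> b \<Longrightarrow> b \<le> c \<Longrightarrow> hmin a b + hmin b c \<le> hmin a c"
proof -
  assume "a \<le> b" "b \<le> c"
  have "hmin a b + hmin b c = ln (real (ext_min D a b * ext_min D b c))"
    unfolding hmin_def of_nat_mult using ext_min_pos by (intro ln_mult_pos[symmetric]) auto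
  also have "\<dots> \<le> hmin a c"
    unfolding hmin_def using ext_min_supermult[OF \<open>a \<le> b\<close> \<open>b \<le> c\<close>] ext_min_pos
    by (subst ln_le_cancel_iff) (auto simp flip: of_nat_mult)
  finally show ?thesis .
qed

text \<open>This absorbs constant factors in the radii into an additive error: the factor
  \<open>1 / (3 * real n3)\<close> of the ball estimates and \<open>real n3 ^ 7\<close> of the
  construction of minimal balls.\<close>

lemma wsum_lev_scale:
  assumes "a > 0" "b > 0" "h = hmax \<or> h = hmin"
  shows "\<exists>C. \<forall>R r. R > 0 \<longrightarrow> r > 0 \<longrightarrow>
    \<bar>wsum h (lev (a * R)) (lev (b * r)) - wsum h (lev R) (lev r)\<bar> \<le> C"
proof -
  obtain c where c: "\<forall>\<rho> q. \<rho> > 0 \<longrightarrow> \<bar>int (lev (a * \<rho>) q) - int (lev \<rho> q)\<bar> \<le> int c"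
    using lev_scale[OF assms(1)] ..
  obtain d where d: "\<forall>\<rho> q. \<rho> > 0 \<longrightarrow> \<bar>int (lev (b * \<rho>) q) - int (lev \<rho> q)\<bar> \<le> int d"
    using lev_scale[OF assms(2)] ..
  have h: "h a 0 = 0" "0 \<le> h a b" "h a b \<le> ln (real (card D))" for a b
    using assms(3) h_trivial h_nonneg h_le by auto
  have "\<bar>wsum h (lev (a * R)) (lev (b * r)) - wsum h (lev R) (lev r)\<bar>
      \<le> 6 * real (max c d) * ln (real (card D))" if "R > 0" "r > 0" for R r
  proof (rule abs_wsum_diff_le[where h = h, OF decreasing_lev decreasing_lev h])
    fix q :: nat
    show "\<bar>int (lev (a * R) q) - int (lev R q)\<bar> \<le> int (max c d)"
      using c[rule_format, OF that(1), of q] by linarith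
    show "\<bar>int (lev (b * r) q) - int (lev r q)\<bar> \<le> int (max c d)"
      using d[rule_format, OF that(2), of q] by linarith
  qed
  then show ?thesis by (intro exI allI impI)
qed

lemma n3_pos: "real n3 > 0"
  using n1 n12 n23 by simp

lemma exp_wsum_max: "exp (wsum hmax k m) = real (\<Prod>l<m 0. ext_max D (depth k l) (depth m l))"
  unfolding wsum_def hmax_def using ext_max_pos by (simp add: exp_sum)

lemma exp_wsum_min: "exp (wsum hmin k m) = real (\<Prod>l<m 0. ext_min D (depth k l) (depth m l))"
  unfolding wsum_def hmin_def using ext_min_pos by (simp add: exp_sum)

lemma words_letter: "\<omega> \<in> words D \<Longrightarrow> \<omega> l \<in> D"
  by (simp add: words_def)

lemma pattern_count_le_max:
  assumes "decreasing m" "\<omega> \<in> words D"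
  shows "pattern_count D k m \<omega> \<le> (\<Prod>l<m 0. ext_max D (depth k l) (depth m l))"
  unfolding pattern_count_eq_prod[OF assms]
  using ext_count_le_max words_letter[OF assms(2)] by (intro prod_mono) auto

lemma pattern_count_ge_min:
  assumes "decreasing m" "\<omega> \<in> words D"
  shows "(\<Prod>l<m 0. ext_min D (depth k l) (depth m l)) \<le> pattern_count D k m \<omega>"
  unfolding pattern_count_eq_prod[OF assms]
  using ext_min_le_count words_letter[OF assms(2)] by (intro prod_mono) auto

lemma pattern_count_max_attained:
  assumes "decreasing m"
  obtains \<omega> where "\<omega> \<in> words D" "pattern_count D k m \<omega> = (\<Prod>l<m 0. ext_max D (depth k l) (depth m l))"
proof -
  have "\<forall>l. \<exists>i. i \<in> D \<and> ext_count D (depth k l) (depth m l) i = ext_max D (depth k l) (depth m l)"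
    using ext_max_attained by blast
  from choice[OF this] obtain \<omega> where
    w: "\<forall>l. \<omega> l \<in> D \<and> ext_count D (depth k l) (depth m l) (\<omega> l) = ext_max D (depth k l) (depth m l)" ..
  then have "\<omega> \<in> words D" by (simp add: words_def)
  moreover have "pattern_count D k m \<omega> = (\<Prod>l<m 0. ext_max D (depth k l) (depth m l))"
    unfolding pattern_count_eq_prod[OF assms \<open>\<omega> \<in> words D\<close>] using w by simp
  ultimately show ?thesis using that by blast
qed

lemma ball_inter_F_nonempty: "x \<in> F \<Longrightarrow> 0 < R \<Longrightarrow> cball x R \<inter> F \<noteq> {}"
  by (metis IntI centre_in_cball empty_iff less_imp_le)

text \<open>A third of the radius is what \<open>dist_le_coord\<close> asks for, and
  \<open>lev_lower\<close> loses a factor \<open>n3\<close>; the scale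
  \<open>1 / (3 * real n3)\<close> pays for both.\<close>

lemma lev_fine: "r > 0 \<Longrightarrow> 1 / real (base q) ^ lev (1 / (3 * real n3) * r) q \<le> r / 3"
  using lev_lower[of "1 / (3 * real n3) * r" q] n3_pos by simp

lemma ln_covering_ball_upper:
  "\<exists>C. \<forall>x R r. x \<in> F \<longrightarrow> 0 < R \<longrightarrow> 0 < r \<longrightarrow>
    ln (real (covering_number (cball x R \<inter> F) r)) \<le> wsum hmax (lev R) (lev r) + C"
proof -
  obtain C where C: "\<forall>R r. R > 0 \<longrightarrow> r > 0 \<longrightarrow>
      \<bar>wsum hmax (lev (1 * R)) (lev (1 / (3 * real n3) * r)) - wsum hmax (lev R) (lev r)\<bar> \<le> C"
    using wsum_lev_scale[of 1 "1 / (3 * real n3)" hmax] n3_pos by (metis zero_less_one zero_less_divide_1_iff zero_less_mult_iff zero_less_numeral zero_less_power)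
  have "ln (real (covering_number (cball x R \<inter> F) r)) \<le> wsum hmax (lev R) (lev r) + (ln 64 + C)"
    if "x \<in> F" "0 < R" "0 < r" for x R r
  proof -
    let ?m = "lev (1 / (3 * real n3) * r)"
    have "covering_number (cball x R \<inter> F) r \<le> 64 * (\<Prod>l<?m 0. ext_max D (depth (lev R) l) (depth ?m l))"
    proof (rule covering_number_ball_le[of "lev R" R ?m r])
      show "lev R q = 0 \<or> R * real (base q) ^ lev R q \<le> 1" for q by (rule lev_upper[OF that(2)])
      show "1 / real (base q) ^ ?m q \<le> r / 3" for q by (rule lev_fine[OF that(3)])
    qed (rule decreasing_lev pattern_count_le_max | assumption)+
    then have "real (covering_number (cball x R \<inter> F) r) \<le> 64 * exp (wsum hmax (lev R) ?m)"
      unfolding exp_wsum_max by (rule real_le_64_mult)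
    moreover have "covering_number (cball x R \<inter> F) r > 0"
      using that by (intro covering_number_pos_F ball_inter_F_nonempty) auto
    ultimately have "ln (real (covering_number (cball x R \<inter> F) r)) \<le> ln (64 * exp (wsum hmax (lev R) ?m))"
      by (subst ln_le_cancel_iff) auto
    also have "\<dots> = ln 64 + wsum hmax (lev R) ?m" by (simp add: ln_mult)
    finally show ?thesis using C[rule_format, OF that(2,3)] by simp
  qed
  then show ?thesis by (intro exI allI impI)
qed

lemma pattern_count_le_ball:
  assumes "\<omega> \<in> words D" "0 < R" "0 < r"
  shows "pattern_count D (lev (1 / (3 * real n3) * R)) (lev r) \<omega>
    \<le> 64 * covering_number (cball (pt \<omega>) R \<inter> F) r"
proof (rule pattern_count_le_covering_ball)
  show "1 / real (base q) ^ lev (1 / (3 * real n3) * R) q \<le> R / 3" for q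
    by (rule lev_fine[OF assms(2)])
  show "lev r q = 0 \<or> r * real (base q) ^ lev r q \<le> 1" for q by (rule lev_upper[OF assms(3)])
qed (rule decreasing_lev assms)+

lemma pt_in_F: "\<omega> \<in> words D \<Longrightarrow> pt \<omega> \<in> F"
  by (simp add: F_eq)

lemma ln_covering_ball_lower:
  "\<exists>C. \<forall>x R r. x \<in> F \<longrightarrow> 0 < R \<longrightarrow> 0 < r \<longrightarrow>
    wsum hmin (lev R) (lev r) - C \<le> ln (real (covering_number (cball x R \<inter> F) r))"
proof -
  obtain C where C: "\<forall>R r. R > 0 \<longrightarrow> r > 0 \<longrightarrow>
      \<bar>wsum hmin (lev (1 / (3 * real n3) * R)) (lev (1 * r)) - wsum hmin (lev R) (lev r)\<bar> \<le> C"
    using wsum_lev_scale[of "1 / (3 * real n3)" 1 hmin] n3_pos by (metis zero_less_one zero_less_divide_1_iff zero_less_mult_iff zero_less_numeral zero_less_power)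
  have "wsum hmin (lev R) (lev r) - (ln 64 + C) \<le> ln (real (covering_number (cball x R \<inter> F) r))"
    if x: "x \<in> F" and "0 < R" "0 < r" for x R r
  proof -
    obtain \<omega> where w: "\<omega> \<in> words D" "x = pt \<omega>" using x by (auto simp: F_eq)
    let ?k = "lev (1 / (3 * real n3) * R)"
    let ?N = "covering_number (cball x R \<inter> F) r"
    have "(\<Prod>l<lev r 0. ext_min D (depth ?k l) (depth (lev r) l)) \<le> 64 * ?N"
      using pattern_count_ge_min[OF decreasing_lev w(1), of ?k r] pattern_count_le_ball[OF w(1) that(2,3)]
      unfolding w(2) by linarith
    then have "exp (wsum hmin ?k (lev r)) \<le> 64 * real ?N"
      unfolding exp_wsum_min by (rule real_le_64_mult)
    moreover have N: "?N > 0"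
      using that by (intro covering_number_pos_F ball_inter_F_nonempty) auto
    ultimately have "ln (exp (wsum hmin ?k (lev r))) \<le> ln (64 * real ?N)"
      by (subst ln_le_cancel_iff) auto
    also have "\<dots> = ln 64 + ln (real ?N)" using N by (simp add: ln_mult)
    finally show ?thesis using C[rule_format, OF that(2,3)] by simp
  qed
  then show ?thesis by (intro exI allI impI)
qed

text \<open>The centre depends on both radii: it codes a word that maximises the count for these
  particular levels. It suffices that the ball contains the maximal cube; whatever else it meets
  only helps.\<close>

lemma ln_covering_ball_upper_sharp:
  "\<exists>C. \<forall>R r. 0 < R \<longrightarrow> 0 < r \<longrightarrow> (\<exists>x\<in>F.
    wsum hmax (lev R) (lev r) - C \<le> ln (real (covering_number (cball x R \<inter> F) r)))"
proof -
  obtain C where C: "\<forall>R r. R > 0 \<longrightarrow> r > 0 \<longrightarrow>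
      \<bar>wsum hmax (lev (1 / (3 * real n3) * R)) (lev (1 * r)) - wsum hmax (lev R) (lev r)\<bar> \<le> C"
    using wsum_lev_scale[of "1 / (3 * real n3)" 1 hmax] n3_pos by (metis zero_less_one zero_less_divide_1_iff zero_less_mult_iff zero_less_numeral zero_less_power)
  have "\<exists>x\<in>F. wsum hmax (lev R) (lev r) - (ln 64 + C) \<le> ln (real (covering_number (cball x R \<inter> F) r))"
    if "0 < R" "0 < r" for R r
  proof -
    let ?k = "lev (1 / (3 * real n3) * R)"
    obtain \<omega> where w: "\<omega> \<in> words D"
      "pattern_count D ?k (lev r) \<omega> = (\<Prod>l<lev r 0. ext_max D (depth ?k l) (depth (lev r) l))"
      using pattern_count_max_attained[OF decreasing_lev] .
    let ?N = "covering_number (cball (pt \<omega>) R \<inter> F) r"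
    have "(\<Prod>l<lev r 0. ext_max D (depth ?k l) (depth (lev r) l)) \<le> 64 * ?N"
      using pattern_count_le_ball[OF w(1) that] unfolding w(2) .
    then have "exp (wsum hmax ?k (lev r)) \<le> 64 * real ?N"
      unfolding exp_wsum_max by (rule real_le_64_mult)
    moreover have N: "?N > 0"
      using that pt_in_F[OF w(1)] by (intro covering_number_pos_F ball_inter_F_nonempty) auto
    ultimately have "ln (exp (wsum hmax ?k (lev r))) \<le> ln (64 * real ?N)"
      by (subst ln_le_cancel_iff) auto
    also have "\<dots> = ln 64 + ln (real ?N)" using N by (simp add: ln_mult)
    finally show ?thesis using C[rule_format, OF that] pt_in_F[OF w(1)] by (intro bexI[of _ "pt \<omega>"]) auto
  qed
  then show ?thesis by (intro exI allI impI)
qed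

text \<open>The minimising word is altered at two letters per coordinate, so that its point lies well
  inside its approximate cube and a smaller ball around it meets no other cube. The shifts
  \<open>2 * (2 - q)\<close> keep the altered positions of different coordinates apart.\<close>

lemma exists_interior_word:
  assumes "decreasing k" "decreasing m"
  obtains \<omega> where "\<omega> \<in> words D"
    "pattern_count D k m \<omega> \<le> (\<Prod>l<m 0. ext_min D (depth k l) (depth m l)) * card D ^ 6"
    "\<And>q. q < 3 \<Longrightarrow> (\<forall>i\<in>D. \<forall>j\<in>D. digit_coord q i = digit_coord q j) \<or>
       digit_coord q (\<omega> (k q + 2 * (2 - q))) \<noteq> digit_coord q (\<omega> (Suc (k q + 2 * (2 - q))))"
proof -
  have "\<forall>l. \<exists>i. i \<in> D \<and> ext_count D (depth k l) (depth m l) i = ext_min D (depth k l) (depth m l)"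
    using ext_min_attained by blast
  from choice[OF this] obtain \<mu> where
    mu: "\<forall>l. \<mu> l \<in> D \<and> ext_count D (depth k l) (depth m l) (\<mu> l) = ext_min D (depth k l) (depth m l)" ..
  have "\<forall>q. \<exists>p. fst p \<in> D \<and> snd p \<in> D \<and> ((\<forall>i\<in>D. \<forall>j\<in>D. digit_coord q i = digit_coord q j) \<or>
      digit_coord q (fst p) \<noteq> digit_coord q (snd p))"
    using D_ne by (metis ex_in_conv fst_conv snd_conv)
  from choice[OF this] obtain P where
    P: "\<And>q. fst (P q) \<in> D" "\<And>q. snd (P q) \<in> D"
      "\<And>q. (\<forall>i\<in>D. \<forall>j\<in>D. digit_coord q i = digit_coord q j) \<or> digit_coord q (fst (P q)) \<noteq> digit_coord q (snd (P q))"
    by blast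
  define p where "p q = k q + 2 * (2 - q)" for q
  have p: "p 2 < p 1" "Suc (p 2) < p 1" "p 1 < p 0" "Suc (p 1) < p 0"
    using assms(1) by (simp_all add: p_def decreasing_def)
  define E where "E = {p 0, Suc (p 0), p 1, Suc (p 1), p 2, Suc (p 2)}"
  define \<omega> where "\<omega> l = (if l = p 0 then fst (P 0) else if l = Suc (p 0) then snd (P 0)
      else if l = p 1 then fst (P 1) else if l = Suc (p 1) then snd (P 1)
      else if l = p 2 then fst (P 2) else if l = Suc (p 2) then snd (P 2) else \<mu> l)" for l
  have w: "\<omega> \<in> words D" using mu P(1,2) by (auto simp: words_def \<omega>_def)
  have wp: "\<omega> (p q) = fst (P q) \<and> \<omega> (Suc (p q)) = snd (P q)" if "q < 3" for q
  proof -
    have "\<forall>q<3. \<omega> (p q) = fst (P q) \<and> \<omega> (Suc (p q)) = snd (P q)"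
      unfolding all_less_3 using p by (auto simp: \<omega>_def)
    then show ?thesis using that by blast
  qed
  have "card E \<le> 6"
    using card_length[of "[p 0, Suc (p 0), p 1, Suc (p 1), p 2, Suc (p 2)]"] by (simp add: E_def)
  then have cE: "card ({..<m 0} \<inter> E) \<le> 6"
    using card_mono[of E "{..<m 0} \<inter> E"] by (simp add: E_def)
  \<comment> \<open>At an altered letter the factor is at most \<open>card D\<close>, while the
    minimum it replaces is at least 1. Six altered letters give the factor
    \<open>card D ^ 6\<close>.\<close>
  have c: "ext_count D (depth k l) (depth m l) (\<omega> l) \<le>
      ext_min D (depth k l) (depth m l) * (if l \<in> E then card D else 1)" for l
  proof (cases "l \<in> E")
    case True
    have "ext_count D (depth k l) (depth m l) (\<omega> l) \<le> 1 * card D"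
      using ext_count_le_card by simp
    also have "\<dots> \<le> ext_min D (depth k l) (depth m l) * card D"
      using ext_min_pos by (intro mult_le_mono1) (simp add: Suc_le_eq)
    finally show ?thesis using True by simp
  next
    case False
    then have "\<omega> l = \<mu> l" by (auto simp: E_def \<omega>_def)
    then show ?thesis using mu False by simp
  qed
  have "pattern_count D k m \<omega> \<le> (\<Prod>l<m 0. ext_min D (depth k l) (depth m l) * (if l \<in> E then card D else 1))"
    unfolding pattern_count_eq_prod[OF assms(2) w] using c by (intro prod_mono) auto
  also have "\<dots> = (\<Prod>l<m 0. ext_min D (depth k l) (depth m l)) * card D ^ card ({..<m 0} \<inter> E)"
    by (simp add: prod.distrib prod.If_cases)
  also have "\<dots> \<le> (\<Prod>l<m 0. ext_min D (depth k l) (depth m l)) * card D ^ 6"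
    using cE card_D_pos by (intro mult_le_mono2 power_increasing) auto
  finally have "pattern_count D k m \<omega> \<le> (\<Prod>l<m 0. ext_min D (depth k l) (depth m l)) * card D ^ 6" .
  moreover have "(\<forall>i\<in>D. \<forall>j\<in>D. digit_coord q i = digit_coord q j) \<or>
      digit_coord q (\<omega> (k q + 2 * (2 - q))) \<noteq> digit_coord q (\<omega> (Suc (k q + 2 * (2 - q))))"
    if "q < 3" for q
    using P(3)[of q] wp[OF that] unfolding p_def by metis
  ultimately show ?thesis using that[OF w] by blast
qed

text \<open>Up to \<open>2 * (2 - q) + 2\<close>, at most 6, digits beyond the recorded level are
  involved, each costing a factor at most \<open>n3\<close>; the seventh power makes the inequality
  strict. The bound on \<open>R\<close> keeps \<open>real n3 ^ 7 * R\<close> at most 1, so that the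
  level estimate holds at level 0 too.\<close>

lemma small_radius_interior:
  assumes "0 < R" "R \<le> 1 / real n3 ^ 7" "q < 3"
  shows "R < 1 / real (base q) ^ (lev (real n3 ^ 7 * R) q + 2 * (2 - q) + 2)"
proof -
  let ?k = "lev (real n3 ^ 7 * R) q"
  have n3: "1 < real n3" using n1 n12 n23 by simp
  have b: "1 \<le> real (base q)" using base_ge[of q] by simp
  have 1: "real n3 ^ 7 * R * real (base q) ^ ?k \<le> 1"
    using lev_upper[of "real n3 ^ 7 * R" q] assms n3 by (auto simp: field_simps)
  have "real (base q) ^ (?k + 2 * (2 - q) + 2) = real (base q) ^ ?k * real (base q) ^ (2 * (2 - q) + 2)"
    by (simp add: power_add)
  also have "\<dots> \<le> real (base q) ^ ?k * real (base q) ^ 6"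
    using b by (intro mult_left_mono power_increasing) auto
  also have "\<dots> \<le> real (base q) ^ ?k * real n3 ^ 6"
    using base_le[of q] by (intro mult_left_mono power_mono) auto
  also have "\<dots> < real (base q) ^ ?k * real n3 ^ 7"
    using n3 b by (intro mult_strict_left_mono power_strict_increasing) auto
  finally have "R * real (base q) ^ (?k + 2 * (2 - q) + 2) < R * (real (base q) ^ ?k * real n3 ^ 7)"
    using assms(1) by (rule mult_strict_left_mono)
  also have "\<dots> \<le> 1" using 1 by (simp only: mult_ac)
  finally show ?thesis using b by (subst pos_less_divide_eq) auto
qed

text \<open>The coarse levels are those of the larger radius \<open>real n3 ^ 7 * R\<close>, so the
  ball around an interior point sees one cube only, and a single count, minimal up to a bounded
  factor, bounds its covering number.\<close>

lemma ln_covering_ball_lower_sharp: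
  "\<exists>C. \<forall>R r. 0 < R \<longrightarrow> R \<le> 1 / real n3 ^ 7 \<longrightarrow> 0 < r \<longrightarrow> (\<exists>x\<in>F.
    ln (real (covering_number (cball x R \<inter> F) r)) \<le> wsum hmin (lev R) (lev r) + C)"
proof -
  obtain C where C: "\<forall>R r. R > 0 \<longrightarrow> r > 0 \<longrightarrow>
      \<bar>wsum hmin (lev (real n3 ^ 7 * R)) (lev (1 / (3 * real n3) * r)) - wsum hmin (lev R) (lev r)\<bar> \<le> C"
    using wsum_lev_scale[of "real n3 ^ 7" "1 / (3 * real n3)" hmin] n3_pos by (metis zero_less_one zero_less_divide_1_iff zero_less_mult_iff zero_less_numeral zero_less_power)
  have "\<exists>x\<in>F. ln (real (covering_number (cball x R \<inter> F) r)) \<le>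
      wsum hmin (lev R) (lev r) + (ln (real (card D) ^ 6) + C)"
    if R: "0 < R" "R \<le> 1 / real n3 ^ 7" and r: "0 < r" for R r
  proof -
    let ?k = "lev (real n3 ^ 7 * R)"
    let ?m = "lev (1 / (3 * real n3) * r)"
    obtain \<omega> where w: "\<omega> \<in> words D"
      "pattern_count D ?k ?m \<omega> \<le> (\<Prod>l<?m 0. ext_min D (depth ?k l) (depth ?m l)) * card D ^ 6"
      "\<And>q. q < 3 \<Longrightarrow> (\<forall>i\<in>D. \<forall>j\<in>D. digit_coord q i = digit_coord q j) \<or>
         digit_coord q (\<omega> (?k q + 2 * (2 - q))) \<noteq> digit_coord q (\<omega> (Suc (?k q + 2 * (2 - q))))"
      using exists_interior_word[OF decreasing_lev decreasing_lev] by blast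
    let ?N = "covering_number (cball (pt \<omega>) R \<inter> F) r"
    have s: "cyl D ?k \<omega> \<subseteq> words D" by (auto simp: cyl_def)
    have "cball (pt \<omega>) R \<inter> F \<subseteq> pt ` cyl D ?k \<omega>"
      using w(3) small_radius_interior[OF R]
      by (intro cball_inter_F_subset_cyl[OF decreasing_lev w(1), of _ "\<lambda>q. ?k q + 2 * (2 - q)"]) auto
    then have "?N \<le> covering_number (pt ` cyl D ?k \<omega>) r"
      using s by (intro covering_number_mono_F[OF r]) (auto simp: F_eq)
    also have "\<dots> \<le> pattern_count D ?k ?m \<omega>"
      unfolding pattern_count_def
      by (rule covering_number_le_patterns[of ?m, OF decreasing_lev s]) (rule lev_fine[OF r])
    also note w(2)
    finally have "real ?N \<le> exp (wsum hmin ?k ?m) * real (card D) ^ 6"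
      unfolding exp_wsum_min by (rule real_le_mult_power)
    moreover have "?N > 0"
      using R r pt_in_F[OF w(1)] by (intro covering_number_pos_F ball_inter_F_nonempty) auto
    ultimately have "ln (real ?N) \<le> ln (exp (wsum hmin ?k ?m) * real (card D) ^ 6)"
      using card_D_pos by (subst ln_le_cancel_iff) auto
    also have "\<dots> = wsum hmin ?k ?m + ln (real (card D) ^ 6)"
      using card_D_pos by (subst ln_mult_pos) auto
    finally show ?thesis using C[rule_format, OF R(1) r] pt_in_F[OF w(1)] by (intro bexI[of _ "pt \<omega>"]) auto
  qed
  then show ?thesis by (intro exI allI impI)
qed

end

subsection \<open>Critical exponents\<close>

lemma Inf_critical_exponent:
  fixes v :: real
  assumes "\<And>s. v < s \<Longrightarrow> s \<in> S" "\<And>s. s \<in> S \<Longrightarrow> v \<le> s"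
  shows "Inf S = v"
proof (rule antisym)
  have bdd: "bdd_below S" using assms(2) by (intro bdd_belowI)
  show "Inf S \<le> v"
  proof (rule field_le_epsilon)
    fix e :: real assume "0 < e"
    then show "Inf S \<le> v + e" using assms(1)[of "v + e"] bdd by (intro cInf_lower) auto
  qed
  have "S \<noteq> {}" using assms(1)[of "v + 1"] by auto
  then show "v \<le> Inf S" using assms(2) by (rule cInf_greatest)
qed

text \<open>Admissible exponents are positive, so for \<open>v = 0\<close> there are none; the
  convention for the empty set then gives the right value.\<close>

lemma Sup0_critical_exponent:
  assumes "0 \<le> v" "\<And>s. 0 < s \<Longrightarrow> s < v \<Longrightarrow> s \<in> S" "\<And>s. s \<in> S \<Longrightarrow> 0 < s \<and> s \<le> v"
  shows "Sup0 S = v"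
proof (cases "S = {}")
  case True
  have "v = 0"
  proof (rule ccontr)
    assume "v \<noteq> 0"
    then have "v / 2 \<in> S" using assms(1) by (intro assms(2)) auto
    then show False using True by simp
  qed
  then show ?thesis using True by (simp add: Sup0_def)
next
  case False
  have bdd: "bdd_above S" using assms(3) by (intro bdd_aboveI) auto
  have le: "Sup S \<le> v" using False assms(3) by (intro cSup_least) auto
  obtain s0 where s0: "s0 \<in> S" using False by blast
  have pos: "0 < Sup S" using assms(3)[OF s0] cSup_upper[OF s0 bdd] by linarith
  have "v \<le> Sup S"
  proof (rule ccontr)
    assume "\<not> v \<le> Sup S"
    then have "(Sup S + v) / 2 \<in> S" using pos by (intro assms(2)) auto
    then have "(Sup S + v) / 2 \<le> Sup S" using bdd by (rule cSup_upper)
    then show False using \<open>\<not> v \<le> Sup S\<close> by simp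
  qed
  then show ?thesis using le False by (simp add: Sup0_def)
qed

text \<open>Used with \<open>t = ln (1 / R)\<close> as \<open>R\<close> tends to 0: additive
  constants drop out and a comparison of exponents remains. The threshold \<open>T\<close> admits
  estimates valid for small \<open>R\<close> only.\<close>

lemma slope_nonpos_if_bounded:
  fixes a :: real
  assumes "\<And>t. T < t \<Longrightarrow> a * t \<le> b"
  shows "a \<le> 0"
proof (rule ccontr)
  assume "\<not> a \<le> 0"
  then have a: "a > 0" by simp
  define t where "t = max T (b / a) + 1"
  have "b / a < t" by (simp add: t_def)
  then have "b < a * t" using a by (simp add: field_simps)
  moreover have "a * t \<le> b" by (rule assms) (simp add: t_def)
  ultimately show False by simp
qed

lemma real_floor_diff_le:
  assumes "x \<le> y" shows "real (nat \<lfloor>y\<rfloor> - nat \<lfloor>x\<rfloor>) \<le> y - x + 1"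
proof -
  have "nat \<lfloor>x\<rfloor> \<le> nat \<lfloor>y\<rfloor>" using assms by (intro nat_mono floor_mono)
  then show ?thesis using assms by (simp only: of_nat_diff) linarith
qed

text \<open>Levels are clipped at 0, so their difference can fall short when \<open>x\<close> is
  negative. This corresponds to the restriction \<open>R < 1\<close> in the lower dimension, whereas
  the upper estimate holds for all \<open>R\<close>.\<close>

lemma real_floor_diff_ge:
  assumes "x \<le> y" "0 \<le> x" shows "y - x - 1 \<le> real (nat \<lfloor>y\<rfloor> - nat \<lfloor>x\<rfloor>)"
proof -
  have "nat \<lfloor>x\<rfloor> \<le> nat \<lfloor>y\<rfloor>" using assms by (intro nat_mono floor_mono)
  then show ?thesis using assms by (simp only: of_nat_diff) linarith
qed

lemma weighted_diff_close:
  fixes g :: real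
  assumes "\<bar>a - a'\<bar> \<le> 1" "\<bar>b - b'\<bar> \<le> 1" "0 \<le> g" "g \<le> H"
  shows "\<bar>(a - b) * g - (a' - b') * g\<bar> \<le> 2 * H"
proof -
  have "\<bar>(a - b) * g - (a' - b') * g\<bar> = \<bar>(a - b) - (a' - b')\<bar> * g"
    using assms(3) by (simp add: abs_mult flip: left_diff_distrib)
  also have "\<dots> \<le> 2 * H" using assms by (intro mult_mono) auto
  finally show ?thesis .
qed

lemma scaled_diff: "(a - \<theta> * b) * (s * t) = a * s * t - (\<theta> * s) * b * t" for a :: real
  by (simp add: algebra_simps)

lemma abs_diff_sum3:
  fixes a :: real
  assumes "\<bar>a - a'\<bar> \<le> e" "\<bar>b - b'\<bar> \<le> e" "\<bar>c - c'\<bar> \<le> e"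
  shows "\<bar>a + b + c - (a' + b' + c')\<bar> \<le> 3 * e"
  using assms by linarith

section \<open>Growth exponents of the extremal counts\<close>

context bm_digits
begin

abbreviation lb :: "nat \<Rightarrow> real" where "lb q \<equiv> ln (real (base q))"

text \<open>The shape of \<open>f1\<close> and \<open>g1\<close>, with logarithms of quotients
  written as differences of local exponents. Likewise \<open>exponent2\<close> is the shape of
  \<open>f2\<close> and \<open>g2\<close>, and \<open>exponent3\<close> is the Assouad or lower
  dimension.\<close>

definition exponent1 :: "(nat \<Rightarrow> nat \<Rightarrow> real) \<Rightarrow> real \<Rightarrow> real" where
  "exponent1 h \<theta> = (h 0 (Suc 0) / lb 0 + (h 0 2 - h 0 (Suc 0)) / lb 1 + (h 0 3 - h 0 2) / lb 2
     - \<theta> * ((h 0 3 - h (Suc 0) 3) / lb 0 + (h (Suc 0) 3 - h 2 3) / lb 1 + h 2 3 / lb 2)) / (1 - \<theta>)"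

definition exponent2 :: "(nat \<Rightarrow> nat \<Rightarrow> real) \<Rightarrow> real \<Rightarrow> real" where
  "exponent2 h \<theta> = (h 0 (Suc 0) / lb 0 + (h 0 2 - h 0 (Suc 0)) / lb 1 + (h (Suc 0) 3 - h (Suc 0) 2) / lb 2
     - \<theta> * ((h 0 2 - h (Suc 0) 2) / lb 0 + (h (Suc 0) 3 - h 2 3) / lb 1 + h 2 3 / lb 2)) / (1 - \<theta>)"

definition exponent3 :: "(nat \<Rightarrow> nat \<Rightarrow> real) \<Rightarrow> real" where
  "exponent3 h = h 0 (Suc 0) / lb 0 + h (Suc 0) 2 / lb 1 + h 2 3 / lb 2"

text \<open>For \<open>r = R powr (1 / \<theta>)\<close> one has
  \<open>ln (R / r) = (1 / \<theta> - 1) * ln (1 / R)\<close>, so \<open>v\<close> is the power of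
  \<open>R / r\<close> with which the extremal count grows, up to bounded factors.\<close>

definition spectral_exponent :: "(nat \<Rightarrow> nat \<Rightarrow> real) \<Rightarrow> real \<Rightarrow> real \<Rightarrow> bool" where
  "spectral_exponent h \<theta> v \<longleftrightarrow> (\<exists>C. \<forall>R. 0 < R \<longrightarrow> R < 1 \<longrightarrow>
     \<bar>wsum h (lev R) (lev (R powr (1 / \<theta>))) - v * ((1 / \<theta> - 1) * ln (1 / R))\<bar> \<le> C)"

lemma lev_le_lev:
  "ln (1 / R) / lb q \<le> ln (1 / r) / lb q' \<Longrightarrow> lev R q \<le> lev r q'"
  unfolding lev_def by (intro nat_mono floor_mono)

lemma lev_close: "0 \<le> ln (1 / \<rho>) \<Longrightarrow> \<bar>real (lev \<rho> q) - ln (1 / \<rho>) / lb q\<bar> \<le> 1"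
  using lev_bounds[of \<rho> q] by linarith

lemma ln_inverse_powr: "0 < (R::real) \<Longrightarrow> ln (1 / R powr a) = a * ln (1 / R)"
  by (simp add: ln_div ln_powr)

text \<open>With \<open>t = ln (1 / R)\<close> the two sides are the unrounded levels of
  \<open>R\<close> in coordinate \<open>q\<close> and of \<open>r\<close> in coordinate
  \<open>q'\<close>. The thresholds for \<theta> are the ratios at which such a pair changes
  order.\<close>

lemma ratio_le_iff:
  assumes "0 < \<theta>" "0 < t"
  shows "t / lb q \<le> (1 / \<theta> * t) / lb q' \<longleftrightarrow> \<theta> \<le> lb q / lb q'"
    and "(1 / \<theta> * t) / lb q' \<le> t / lb q \<longleftrightarrow> lb q / lb q' \<le> \<theta>"
  using assms ln_base_pos[of q] ln_base_pos[of q'] by (simp_all add: field_simps)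

lemma spectral_exponent1:
  assumes "0 < \<theta>" "\<theta> < 1" "\<theta> \<le> lb 0 / lb 2" and h: "h = hmax \<or> h = hmin"
  shows "spectral_exponent h \<theta> (exponent1 h \<theta>)"
  unfolding spectral_exponent_def
proof (intro exI allI impI)
  fix R :: real assume R: "0 < R" "R < 1"
  define t where "t = ln (1 / R)"
  define r where "r = R powr (1 / \<theta>)"
  define s where "s = 1 / \<theta>"
  define H where "H = ln (real (card D))"
  have h0: "h 3 3 = 0" "0 \<le> h a b" "h a b \<le> H" for a b
    using h h_trivial h_nonneg h_le by (auto simp: H_def)
  have t: "0 < t" using R by (simp add: t_def)
  have s: "0 < s" "\<theta> * s = 1" using assms by (simp_all add: s_def)
  have tr: "ln (1 / r) = s * t" using R by (simp add: r_def t_def s_def ln_inverse_powr)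
  have k: "\<bar>real (lev R q) - t / lb q\<bar> \<le> 1" for q using lev_close[of R q] t by (simp add: t_def)
  have m: "\<bar>real (lev r q) - s * t / lb q\<bar> \<le> 1" for q using lev_close[of r q] t s by (simp add: tr)
  have "lev R 0 \<le> lev r 2"
    using ratio_le_iff(1)[OF assms(1) t, of 0 2] assms(3)
    by (intro lev_le_lev) (simp only: tr t_def[symmetric] s_def)
  then have "wsum h (lev R) (lev r) = (real (lev R 1) - real (lev R 2)) * h 2 3
     + (real (lev R 0) - real (lev R 1)) * h (Suc 0) 3
     + (real (lev r 2) - real (lev R 0)) * h 0 3 + (real (lev r 1) - real (lev r 2)) * h 0 2
     + (real (lev r 0) - real (lev r 1)) * h 0 (Suc 0)"
    by (intro wsum_separated lev_antimono_coord h0) auto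
  \<comment> \<open>Replacing levels by unrounded quotients changes each of the five block lengths
    by at most 2, and the weights are at most \<open>H\<close>.\<close>
  then have "\<bar>wsum h (lev R) (lev r) - ((t / lb 1 - t / lb 2) * h 2 3 + (t / lb 0 - t / lb 1) * h (Suc 0) 3
     + (s * t / lb 2 - t / lb 0) * h 0 3 + (s * t / lb 1 - s * t / lb 2) * h 0 2
     + (s * t / lb 0 - s * t / lb 1) * h 0 (Suc 0))\<bar> \<le> 10 * H"
    using weighted_diff_close[OF k k h0(2,3), of 1 2 2 3]
      weighted_diff_close[OF k k h0(2,3), of 0 1 "Suc 0" 3]
      weighted_diff_close[OF m k h0(2,3), of 2 0 0 3]
      weighted_diff_close[OF m m h0(2,3), of 1 2 0 2]
      weighted_diff_close[OF m m h0(2,3), of 0 1 0 "Suc 0"] by linarith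
  moreover have "(t / lb 1 - t / lb 2) * h 2 3 + (t / lb 0 - t / lb 1) * h (Suc 0) 3
     + (s * t / lb 2 - t / lb 0) * h 0 3 + (s * t / lb 1 - s * t / lb 2) * h 0 2
     + (s * t / lb 0 - s * t / lb 1) * h 0 (Suc 0) = exponent1 h \<theta> * ((1 / \<theta> - 1) * t)"
  proof -
    have "exponent1 h \<theta> * ((1 / \<theta> - 1) * t) = exponent1 h \<theta> * (1 - \<theta>) * (s * t)"
      using assms by (simp add: s_def field_simps)
    also have "exponent1 h \<theta> * (1 - \<theta>) = h 0 (Suc 0) / lb 0 + (h 0 2 - h 0 (Suc 0)) / lb 1
      + (h 0 3 - h 0 2) / lb 2
      - \<theta> * ((h 0 3 - h (Suc 0) 3) / lb 0 + (h (Suc 0) 3 - h 2 3) / lb 1 + h 2 3 / lb 2)"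
      using assms by (simp add: exponent1_def)
    also have "\<dots> * (s * t) = (h 0 (Suc 0) / lb 0 + (h 0 2 - h 0 (Suc 0)) / lb 1
      + (h 0 3 - h 0 2) / lb 2) * s * t
      - (\<theta> * s) * ((h 0 3 - h (Suc 0) 3) / lb 0 + (h (Suc 0) 3 - h 2 3) / lb 1 + h 2 3 / lb 2) * t"
      by (rule scaled_diff)
    finally show ?thesis unfolding s(2)
      by (simp add: algebra_simps add_divide_distrib diff_divide_distrib)
  qed
  ultimately show "\<bar>wsum h (lev R) (lev (R powr (1 / \<theta>))) - exponent1 h \<theta> * ((1 / \<theta> - 1) * ln (1 / R))\<bar>
      \<le> 10 * ln (real (card D))"
    by (simp only: r_def t_def H_def)
qed

text \<open>Three comparisons of levels fix the interlacing. The one of \<open>lev R 0\<close> with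
  \<open>lev r 1\<close> contributes the last condition on \<theta>, which the hypothesis on the
  logarithms turns into \<open>\<theta> \<le> lb 1 / lb 2\<close>.\<close>

lemma spectral_exponent2:
  assumes "0 < \<theta>" "\<theta> < 1" "lb 0 / lb 2 \<le> \<theta>" "\<theta> \<le> lb 1 / lb 2" "\<theta> \<le> lb 0 / lb 1"
    and h: "h = hmax \<or> h = hmin"
  shows "spectral_exponent h \<theta> (exponent2 h \<theta>)"
  unfolding spectral_exponent_def
proof (intro exI allI impI)
  fix R :: real assume R: "0 < R" "R < 1"
  define t where "t = ln (1 / R)"
  define r where "r = R powr (1 / \<theta>)"
  define s where "s = 1 / \<theta>"
  define H where "H = ln (real (card D))"
  have h0: "h 3 3 = 0" "0 \<le> h a b" "h a b \<le> H" for a b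
    using h h_trivial h_nonneg h_le by (auto simp: H_def)
  have t: "0 < t" using R by (simp add: t_def)
  have s: "0 < s" "\<theta> * s = 1" using assms by (simp_all add: s_def)
  have tr: "ln (1 / r) = s * t" using R by (simp add: r_def t_def s_def ln_inverse_powr)
  have k: "\<bar>real (lev R q) - t / lb q\<bar> \<le> 1" for q using lev_close[of R q] t by (simp add: t_def)
  have m: "\<bar>real (lev r q) - s * t / lb q\<bar> \<le> 1" for q using lev_close[of r q] t s by (simp add: tr)
  have "lev R 1 \<le> lev r 2" "lev r 2 \<le> lev R 0" "lev R 0 \<le> lev r 1"
    using ratio_le_iff(1)[OF assms(1) t, of 1 2] ratio_le_iff(2)[OF assms(1) t, of 2 0]
      ratio_le_iff(1)[OF assms(1) t, of 0 1] assms(3,4,5)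
    by (intro lev_le_lev; simp only: tr t_def[symmetric] s_def)+
  then have "wsum h (lev R) (lev r) = (real (lev R 1) - real (lev R 2)) * h 2 3
     + (real (lev r 2) - real (lev R 1)) * h (Suc 0) 3
     + (real (lev R 0) - real (lev r 2)) * h (Suc 0) 2 + (real (lev r 1) - real (lev R 0)) * h 0 2
     + (real (lev r 0) - real (lev r 1)) * h 0 (Suc 0)"
    by (intro wsum_interlaced lev_antimono_coord h0) auto
  then have "\<bar>wsum h (lev R) (lev r) - ((t / lb 1 - t / lb 2) * h 2 3 + (s * t / lb 2 - t / lb 1) * h (Suc 0) 3
     + (t / lb 0 - s * t / lb 2) * h (Suc 0) 2 + (s * t / lb 1 - t / lb 0) * h 0 2
     + (s * t / lb 0 - s * t / lb 1) * h 0 (Suc 0))\<bar> \<le> 10 * H"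
    using weighted_diff_close[OF k k h0(2,3), of 1 2 2 3]
      weighted_diff_close[OF m k h0(2,3), of 2 1 "Suc 0" 3]
      weighted_diff_close[OF k m h0(2,3), of 0 2 "Suc 0" 2]
      weighted_diff_close[OF m k h0(2,3), of 1 0 0 2]
      weighted_diff_close[OF m m h0(2,3), of 0 1 0 "Suc 0"] by linarith
  moreover have "(t / lb 1 - t / lb 2) * h 2 3 + (s * t / lb 2 - t / lb 1) * h (Suc 0) 3
     + (t / lb 0 - s * t / lb 2) * h (Suc 0) 2 + (s * t / lb 1 - t / lb 0) * h 0 2
     + (s * t / lb 0 - s * t / lb 1) * h 0 (Suc 0) = exponent2 h \<theta> * ((1 / \<theta> - 1) * t)"
  proof -
    have "exponent2 h \<theta> * ((1 / \<theta> - 1) * t) = exponent2 h \<theta> * (1 - \<theta>) * (s * t)"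
      using assms by (simp add: s_def field_simps)
    also have "exponent2 h \<theta> * (1 - \<theta>) = h 0 (Suc 0) / lb 0 + (h 0 2 - h 0 (Suc 0)) / lb 1
      + (h (Suc 0) 3 - h (Suc 0) 2) / lb 2
      - \<theta> * ((h 0 2 - h (Suc 0) 2) / lb 0 + (h (Suc 0) 3 - h 2 3) / lb 1 + h 2 3 / lb 2)"
      using assms by (simp add: exponent2_def)
    also have "\<dots> * (s * t) = (h 0 (Suc 0) / lb 0 + (h 0 2 - h 0 (Suc 0)) / lb 1
      + (h (Suc 0) 3 - h (Suc 0) 2) / lb 2) * s * t
      - (\<theta> * s) * ((h 0 2 - h (Suc 0) 2) / lb 0 + (h (Suc 0) 3 - h 2 3) / lb 1 + h 2 3 / lb 2) * t"
      by (rule scaled_diff)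
    finally show ?thesis unfolding s(2)
      by (simp add: algebra_simps add_divide_distrib diff_divide_distrib)
  qed
  ultimately show "\<bar>wsum h (lev R) (lev (R powr (1 / \<theta>))) - exponent2 h \<theta> * ((1 / \<theta> - 1) * ln (1 / R))\<bar>
      \<le> 10 * ln (real (card D))"
    by (simp only: r_def t_def H_def)
qed

text \<open>Once \<theta> passes both ratios of neighbouring bases, each coordinate contributes
  about \<open>ln (R / r) / lb q\<close> positions with its own extremal fibre count, and the
  exponent no longer depends on \<theta>.\<close>

lemma spectral_exponent3:
  assumes "0 < \<theta>" "\<theta> < 1" "lb 1 / lb 2 \<le> \<theta>" "lb 0 / lb 1 \<le> \<theta>"
    and h: "h = hmax \<or> h = hmin"
  shows "spectral_exponent h \<theta> (exponent3 h)"
  unfolding spectral_exponent_def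
proof (intro exI allI impI)
  fix R :: real assume R: "0 < R" "R < 1"
  define t where "t = ln (1 / R)"
  define r where "r = R powr (1 / \<theta>)"
  define s where "s = 1 / \<theta>"
  define H where "H = ln (real (card D))"
  have h0: "b \<le> a \<Longrightarrow> h a b = 0" "0 \<le> h a b" "h a b \<le> H" for a b
    using h h_trivial h_nonneg h_le by (auto simp: H_def)
  have t: "0 < t" using R by (simp add: t_def)
  have s: "0 < s" "\<theta> * s = 1" using assms by (simp_all add: s_def)
  have tr: "ln (1 / r) = s * t" using R by (simp add: r_def t_def s_def ln_inverse_powr)
  have k: "\<bar>real (lev R q) - t / lb q\<bar> \<le> 1" for q using lev_close[of R q] t by (simp add: t_def)
  have m: "\<bar>real (lev r q) - s * t / lb q\<bar> \<le> 1" for q using lev_close[of r q] t s by (simp add: tr)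
  have "lev r 2 \<le> lev R 1" "lev r 1 \<le> lev R 0"
    using ratio_le_iff(2)[OF assms(1) t, of 2 1] ratio_le_iff(2)[OF assms(1) t, of 1 0] assms(3,4)
    by (intro lev_le_lev; simp only: tr t_def[symmetric] s_def)+
  moreover have "lev R q \<le> lev r q" for q
    using ratio_le_iff(1)[OF assms(1) t, of q q] assms(2) ln_base_pos[of q]
    by (intro lev_le_lev) (simp add: tr t_def[symmetric] s_def)
  ultimately have "wsum h (lev R) (lev r) = (real (lev r 2) - real (lev R 2)) * h 2 3
     + (real (lev r 1) - real (lev R 1)) * h (Suc 0) 2
     + (real (lev r 0) - real (lev R 0)) * h 0 (Suc 0)"
    by (intro wsum_nested h0) auto
  then have "\<bar>wsum h (lev R) (lev r) - ((s * t / lb 2 - t / lb 2) * h 2 3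
     + (s * t / lb 1 - t / lb 1) * h (Suc 0) 2 + (s * t / lb 0 - t / lb 0) * h 0 (Suc 0))\<bar> \<le> 6 * H"
    using abs_diff_sum3[OF weighted_diff_close[OF m k h0(2,3), of 2 2 2 3]
      weighted_diff_close[OF m k h0(2,3), of 1 1 "Suc 0" 2]
      weighted_diff_close[OF m k h0(2,3), of 0 0 0 "Suc 0"]] by simp
  moreover have "(s * t / lb 2 - t / lb 2) * h 2 3
     + (s * t / lb 1 - t / lb 1) * h (Suc 0) 2 + (s * t / lb 0 - t / lb 0) * h 0 (Suc 0)
     = exponent3 h * ((1 / \<theta> - 1) * t)"
    unfolding exponent3_def s_def[symmetric]
    by (simp add: algebra_simps add_divide_distrib diff_divide_distrib)
  ultimately show "\<bar>wsum h (lev R) (lev (R powr (1 / \<theta>))) - exponent3 h * ((1 / \<theta> - 1) * ln (1 / R))\<bar>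
      \<le> 6 * ln (real (card D))"
    by (simp only: r_def t_def H_def)
qed

lemma wsum_nonneg: "h = hmax \<or> h = hmin \<Longrightarrow> 0 \<le> wsum h k m"
  unfolding wsum_def using h_nonneg by (intro sum_nonneg) auto

text \<open>The spectra are defined with positive exponents only; \<open>0 \<le> v\<close> ensures
  that this restriction does not cut off the critical value. It holds because extremal counts are at
  least 1.\<close>

lemma spectral_exponent_nonneg:
  assumes "0 < \<theta>" "\<theta> < 1" "spectral_exponent h \<theta> v" "h = hmax \<or> h = hmin"
  shows "0 \<le> v"
proof -
  obtain C where C: "\<forall>R. 0 < R \<longrightarrow> R < 1 \<longrightarrow>
     \<bar>wsum h (lev R) (lev (R powr (1 / \<theta>))) - v * ((1 / \<theta> - 1) * ln (1 / R))\<bar> \<le> C"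
    using assms(3) unfolding spectral_exponent_def ..
  have "- (v * (1 / \<theta> - 1)) \<le> 0"
  proof (rule slope_nonpos_if_bounded)
    fix t :: real assume "0 < t"
    then show "- (v * (1 / \<theta> - 1)) * t \<le> C"
      using C[rule_format, of "exp (- t)"] wsum_nonneg[OF assms(4), of "lev (exp (- t))" "lev (exp (- t) powr (1 / \<theta>))"]
      by (simp add: ln_div)
  qed
  then have "0 \<le> v * (1 / \<theta> - 1)" by simp
  moreover have "0 < 1 / \<theta> - 1" using assms by simp
  ultimately show ?thesis by (simp add: zero_le_mult_iff)
qed

section \<open>From growth exponents to the two spectra\<close>

lemma powr_ratio: "0 < (R::real) \<Longrightarrow> 0 < r \<Longrightarrow> (R / r) powr s = exp (s * ln (R / r))"
  by (simp add: powr_def)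

lemma ln_ratio_powr: "0 < (R::real) \<Longrightarrow> ln (R / R powr a) = (a - 1) * ln (1 / R)"
  by (simp add: ln_div ln_powr algebra_simps)

lemma covering_ball_pos: "x \<in> F \<Longrightarrow> 0 < R \<Longrightarrow> 0 < r \<Longrightarrow> 0 < real (covering_number (cball x R \<inter> F) r)"
  using covering_number_pos_F[OF _ Int_lower2 ball_inter_F_nonempty] by simp

lemma covering_ball_le_expI:
  assumes "x \<in> F" "0 < R" "0 < r" "ln (real (covering_number (cball x R \<inter> F) r)) \<le> s * ln (R / r) + C"
  shows "real (covering_number (cball x R \<inter> F) r) \<le> exp C * (R / r) powr s"
proof -
  have "real (covering_number (cball x R \<inter> F) r) = exp (ln (real (covering_number (cball x R \<inter> F) r)))"
    using covering_ball_pos[OF assms(1-3)] by simp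
  also have "\<dots> \<le> exp (s * ln (R / r) + C)" using assms(4) by simp
  finally show ?thesis using assms by (simp add: powr_ratio exp_add mult.commute)
qed

lemma covering_ball_ge_expI:
  assumes "x \<in> F" "0 < R" "0 < r" "s * ln (R / r) - C \<le> ln (real (covering_number (cball x R \<inter> F) r))"
  shows "exp (- C) * (R / r) powr s \<le> real (covering_number (cball x R \<inter> F) r)"
proof -
  have "exp (- C) * (R / r) powr s = exp (s * ln (R / r) - C)"
    using assms by (simp add: powr_ratio flip: exp_add)
  also have "\<dots> \<le> exp (ln (real (covering_number (cball x R \<inter> F) r)))" using assms(4) by simp
  also have "\<dots> = real (covering_number (cball x R \<inter> F) r)"
    using covering_ball_pos[OF assms(1-3)] by simp
  finally show ?thesis .
qed

lemma ln_mult_powr: "0 < (C::real) \<Longrightarrow> 0 < R \<Longrightarrow> 0 < r \<Longrightarrow> ln (C * (R / r) powr s) = ln C + s * ln (R / r)"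
  by (simp add: ln_mult_pos ln_powr)

text \<open>Stated for one admissible pair \<open>C\<close>, \<open>s\<close> rather than for the
  spectrum, so that it applies to the Assouad dimension as well, whose condition contains this
  one.\<close>

lemma assouad_spectrum_exponent_ge:
  assumes \<theta>: "0 < \<theta>" "\<theta> < 1" and v: "spectral_exponent hmax \<theta> v"
    and C: "C > 0" "\<And>R x. x \<in> F \<Longrightarrow> 0 < R \<Longrightarrow> R < 1 \<Longrightarrow>
      real (covering_number (cball x R \<inter> F) (R powr (1 / \<theta>))) \<le> C * (R / R powr (1 / \<theta>)) powr s"
  shows "v \<le> s"
proof -
  obtain C1 where C1: "\<forall>R. 0 < R \<longrightarrow> R < 1 \<longrightarrow>
     \<bar>wsum hmax (lev R) (lev (R powr (1 / \<theta>))) - v * ((1 / \<theta> - 1) * ln (1 / R))\<bar> \<le> C1"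
    using v unfolding spectral_exponent_def ..
  obtain C2 where C2: "\<forall>R r. 0 < R \<longrightarrow> 0 < r \<longrightarrow> (\<exists>x\<in>F.
      wsum hmax (lev R) (lev r) - C2 \<le> ln (real (covering_number (cball x R \<inter> F) r)))"
    using ln_covering_ball_upper_sharp ..
  have "(v - s) * (1 / \<theta> - 1) \<le> 0"
  proof (rule slope_nonpos_if_bounded)
    fix t :: real assume t: "0 < t"
    define R where "R = exp (- t)"
    have R: "0 < R" "R < 1" "ln (1 / R) = t" using t by (simp_all add: R_def ln_div)
    define r where "r = R powr (1 / \<theta>)"
    have r: "0 < r" using R by (simp add: r_def)
    obtain x where x: "x \<in> F" "wsum hmax (lev R) (lev r) - C2 \<le> ln (real (covering_number (cball x R \<inter> F) r))"
      using C2[rule_format, OF R(1) r] ..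
    note x(2)
    also have "ln (real (covering_number (cball x R \<inter> F) r)) \<le> ln (C * (R / r) powr s)"
      using C(1) C(2)[OF x(1) R(1,2)] covering_ball_pos[OF x(1) R(1) r] R r
      unfolding r_def[symmetric] by (subst ln_le_cancel_iff) auto
    also have "\<dots> = ln C + s * ((1 / \<theta> - 1) * t)"
      using C(1) R r by (simp only: ln_mult_powr) (simp only: r_def ln_ratio_powr)
    finally have "v * ((1 / \<theta> - 1) * t) - s * ((1 / \<theta> - 1) * t) \<le> ln C + C1 + C2"
      using C1[rule_format, OF R(1,2)] unfolding r_def[symmetric] R(3) by linarith
    then show "(v - s) * (1 / \<theta> - 1) * t \<le> ln C + C1 + C2"
      by (simp only: left_diff_distrib mult.assoc)
  qed
  moreover have "0 < 1 / \<theta> - 1" using \<theta> by simp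
  ultimately show ?thesis by (simp add: mult_le_0_iff)
qed

lemma lower_spectrum_exponent_le:
  assumes \<theta>: "0 < \<theta>" "\<theta> < 1" and v: "spectral_exponent hmin \<theta> v"
    and C: "C > 0" "\<And>R x. x \<in> F \<Longrightarrow> 0 < R \<Longrightarrow> R < 1 \<Longrightarrow>
      C * (R / R powr (1 / \<theta>)) powr s \<le> real (covering_number (cball x R \<inter> F) (R powr (1 / \<theta>)))"
  shows "s \<le> v"
proof -
  obtain C1 where C1: "\<forall>R. 0 < R \<longrightarrow> R < 1 \<longrightarrow>
     \<bar>wsum hmin (lev R) (lev (R powr (1 / \<theta>))) - v * ((1 / \<theta> - 1) * ln (1 / R))\<bar> \<le> C1"
    using v unfolding spectral_exponent_def ..
  obtain C2 where C2: "\<forall>R r. 0 < R \<longrightarrow> R \<le> 1 / real n3 ^ 7 \<longrightarrow> 0 < r \<longrightarrow> (\<exists>x\<in>F.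
      ln (real (covering_number (cball x R \<inter> F) r)) \<le> wsum hmin (lev R) (lev r) + C2)"
    using ln_covering_ball_lower_sharp ..
  have n3: "1 \<le> real n3 ^ 7" using n1 n12 n23 by (intro one_le_power) simp
  have "(s - v) * (1 / \<theta> - 1) \<le> 0"
  proof (rule slope_nonpos_if_bounded)
    \<comment> \<open>Minimal balls are available only for \<open>R \<le> 1 / real n3 ^ 7\<close>,
      hence the threshold for \<open>t\<close>.\<close>
    fix t :: real assume t: "ln (real n3 ^ 7) < t"
    define R where "R = exp (- t)"
    have "0 \<le> ln (real n3 ^ 7)" using n3 by (rule ln_ge_zero)
    then have R: "0 < R" "R < 1" "ln (1 / R) = t" using t by (simp_all add: R_def ln_div)
    have "exp (- t) \<le> exp (- ln (real n3 ^ 7))" using t by (simp del: ln_realpow)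
    also have "\<dots> = 1 / real n3 ^ 7" using n3 n3_pos by (simp add: exp_minus inverse_eq_divide del: ln_realpow)
    finally have R': "R \<le> 1 / real n3 ^ 7" unfolding R_def .
    define r where "r = R powr (1 / \<theta>)"
    have r: "0 < r" using R by (simp add: r_def)
    obtain x where x: "x \<in> F" "ln (real (covering_number (cball x R \<inter> F) r)) \<le> wsum hmin (lev R) (lev r) + C2"
      using C2[rule_format, OF R(1) R' r] ..
    have "ln C + s * ((1 / \<theta> - 1) * t) = ln (C * (R / r) powr s)"
      using C(1) R r by (simp only: ln_mult_powr) (simp only: r_def ln_ratio_powr)
    also have "\<dots> \<le> ln (real (covering_number (cball x R \<inter> F) r))"
      using C(1) C(2)[OF x(1) R(1,2)] covering_ball_pos[OF x(1) R(1) r] R r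
      unfolding r_def[symmetric] by (subst ln_le_cancel_iff) auto
    also note x(2)
    finally have "s * ((1 / \<theta> - 1) * t) - v * ((1 / \<theta> - 1) * t) \<le> C1 + C2 - ln C"
      using C1[rule_format, OF R(1,2)] unfolding r_def[symmetric] R(3) by linarith
    then show "(s - v) * (1 / \<theta> - 1) * t \<le> C1 + C2 - ln C"
      by (simp only: left_diff_distrib mult.assoc)
  qed
  moreover have "0 < 1 / \<theta> - 1" using \<theta> by simp
  ultimately show ?thesis by (simp add: mult_le_0_iff)
qed

lemma assouad_spectrum_eq:
  assumes \<theta>: "0 < \<theta>" "\<theta> < 1" and v: "spectral_exponent hmax \<theta> v"
  shows "assouad_spectrum \<theta> F = v"
  unfolding assouad_spectrum_def
proof (rule Inf_critical_exponent)
  fix s assume s: "v < s"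
  have v0: "0 \<le> v" using spectral_exponent_nonneg[OF \<theta> v] by simp
  obtain C1 where C1: "\<forall>R. 0 < R \<longrightarrow> R < 1 \<longrightarrow>
     \<bar>wsum hmax (lev R) (lev (R powr (1 / \<theta>))) - v * ((1 / \<theta> - 1) * ln (1 / R))\<bar> \<le> C1"
    using v unfolding spectral_exponent_def ..
  obtain C2 where C2: "\<forall>x R r. x \<in> F \<longrightarrow> 0 < R \<longrightarrow> 0 < r \<longrightarrow>
      ln (real (covering_number (cball x R \<inter> F) r)) \<le> wsum hmax (lev R) (lev r) + C2"
    using ln_covering_ball_upper ..
  have "real (covering_number (cball x R \<inter> F) (R powr (1 / \<theta>))) \<le>
      exp (C1 + C2) * (R / R powr (1 / \<theta>)) powr s" if R: "x \<in> F" "0 < R" "R < 1" for x R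
  proof (rule covering_ball_le_expI)
    have "0 \<le> (1 / \<theta> - 1) * ln (1 / R)" using \<theta> R by (intro mult_nonneg_nonneg) auto
    then have "v * ((1 / \<theta> - 1) * ln (1 / R)) \<le> s * ((1 / \<theta> - 1) * ln (1 / R))"
      using s by (intro mult_right_mono) auto
    then show "ln (real (covering_number (cball x R \<inter> F) (R powr (1 / \<theta>))))
        \<le> s * ln (R / R powr (1 / \<theta>)) + (C1 + C2)"
      using C1[rule_format, OF R(2,3)] C2[rule_format, OF R(1,2), of "R powr (1 / \<theta>)"] R
      unfolding ln_ratio_powr[OF R(2)] by (simp add: abs_le_iff)
  qed (use R in auto)
  then show "s \<in> {s. s > 0 \<and> (\<exists>C>0. \<forall>R. \<forall>x\<in>F. 0 < R \<and> R < 1 \<longrightarrow>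
     real (covering_number (cball x R \<inter> F) (R powr (1 / \<theta>))) \<le> C * (R / R powr (1 / \<theta>)) powr s)}"
    using s v0 by (intro CollectI conjI exI[of _ "exp (C1 + C2)"] allI ballI impI) auto
next
  fix s assume "s \<in> {s. s > 0 \<and> (\<exists>C>0. \<forall>R. \<forall>x\<in>F. 0 < R \<and> R < 1 \<longrightarrow>
     real (covering_number (cball x R \<inter> F) (R powr (1 / \<theta>))) \<le> C * (R / R powr (1 / \<theta>)) powr s)}"
  then show "v \<le> s" using assouad_spectrum_exponent_ge[OF assms] by blast
qed

lemma lower_spectrum_eq:
  assumes \<theta>: "0 < \<theta>" "\<theta> < 1" and v: "spectral_exponent hmin \<theta> v"
  shows "lower_spectrum \<theta> F = v"
  unfolding lower_spectrum_def
proof (rule Sup0_critical_exponent)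
  show "0 \<le> v" using spectral_exponent_nonneg[OF \<theta> v] by simp
next
  fix s assume s: "0 < s" "s < v"
  obtain C1 where C1: "\<forall>R. 0 < R \<longrightarrow> R < 1 \<longrightarrow>
     \<bar>wsum hmin (lev R) (lev (R powr (1 / \<theta>))) - v * ((1 / \<theta> - 1) * ln (1 / R))\<bar> \<le> C1"
    using v unfolding spectral_exponent_def ..
  obtain C2 where C2: "\<forall>x R r. x \<in> F \<longrightarrow> 0 < R \<longrightarrow> 0 < r \<longrightarrow>
      wsum hmin (lev R) (lev r) - C2 \<le> ln (real (covering_number (cball x R \<inter> F) r))"
    using ln_covering_ball_lower ..
  have "exp (- (C1 + C2)) * (R / R powr (1 / \<theta>)) powr s \<le>
      real (covering_number (cball x R \<inter> F) (R powr (1 / \<theta>)))" if R: "x \<in> F" "0 < R" "R < 1" for x R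
  proof (rule covering_ball_ge_expI)
    have "0 \<le> (1 / \<theta> - 1) * ln (1 / R)" using \<theta> R by (intro mult_nonneg_nonneg) auto
    then have "s * ((1 / \<theta> - 1) * ln (1 / R)) \<le> v * ((1 / \<theta> - 1) * ln (1 / R))"
      using s by (intro mult_right_mono) auto
    then show "s * ln (R / R powr (1 / \<theta>)) - (C1 + C2) \<le>
        ln (real (covering_number (cball x R \<inter> F) (R powr (1 / \<theta>))))"
      using C1[rule_format, OF R(2,3)] C2[rule_format, OF R(1,2), of "R powr (1 / \<theta>)"] R
      unfolding ln_ratio_powr[OF R(2)] by (simp add: abs_le_iff)
  qed (use R in auto)
  then show "s \<in> {s. s > 0 \<and> (\<exists>C>0. \<forall>R. \<forall>x\<in>F. 0 < R \<and> R < 1 \<longrightarrow>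
     real (covering_number (cball x R \<inter> F) (R powr (1 / \<theta>))) \<ge> C * (R / R powr (1 / \<theta>)) powr s)}"
    using s by (intro CollectI conjI exI[of _ "exp (- (C1 + C2))"] allI ballI impI) auto
next
  fix s assume "s \<in> {s. s > 0 \<and> (\<exists>C>0. \<forall>R. \<forall>x\<in>F. 0 < R \<and> R < 1 \<longrightarrow>
     real (covering_number (cball x R \<inter> F) (R powr (1 / \<theta>))) \<ge> C * (R / R powr (1 / \<theta>)) powr s)}"
  then show "0 < s \<and> s \<le> v" using lower_spectrum_exponent_le[OF assms] by blast
qed

section \<open>Assouad and lower dimensions\<close>

lemma ln_ratio: "0 < R \<Longrightarrow> 0 < r \<Longrightarrow> ln (1 / r) / l - ln (1 / R) / l = ln (R / r) / l" for R r l :: real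
  by (simp add: ln_div diff_divide_distrib)

lemma lev_diff_le:
  assumes "0 < r" "r < R"
  shows "real (lev r q - lev R q) \<le> ln (R / r) / lb q + 1"
proof -
  have "ln (1 / R) / lb q \<le> ln (1 / r) / lb q"
    using assms ln_base_pos[of q] by (intro divide_right_mono) (auto simp: ln_div)
  then show ?thesis
    using real_floor_diff_le[of "ln (1 / R) / lb q" "ln (1 / r) / lb q"] ln_ratio[of R r "lb q"] assms
    unfolding lev_def by linarith
qed

lemma lev_diff_ge:
  assumes "0 < r" "r < R" "R < 1"
  shows "ln (R / r) / lb q - 1 \<le> real (lev r q - lev R q)"
proof -
  have "ln (1 / R) / lb q \<le> ln (1 / r) / lb q"
    using assms ln_base_pos[of q] by (intro divide_right_mono) (auto simp: ln_div)
  moreover have "0 \<le> ln (1 / R) / lb q"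
    using assms ln_base_pos[of q] by (intro divide_nonneg_pos) auto
  ultimately show ?thesis
    using real_floor_diff_ge[of "ln (1 / R) / lb q" "ln (1 / r) / lb q"] ln_ratio[of R r "lb q"] assms
    unfolding lev_def by linarith
qed

lemma exponent3_mult: "exponent3 h * x = x / lb 0 * h 0 (Suc 0) + x / lb 1 * h (Suc 0) 2 + x / lb 2 * h 2 3"
  by (simp add: exponent3_def algebra_simps)

lemma sum_less_3: "(\<Sum>q<3. f q) = f 0 + f (Suc 0) + f 2" for f :: "nat \<Rightarrow> real"
  by (simp add: numeral_3_eq_3 numeral_2_eq_2)

text \<open>Rounding lengthens each coordinate by at most one level, of weight at most
  \<open>ln (real (card D))\<close>; three coordinates give the error term.\<close>

lemma wsum_hmax_le:
  assumes "0 < r" "r < R"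
  shows "wsum hmax (lev R) (lev r) \<le> exponent3 hmax * ln (R / r) + 3 * ln (real (card D))"
proof -
  have "wsum hmax (lev R) (lev r) \<le> (\<Sum>q<3. real (lev r q - lev R q) * hmax q (Suc q))"
    by (rule wsum_le_coordinatewise[OF decreasing_lev decreasing_lev h_trivial(1) hmax_subadditive])
  also have "\<dots> \<le> (\<Sum>q<3. (ln (R / r) / lb q) * hmax q (Suc q) + ln (real (card D)))"
  proof (rule sum_mono)
    fix q :: nat
    have "real (lev r q - lev R q) * hmax q (Suc q) \<le> (ln (R / r) / lb q + 1) * hmax q (Suc q)"
      using lev_diff_le[OF assms] h_nonneg by (intro mult_right_mono)
    then show "real (lev r q - lev R q) * hmax q (Suc q) \<le> (ln (R / r) / lb q) * hmax q (Suc q) + ln (real (card D))"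
      using h_le(1)[of q "Suc q"] by (simp add: distrib_right)
  qed
  also have "\<dots> = exponent3 hmax * ln (R / r) + 3 * ln (real (card D))"
    unfolding sum_less_3 exponent3_mult by (simp add: numeral_3_eq_3 numeral_2_eq_2)
  finally show ?thesis .
qed

lemma wsum_hmin_ge:
  assumes "0 < r" "r < R" "R < 1"
  shows "exponent3 hmin * ln (R / r) - 3 * ln (real (card D)) \<le> wsum hmin (lev R) (lev r)"
proof -
  have "exponent3 hmin * ln (R / r) - 3 * ln (real (card D)) =
      (\<Sum>q<3. (ln (R / r) / lb q) * hmin q (Suc q) - ln (real (card D)))"
    unfolding sum_less_3 exponent3_mult by (simp add: numeral_3_eq_3 numeral_2_eq_2)
  also have "\<dots> \<le> (\<Sum>q<3. real (lev r q - lev R q) * hmin q (Suc q))"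
  proof (rule sum_mono)
    fix q :: nat
    have "(ln (R / r) / lb q - 1) * hmin q (Suc q) \<le> real (lev r q - lev R q) * hmin q (Suc q)"
      using lev_diff_ge[OF assms] h_nonneg by (intro mult_right_mono)
    then show "(ln (R / r) / lb q) * hmin q (Suc q) - ln (real (card D)) \<le> real (lev r q - lev R q) * hmin q (Suc q)"
      using h_le(2)[of q "Suc q"] by (simp add: left_diff_distrib)
  qed
  also have "\<dots> \<le> wsum hmin (lev R) (lev r)"
    by (rule wsum_ge_coordinatewise[OF decreasing_lev decreasing_lev h_trivial(2) hmin_superadditive])
  finally show ?thesis .
qed

lemma powr_inverse_less: "0 < R \<Longrightarrow> R < 1 \<Longrightarrow> 0 < \<theta> \<Longrightarrow> \<theta> < 1 \<Longrightarrow> R powr (1 / \<theta>) < R" for R :: real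
  using powr_less_mono'[of R 1 "1 / \<theta>"] by simp

lemma exponent3_nonneg: "h = hmax \<or> h = hmin \<Longrightarrow> 0 \<le> exponent3 h"
  unfolding exponent3_def using h_nonneg ln_base_pos by (intro add_nonneg_nonneg divide_nonneg_pos) auto

lemma lb_ratio_less_1: "lb 0 / lb 1 < 1" "lb 1 / lb 2 < 1"
  using n1 n12 n23 by (simp_all add: base_def)

lemma exists_large_theta:
  obtains \<theta> where "0 < \<theta>" "\<theta> < 1" "lb 1 / lb 2 \<le> \<theta>" "lb 0 / lb 1 \<le> \<theta>"
proof -
  have "0 < lb 0 / lb 1" using ln_base_pos by simp
  then show ?thesis
    using lb_ratio_less_1 by (intro that[of "max (lb 0 / lb 1) (lb 1 / lb 2)"]) auto
qed

text \<open>The upper bound comes from subadditivity at arbitrary pairs of radii. For sharpness the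
  pairs \<open>R\<close>, \<open>R powr (1 / \<theta>)\<close> with one fixed large \<theta> are
  enough, since the largest count already grows with \<open>exponent3\<close> along them.\<close>

lemma assouad_dim_eq: "assouad_dim F = exponent3 hmax"
  unfolding assouad_dim_def
proof (rule Inf_critical_exponent)
  fix s assume s: "exponent3 hmax < s"
  obtain C where C: "\<forall>x R r. x \<in> F \<longrightarrow> 0 < R \<longrightarrow> 0 < r \<longrightarrow>
      ln (real (covering_number (cball x R \<inter> F) r)) \<le> wsum hmax (lev R) (lev r) + C"
    using ln_covering_ball_upper ..
  have "real (covering_number (cball x R \<inter> F) r) \<le> exp (3 * ln (real (card D)) + C) * (R / r) powr s"
    if R: "x \<in> F" "0 < r" "r < R" for x R r
  proof (rule covering_ball_le_expI)
    have "exponent3 hmax * ln (R / r) \<le> s * ln (R / r)"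
      using s R by (intro mult_right_mono) auto
    then show "ln (real (covering_number (cball x R \<inter> F) r)) \<le> s * ln (R / r) + (3 * ln (real (card D)) + C)"
      using C[rule_format, OF R(1) _ R(2), of R] wsum_hmax_le[OF R(2,3)] R by linarith
  qed (use R in auto)
  then show "s \<in> {s. s > 0 \<and> (\<exists>C>0. \<forall>x\<in>F. \<forall>r R. 0 < r \<and> r < R \<longrightarrow>
     real (covering_number (cball x R \<inter> F) r) \<le> C * (R / r) powr s)}"
    using s exponent3_nonneg[of hmax]
    by (intro CollectI conjI exI[of _ "exp (3 * ln (real (card D)) + C)"] allI ballI impI) auto
next
  fix s assume s: "s \<in> {s. s > 0 \<and> (\<exists>C>0. \<forall>x\<in>F. \<forall>r R. 0 < r \<and> r < R \<longrightarrow>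
     real (covering_number (cball x R \<inter> F) r) \<le> C * (R / r) powr s)}"
  obtain \<theta> where \<theta>: "0 < \<theta>" "\<theta> < 1" "lb 1 / lb 2 \<le> \<theta>" "lb 0 / lb 1 \<le> \<theta>" using exists_large_theta .
  from s obtain C where C: "C > 0" "\<forall>x\<in>F. \<forall>r R. 0 < r \<and> r < R \<longrightarrow>
     real (covering_number (cball x R \<inter> F) r) \<le> C * (R / r) powr s"
    by (elim CollectE conjE exE)
  show "exponent3 hmax \<le> s"
  proof (rule assouad_spectrum_exponent_ge[OF \<theta>(1,2) spectral_exponent3[OF \<theta> disjI1[OF refl]] C(1)])
    fix R :: real and x assume "x \<in> F" "0 < R" "R < 1"
    then show "real (covering_number (cball x R \<inter> F) (R powr (1 / \<theta>))) \<le> C * (R / R powr (1 / \<theta>)) powr s"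
      using powr_inverse_less[OF _ _ \<theta>(1,2), of R] by (intro C(2)[rule_format]) auto
  qed
qed

lemma lower_dim_eq: "lower_dim F = exponent3 hmin"
  unfolding lower_dim_def
proof (rule Sup0_critical_exponent)
  show "0 \<le> exponent3 hmin" by (rule exponent3_nonneg) simp
next
  fix s assume s: "0 < s" "s < exponent3 hmin"
  obtain C where C: "\<forall>x R r. x \<in> F \<longrightarrow> 0 < R \<longrightarrow> 0 < r \<longrightarrow>
      wsum hmin (lev R) (lev r) - C \<le> ln (real (covering_number (cball x R \<inter> F) r))"
    using ln_covering_ball_lower ..
  have "exp (- (3 * ln (real (card D)) + C)) * (R / r) powr s \<le> real (covering_number (cball x R \<inter> F) r)"
    if R: "x \<in> F" "0 < r" "r < R" "R < 1" for x R r
  proof (rule covering_ball_ge_expI)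
    have "s * ln (R / r) \<le> exponent3 hmin * ln (R / r)"
      using s R by (intro mult_right_mono) auto
    then show "s * ln (R / r) - (3 * ln (real (card D)) + C) \<le> ln (real (covering_number (cball x R \<inter> F) r))"
      using C[rule_format, OF R(1) _ R(2), of R] wsum_hmin_ge[OF R(2,3,4)] R by linarith
  qed (use R in auto)
  then show "s \<in> {s. s > 0 \<and> (\<exists>C>0. \<forall>x\<in>F. \<forall>r R. 0 < r \<and> r < R \<and> R < 1 \<longrightarrow>
     real (covering_number (cball x R \<inter> F) r) \<ge> C * (R / r) powr s)}"
    using s
    by (intro CollectI conjI exI[of _ "exp (- (3 * ln (real (card D)) + C))"] allI ballI impI) auto
next
  fix s assume s: "s \<in> {s. s > 0 \<and> (\<exists>C>0. \<forall>x\<in>F. \<forall>r R. 0 < r \<and> r < R \<and> R < 1 \<longrightarrow>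
     real (covering_number (cball x R \<inter> F) r) \<ge> C * (R / r) powr s)}"
  obtain \<theta> where \<theta>: "0 < \<theta>" "\<theta> < 1" "lb 1 / lb 2 \<le> \<theta>" "lb 0 / lb 1 \<le> \<theta>" using exists_large_theta .
  from s obtain C where C: "s > 0" "C > 0" "\<forall>x\<in>F. \<forall>r R. 0 < r \<and> r < R \<and> R < 1 \<longrightarrow>
     real (covering_number (cball x R \<inter> F) r) \<ge> C * (R / r) powr s"
    by (elim CollectE conjE exE)
  have "s \<le> exponent3 hmin"
  proof (rule lower_spectrum_exponent_le[OF \<theta>(1,2) spectral_exponent3[OF \<theta> disjI2[OF refl]] C(2)])
    fix R :: real and x assume "x \<in> F" "0 < R" "R < 1"
    then show "C * (R / R powr (1 / \<theta>)) powr s \<le> real (covering_number (cball x R \<inter> F) (R powr (1 / \<theta>)))"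
      using powr_inverse_less[OF _ _ \<theta>(1,2), of R] by (intro C(3)[rule_format]) auto
  qed
  then show "0 < s \<and> s \<le> exponent3 hmin" using C(1) by simp
qed

section \<open>Box dimension\<close>

definition box_exponent :: real where
  "box_exponent = hmax 0 (Suc 0) / lb 0 + (hmax 0 2 - hmax 0 (Suc 0)) / lb 1 + (hmax 0 3 - hmax 0 2) / lb 2"

text \<open>Two points of \<open>F\<close> differ by at most 1 in each coordinate; 3 is the radius
  that the estimate of distances by coordinates then yields.\<close>

lemma F_subset_cball_3: "x \<in> F \<Longrightarrow> cball x 3 \<inter> F = F"
proof -
  assume "x \<in> F"
  then obtain \<omega> where w: "\<omega> \<in> words D" "x = pt \<omega>" by (auto simp: F_eq)
  have "pt ` cyl D (\<lambda>_. 0) \<omega> \<subseteq> cball (pt \<omega>) 3"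
    by (rule cyl_image_subset_cball[OF _ w(1)]) (simp_all add: decreasing_def)
  then show ?thesis unfolding cyl_0 w(2) F_eq by blast
qed

lemma lev_3: "lev 3 q = 0"
proof -
  have "ln (1 / 3) / lb q \<le> (0::real)"
    using ln_base_pos[of q] by (intro divide_nonpos_pos) (auto simp: ln_div)
  then have "\<lfloor>ln (1 / 3) / lb q\<rfloor> \<le> 0" by linarith
  then show ?thesis unfolding lev_def by simp
qed

text \<open>At \<open>R = 3\<close> all coarse levels are 0, so only local counts with no coordinate
  fixed occur, and these do not depend on the letter.\<close>

lemma wsum_lev_3:
  assumes "0 < r" "r < 1"
  shows "\<bar>wsum hmax (lev 3) (lev r) - box_exponent * ln (1 / r)\<bar> \<le> 6 * ln (real (card D))"
proof -
  define t where "t = ln (1 / r)"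
  have m: "\<bar>real (lev r q) - t / lb q\<bar> \<le> 1" for q
    using lev_close[of r q] assms by (simp add: t_def)
  have "wsum hmax (lev 3) (lev r) = (real (lev r 2) - 0) * hmax 0 3
      + (real (lev r 1) - real (lev r 2)) * hmax 0 2 + (real (lev r 0) - real (lev r 1)) * hmax 0 (Suc 0)"
    by (subst wsum_separated) (simp_all add: lev_3 lev_antimono_coord h_trivial)
  moreover have "box_exponent * ln (1 / r) = (t / lb 2 - 0) * hmax 0 3
      + (t / lb 1 - t / lb 2) * hmax 0 2 + (t / lb 0 - t / lb 1) * hmax 0 (Suc 0)"
    unfolding t_def[symmetric] box_exponent_def
    by (simp add: algebra_simps add_divide_distrib diff_divide_distrib)
  ultimately show ?thesis
    using abs_diff_sum3[OF weighted_diff_close[OF m _ h_nonneg(1) h_le(1), of 0 0 2 0 3]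
        weighted_diff_close[OF m m h_nonneg(1) h_le(1), of 1 2 0 2]
        weighted_diff_close[OF m m h_nonneg(1) h_le(1), of 0 1 0 "Suc 0"]] by simp
qed

lemma ln_covering_F:
  "\<exists>C. \<forall>r. 0 < r \<longrightarrow> r < 1 \<longrightarrow> \<bar>ln (real (covering_number F r)) - box_exponent * ln (1 / r)\<bar> \<le> C"
proof -
  obtain C where C: "\<forall>x R r. x \<in> F \<longrightarrow> 0 < R \<longrightarrow> 0 < r \<longrightarrow>
      ln (real (covering_number (cball x R \<inter> F) r)) \<le> wsum hmax (lev R) (lev r) + C"
    using ln_covering_ball_upper ..
  obtain C' where C': "\<forall>R r. 0 < R \<longrightarrow> 0 < r \<longrightarrow> (\<exists>x\<in>F.
      wsum hmax (lev R) (lev r) - C' \<le> ln (real (covering_number (cball x R \<inter> F) r)))"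
    using ln_covering_ball_upper_sharp ..
  have "\<bar>ln (real (covering_number F r)) - box_exponent * ln (1 / r)\<bar>
      \<le> 6 * ln (real (card D)) + (\<bar>C\<bar> + \<bar>C'\<bar>)" if r: "0 < r" "r < 1" for r
  proof -
    have "(0::real) < 3" by simp
    then obtain x where x: "x \<in> F" "wsum hmax (lev 3) (lev r) - C' \<le> ln (real (covering_number (cball x 3 \<inter> F) r))"
      using C'[rule_format, of 3 r] r by blast
    show ?thesis
      using x(2) C[rule_format, OF x(1) \<open>0 < 3\<close> r(1)] wsum_lev_3[OF r]
      unfolding F_subset_cball_3[OF x(1)] by linarith
  qed
  then show ?thesis by (intro exI allI impI)
qed

text \<open>A bounded error in the logarithm vanishes after division by \<open>- ln r\<close>. The
  convergence obtained here is what gives the \<open>Lim\<close> in the definition its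
  value.\<close>

lemma box_dim_eq: "box_dim F = box_exponent"
proof -
  obtain C where C: "\<forall>r. 0 < r \<longrightarrow> r < 1 \<longrightarrow>
      \<bar>ln (real (covering_number F r)) - box_exponent * ln (1 / r)\<bar> \<le> C"
    using ln_covering_F ..
  have at_top: "filterlim (\<lambda>r::real. - ln r) at_top (at_right 0)"
    using ln_at_0 by (simp add: filterlim_uminus_at_top)
  have "((\<lambda>r. ln (real (covering_number F r)) / ln (1 / r) - box_exponent) \<longlongrightarrow> 0) (at_right 0)"
  proof (rule Lim_null_comparison)
    show "((\<lambda>r. C / - ln r) \<longlongrightarrow> 0) (at_right 0)"
      by (rule tendsto_divide_0[OF tendsto_const filterlim_at_top_imp_at_infinity[OF at_top]])
    have "norm (ln (real (covering_number F r)) / ln (1 / r) - box_exponent) \<le> C / - ln r"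
      if r: "0 < r" "r < 1" for r
    proof -
      have t: "0 < ln (1 / r)" using r by simp
      have "ln (real (covering_number F r)) / ln (1 / r) - box_exponent =
          (ln (real (covering_number F r)) - box_exponent * ln (1 / r)) / ln (1 / r)"
        using t by (simp add: diff_divide_distrib)
      then have "norm (ln (real (covering_number F r)) / ln (1 / r) - box_exponent) =
          \<bar>ln (real (covering_number F r)) - box_exponent * ln (1 / r)\<bar> / ln (1 / r)"
        using t by simp
      also have "\<dots> \<le> C / ln (1 / r)"
        using C[rule_format, OF r] t by (intro divide_right_mono) auto
      finally show ?thesis using r by (simp add: ln_div)
    qed
    then show "\<forall>\<^sub>F r in at_right 0. norm (ln (real (covering_number F r)) / ln (1 / r) - box_exponent) \<le> C / - ln r"
      unfolding eventually_at_right_field by (intro exI[of _ 1]) auto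
  qed
  then have "((\<lambda>r. ln (real (covering_number F r)) / ln (1 / r)) \<longlongrightarrow> box_exponent) (at_right 0)"
    by (rule LIM_zero_cancel)
  then show ?thesis
    unfolding box_dim_def by (intro tendsto_Lim trivial_limit_at_right_real)
qed

section \<open>The formulae for the spectra\<close>

lemma ln_ext_ratio:
  "ln (real (ext_max D a b) / real (ext_max D c d)) = hmax a b - hmax c d"
  "ln (real (ext_min D a b) / real (ext_min D c d)) = hmin a b - hmin c d"
  unfolding hmax_def hmin_def using ext_max_pos ext_min_pos by (auto intro: ln_divide_pos)

text \<open>This lets \<open>box_exponent\<close>, which is written with \<open>hmax\<close>, serve
  in \<open>g1\<close> too.\<close>

lemma hmin_0: "hmin 0 b = hmax 0 b"
  by (simp add: hmin_def hmax_def ext_max_0 ext_min_0)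

lemma lb_eqs: "lb 0 = ln (real n1)" "lb 1 = ln (real n2)" "lb 2 = ln (real n3)"
  by (simp_all add: base_def)

lemma exponent_formulas:
  "exponent1 hmax \<theta> = f1 n1 n2 n3 D \<theta>" "exponent2 hmax \<theta> = f2 n1 n2 n3 D \<theta>"
  "exponent1 hmin \<theta> = g1 n1 n2 n3 D \<theta>" "exponent2 hmin \<theta> = g2 n1 n2 n3 D \<theta>"
  unfolding exponent1_def exponent2_def f1_def f2_def g1_def g2_def spectrum_formula1_def
    spectrum_formula2_def box_dim_eq box_exponent_def lb_eqs
  using ln_ext_ratio hmax_def hmin_def ext_max_eqs ext_min_eqs hmin_0 by metis+

end

theorem theorem3p4:
  fixes n1 n2 n3 :: nat and D :: "(nat \<times> nat \<times> nat) set" and F :: "(real^3) set"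
  assumes "2 \<le> n1" and "n1 < n2" and "n2 < n3"
    and "ln (real n1) / ln (real n2) = ln (real n2) / ln (real n3)"
    and "D \<subseteq> {..<n1} \<times> {..<n2} \<times> {..<n3}"
    and "card D \<ge> 2"
    and "F = bm_sponge n1 n2 n3 D"
    and "\<not> uniform_fibres D"
  shows "(\<forall>\<theta>. 0 < \<theta> \<and> \<theta> < 1 \<longrightarrow>
           assouad_spectrum \<theta> F =
             (if \<theta> \<le> ln (real n1) / ln (real n3) then f1 n1 n2 n3 D \<theta>
              else if \<theta> \<le> ln (real n2) / ln (real n3) then f2 n1 n2 n3 D \<theta>
              else assouad_dim F))
       \<and> (\<forall>\<theta>. 0 < \<theta> \<and> \<theta> < 1 \<longrightarrow>
           lower_spectrum \<theta> F =
             (if \<theta> \<le> ln (real n1) / ln (real n3) then g1 n1 n2 n3 D \<theta>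
              else if \<theta> \<le> ln (real n2) / ln (real n3) then g2 n1 n2 n3 D \<theta>
              else lower_dim F))"
proof -
  interpret bm_digits n1 n2 n3 D
    using assms by unfold_locales auto
  \<comment> \<open>The exponents of the last two ranges come with conditions on \<theta> against
    \<open>lb 0 / lb 1\<close>; this equality makes them conditions against the threshold
    \<open>lb 1 / lb 2\<close> of the statement.\<close>
  have ratio: "lb 0 / lb 1 = lb 1 / lb 2" using assms(4) unfolding lb_eqs .
  show ?thesis
    unfolding assms(7)
  proof (intro conjI allI impI; elim conjE)
    fix \<theta> :: real assume \<theta>: "0 < \<theta>" "\<theta> < 1"
    show "assouad_spectrum \<theta> (bm_sponge n1 n2 n3 D) =
        (if \<theta> \<le> ln (real n1) / ln (real n3) then f1 n1 n2 n3 D \<theta>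
         else if \<theta> \<le> ln (real n2) / ln (real n3) then f2 n1 n2 n3 D \<theta>
         else assouad_dim (bm_sponge n1 n2 n3 D))"
      unfolding assouad_dim_eq exponent_formulas[symmetric] lb_eqs[symmetric]
      using assouad_spectrum_eq[OF \<theta> spectral_exponent1[OF \<theta>]]
        assouad_spectrum_eq[OF \<theta> spectral_exponent2[OF \<theta>]]
        assouad_spectrum_eq[OF \<theta> spectral_exponent3[OF \<theta>]] ratio by auto
    show "lower_spectrum \<theta> (bm_sponge n1 n2 n3 D) =
        (if \<theta> \<le> ln (real n1) / ln (real n3) then g1 n1 n2 n3 D \<theta>
         else if \<theta> \<le> ln (real n2) / ln (real n3) then g2 n1 n2 n3 D \<theta>
         else lower_dim (bm_sponge n1 n2 n3 D))"
      unfolding lower_dim_eq exponent_formulas[symmetric] lb_eqs[symmetric]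
      using lower_spectrum_eq[OF \<theta> spectral_exponent1[OF \<theta>]]
        lower_spectrum_eq[OF \<theta> spectral_exponent2[OF \<theta>]]
        lower_spectrum_eq[OF \<theta> spectral_exponent3[OF \<theta>]] ratio by auto
  qed
qed

end
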